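(* Let $n\ge 2$, let $I\subset\mathbb{R}$ be a bounded open interval containing $0$, and let $\psi_i:(0,1]\to(0,\infty)$, $i=1,\dots,n$, be left continuous and increasing (i.e. non-decreasing) functions. Set $\Omega_1:=I$ and define domains $\Omega_i\subset\mathbb{R}^i$, $i=2,\dots,n$, inductively by $$\Omega_i:=\left\{(t,x)\in(0,1)\times\mathbb{R}^{i-1}:\ \frac{x-x_o^{i-1}}{\psi_i(t)}+x_o^{i-1}\in\Omega_{i-1}\right\}\cup\left\{(t,x)\in[1,2)\times\mathbb{R}^{i-1}:\ \frac{x-x_o^{i-1}}{\psi_i(1)}+x_o^{i-1}\in\Omega_{i-1}\right\},$$ where $x_o^{i-1}\in\Omega_{i-1}$ is a star center of $\Omega_{i-1}$. Then $W^{1,p}(\Omega_n)=M^{1,p}(\Omega_n)$ for every $1<p\le\infty$.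
   Context: A domain is a nonempty connected open set. A domain $\Omega\subset\mathbb{R}^m$ is star-shaped if there is a point $x_o\in\Omega$ (a star center) such that for every $x\in\Omega$ the segment $[x,x_o]$ is contained in $\Omega$. (Each $\Omega_i$ in the construction is a star-shaped domain, so a star center exists; any choice of star center is allowed at each step.) For a domain $U\subset\mathbb{R}^m$ and $1\le p\le\infty$, $W^{1,p}(U)$ is the usual first order Sobolev space of all $u\in L^p(U)$ whose weak gradient $\nabla u$ belongs to $L^p(U;\mathbb{R}^m)$. For $u\in L^p(U)$, let $\mathcal{D}_p(u)$ be the class of functions $0\le g\in L^p(U)$ for which there is a set $E\subset U$ of Lebesgue measure zero with $|u(z_1)-u(z_2)|\le|z_1-z_2|\,(g(z_1)+g(z_2))$ for all $z_1,z_2\in U\setminus E$. The Hajłasz-Sobolev space is $M^{1,p}(U):=\{u\in L^p(U):\ \mathcal{D}_p(u)\neq\emptyset\}$. The equality $W^{1,p}(U)=M^{1,p}(U)$ means equality as sets of (a.e.-equivalence classes of) functions. *)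

theory Defs
  imports "HOL-Analysis.Analysis"
begin

section \<open>Lebesgue spaces and the two Sobolev spaces\<close>

text \<open>
  All function spaces consist of functions, not of a.e.-equivalence classes. Each of them is closed
  under changing a function on a null set of \<open>U\<close> and arbitrarily off \<open>U\<close>, so (for measurable \<open>U\<close>)
  equality of two such spaces is the same as equality of the sets of a.e.-classes.
\<close>

definition Lp_space :: "ennreal \<Rightarrow> 'a::euclidean_space set \<Rightarrow> ('a \<Rightarrow> 'b::euclidean_space) set" where
  "Lp_space p U = {f \<in> borel_measurable (lebesgue_on U).
     if p = \<infinity> then \<exists>C. AE x in lebesgue_on U. norm (f x) \<le> C
     else integrable (lebesgue_on U) (\<lambda>x. norm (f x) powr enn2real p)}"

primrec Ck :: "nat \<Rightarrow> ('a::euclidean_space \<Rightarrow> real) \<Rightarrow> bool" where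
  "Ck 0 f \<longleftrightarrow> continuous_on UNIV f"
| "Ck (Suc k) f \<longleftrightarrow> (\<forall>x. f differentiable at x) \<and> (\<forall>v. Ck k (\<lambda>x. frechet_derivative f (at x) v))"

definition test_functions :: "'a::euclidean_space set \<Rightarrow> ('a \<Rightarrow> real) set" where
  "test_functions U = {\<phi>. (\<forall>k. Ck k \<phi>) \<and>
     compact (closure {x. \<phi> x \<noteq> 0}) \<and> closure {x. \<phi> x \<noteq> 0} \<subseteq> U}"

text \<open>
  Used below only for \<open>u\<close> and \<open>G\<close> in \<open>L\<^sup>p(U)\<close> with \<open>p \<ge> 1\<close>, where all the integrands are integrable.
\<close>

definition weak_gradient :: "'a::euclidean_space set \<Rightarrow> ('a \<Rightarrow> real) \<Rightarrow> ('a \<Rightarrow> 'a) \<Rightarrow> bool" where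
  "weak_gradient U u G \<longleftrightarrow> (\<forall>\<phi>\<in>test_functions U. \<forall>b\<in>Basis.
     (LINT x|lebesgue_on U. u x * frechet_derivative \<phi> (at x) b) =
     - (LINT x|lebesgue_on U. (G x \<bullet> b) * \<phi> x))"

definition sobolev_W1 :: "ennreal \<Rightarrow> 'a::euclidean_space set \<Rightarrow> ('a \<Rightarrow> real) set" where
  "sobolev_W1 p U = {u \<in> Lp_space p U. \<exists>G\<in>Lp_space p U. weak_gradient U u G}"

definition hajlasz_gradients ::
  "ennreal \<Rightarrow> 'a::euclidean_space set \<Rightarrow> ('a \<Rightarrow> real) \<Rightarrow> ('a \<Rightarrow> real) set" where
  "hajlasz_gradients p U u = {g \<in> Lp_space p U. (\<forall>z\<in>U. 0 \<le> g z) \<and>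
     (\<exists>E. E \<subseteq> U \<and> E \<in> null_sets lebesgue \<and>
       (\<forall>z1\<in>U - E. \<forall>z2\<in>U - E. \<bar>u z1 - u z2\<bar> \<le> norm (z1 - z2) * (g z1 + g z2)))}"

definition hajlasz_M1 :: "ennreal \<Rightarrow> 'a::euclidean_space set \<Rightarrow> ('a \<Rightarrow> real) set" where
  "hajlasz_M1 p U = {u \<in> Lp_space p U. hajlasz_gradients p U u \<noteq> {}}"

section \<open>The iterated cuspidal domains\<close>

text \<open>
  Since the dimension changes along the construction, a point of \<open>\<real>\<^sup>i\<close> is a list of length \<open>i\<close>, and
  \<open>(t, x)\<close> with \<open>x \<in> \<real>\<^sup>i\<close> is \<open>t # x\<close>. As \<^const>\<open>map2\<close> truncates, it is only meaningful on lists of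
  equal length, hence the explicit length condition in \<open>Omega\<close>.
\<close>

definition star_center :: "real list set \<Rightarrow> real list \<Rightarrow> bool" where
  "star_center S a \<longleftrightarrow> a \<in> S \<and>
     (\<forall>x\<in>S. \<forall>s\<in>{0..1}. map2 (\<lambda>xj aj. (1 - s) * xj + s * aj) x a \<in> S)"

definition rescale :: "real \<Rightarrow> real list \<Rightarrow> real list \<Rightarrow> real list" where
  "rescale r a x = map2 (\<lambda>xj aj. (xj - aj) / r + aj) x a"

text \<open>
  \<open>c i\<close> is the point of \<open>\<real>\<^sup>i\<close> with respect to which \<open>Omega I \<psi> c i\<close> is rescaled; the index \<open>0\<close> is
  not used.
\<close>

fun Omega ::
  "real set \<Rightarrow> (nat \<Rightarrow> real \<Rightarrow> real) \<Rightarrow> (nat \<Rightarrow> real list) \<Rightarrow> nat \<Rightarrow> real list set" where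
  "Omega I \<psi> c 0 = {}"
| "Omega I \<psi> c (Suc 0) = {[x] | x. x \<in> I}"
| "Omega I \<psi> c (Suc (Suc k)) =
     {t # x | t x. t \<in> {0<..<1} \<and> length x = Suc k \<and>
        rescale (\<psi> (Suc (Suc k)) t) (c (Suc k)) x \<in> Omega I \<psi> c (Suc k)} \<union>
     {t # x | t x. t \<in> {1..<2} \<and> length x = Suc k \<and>
        rescale (\<psi> (Suc (Suc k)) 1) (c (Suc k)) x \<in> Omega I \<psi> c (Suc k)}"

text \<open>
  The subset of \<open>real ^ 'n\<close> corresponding to a set of lists of length \<open>CARD('n)\<close>, when \<open>e\<close> enumerates
  the index type.
\<close>

definition vectors_of :: "(nat \<Rightarrow> 'n::finite) \<Rightarrow> real list set \<Rightarrow> (real ^ 'n) set" where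
  "vectors_of e S = {z. map (\<lambda>j. z $ e j) [0..<CARD('n)] \<in> S}"

end

theory Submission
  imports Defs
begin

text \<open>
  A function satisfying the pointwise inequality with \<open>g\<close> has difference quotients dominated by
  translates of \<open>g\<close>, hence of the form \<open>g \<cdot> \<theta>\<close> with \<open>\<theta>\<close> bounded after moving the translations to the
  test function; a weak limit of the \<open>\<theta>\<close> gives the weak gradient.

  Conversely, the slices of the domain grow with the first coordinate, as the smaller domain is
  star-shaped and \<open>\<psi>\<close> is increasing. Two points at distance \<open>d\<close> can therefore be moved along the first
  coordinate to a common slice, with a choice of slices of total length comparable to \<open>d\<close>. Averaging
  over this choice and arguing by induction on the number of differing coordinates bounds the
  difference quotient by \<open>M\<^sub>n (|\<nabla>u| + M\<^sub>n\<^sub>-\<^sub>1 (|\<nabla>u| + \<dots>))\<close>, where \<open>M\<^sub>i\<close> is the one-dimensional maximal function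
  along the \<open>i\<close>-th coordinate, which is bounded on \<open>L\<^sup>p\<close> for \<open>p > 1\<close>.
\<close>

text \<open>A ball centred in a cusp may meet the domain in a tiny fraction of its volume, so
  nothing is averaged over balls: only coordinate segments inside the domain are used, and functions
  are extended by 0 outside. Averaging over slices is forced twice: the induction hypothesis holds
  off a null set, which one chosen slice may hit, and the previous bound \<open>g\<close> at a moved
  point is controlled only through its mean along a segment. The delicate point is the length of the
  interval of slices. Fixing the first \<open>i\<close> coordinates leaves an affine copy of a
  lower-dimensional domain, scaled by a factor \<open>r\<close> that may be arbitrarily small, so
  only about min(d, r) of room is available. But points agreeing in those coordinates lie in the
  same copy, hence d is at most \<open>r\<close> times a uniform diameter \<open>L\<close>, and
  there is room d / (2 L). This dictates the order: the outermost coordinate is equalised first. In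
  the other inclusion the factors \<theta> are bounded, so the weak limit is taken in L^2 of the
  finite measure g dx, which serves every p at once, infinity included.\<close>

lemmas LBINT_cong = Bochner_Integration.integral_cong
lemmas LBINT_bound = Bochner_Integration.integrable_bound

section \<open>Translation invariance of Lebesgue measure\<close>

lemma lborel_distr_plus_right: "distr lborel borel (\<lambda>x. x + c) = (lborel :: 'a::euclidean_space measure)"
proof -
  have "(\<lambda>x. x + c) = (+) c" by (auto simp: add.commute)
  then show ?thesis by (simp add: lborel_distr_plus)
qed

lemma nn_integral_translation:
  fixes f :: "'a::euclidean_space \<Rightarrow> ennreal"
  assumes [measurable]: "f \<in> borel_measurable borel"
  shows "(\<integral>\<^sup>+x. f (x + c) \<partial>lborel) = (\<integral>\<^sup>+x. f x \<partial>lborel)"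
  by (subst (2) lborel_distr_plus_right[of c, symmetric], subst nn_integral_distr) auto

lemma integral_translation:
  fixes f :: "'a::euclidean_space \<Rightarrow> real"
  assumes [measurable]: "f \<in> borel_measurable borel"
  shows "(LBINT x. f (x + c)) = (LBINT x. f x)"
  by (subst (2) lborel_distr_plus_right[of c, symmetric], subst integral_distr) auto

lemma integrable_translation:
  fixes f :: "'a::euclidean_space \<Rightarrow> real"
  assumes f: "integrable lborel f"
  shows "integrable lborel (\<lambda>x. f (x + c))"
proof -
  have [measurable]: "f \<in> borel_measurable borel" using f by auto
  have "integrable (distr lborel borel (\<lambda>x. x + c)) f"
    using f by (simp add: lborel_distr_plus_right)
  then show ?thesis by (subst (asm) integrable_distr_eq) auto
qed

lemma AE_translation:
  fixes c :: "'a::euclidean_space"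
  assumes "AE x in lborel. P x"
  shows "AE x in lborel. P (x + c)"
proof -
  obtain N where N: "N \<in> null_sets lborel" "{x. \<not> P x} \<subseteq> N"
    using assms by (auto simp: eventually_ae_filter)
  have "AE x in distr lborel borel (\<lambda>x. x + c). x \<notin> N"
    using N(1) by (simp add: lborel_distr_plus_right AE_not_in)
  then have "AE x in lborel. x + c \<notin> N"
    using N(1) by (subst (asm) AE_distr_iff) auto
  then show ?thesis by eventually_elim (use N(2) in auto)
qed

section \<open>Smooth product bumps\<close>

lemma Ck_Suc_imp_Ck: "Ck (Suc k) f \<Longrightarrow> Ck k f"
proof (induction k arbitrary: f)
  case 0
  then show ?case
    by (auto intro!: continuous_at_imp_continuous_on differentiable_imp_continuous_within)
next
  case (Suc k)
  then show ?case by (metis Ck.simps(2))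
qed

lemma Ck_const: "Ck k (\<lambda>x. c)"
  by (induction k arbitrary: c) auto

lemma Ck_add: "Ck k f \<Longrightarrow> Ck k g \<Longrightarrow> Ck k (\<lambda>x. f x + g x)"
proof (induction k arbitrary: f g)
  case (Suc k)
  have "frechet_derivative (\<lambda>x. f x + g x) (at x) v =
      frechet_derivative f (at x) v + frechet_derivative g (at x) v" for x v
  proof -
    have "((\<lambda>x. f x + g x) has_derivative
        (\<lambda>v. frechet_derivative f (at x) v + frechet_derivative g (at x) v)) (at x)"
      using Suc.prems by (intro has_derivative_add) (simp_all add: frechet_derivative_works[symmetric])
    from fun_cong[OF frechet_derivative_at[OF this], of v] show ?thesis by simp
  qed
  with Suc show ?case by (simp add: differentiable_add)
qed (auto intro: continuous_on_add)

lemma Ck_mult: "Ck k f \<Longrightarrow> Ck k g \<Longrightarrow> Ck k (\<lambda>x. f x * g x)"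
proof (induction k arbitrary: f g)
  case (Suc k)
  have d: "frechet_derivative (\<lambda>x. f x * g x) (at x) v =
      f x * frechet_derivative g (at x) v + frechet_derivative f (at x) v * g x" for x v
  proof -
    have "((\<lambda>x. f x * g x) has_derivative
        (\<lambda>v. f x * frechet_derivative g (at x) v + frechet_derivative f (at x) v * g x)) (at x)"
      using Suc.prems by (intro has_derivative_mult) (simp_all add: frechet_derivative_works[symmetric])
    from fun_cong[OF frechet_derivative_at[OF this], of v] show ?thesis by simp
  qed
  have "Ck k f" "Ck k g" using Suc.prems Ck_Suc_imp_Ck by blast+
  with Suc show ?case by (auto simp: d intro!: Ck_add differentiable_mult)
qed (auto intro: continuous_on_mult)

lemma Ck_diff: "Ck k f \<Longrightarrow> Ck k g \<Longrightarrow> Ck k (\<lambda>x. f x - g x)"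
  using Ck_add[of k f "\<lambda>x. (-1) * g x"] Ck_mult[OF Ck_const, of k g "-1"] by simp

lemma Ck_power: "Ck k f \<Longrightarrow> Ck k (\<lambda>x. f x ^ m)"
  by (induction m) (auto intro: Ck_const Ck_mult)

lemma Ck_prod: "(\<And>i. i \<in> A \<Longrightarrow> Ck k (f i)) \<Longrightarrow> Ck k (\<lambda>x. \<Prod>i\<in>A. f i x)"
  by (induction A rule: infinite_finite_induct) (auto intro: Ck_const Ck_mult)

text \<open>A derivative in direction \<open>v\<close> is again a function of
  \<open>x \<bullet> b + c\<close>, namely the derivative of \<open>f\<close> applied to the
  constant \<open>v \<bullet> b\<close>. So the induction closes once \<open>f\<close> is
  arbitrary.\<close>

lemma Ck_compose_inner:
  fixes f :: "real \<Rightarrow> real" and b :: "'a::euclidean_space"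
  shows "Ck k f \<Longrightarrow> Ck k (\<lambda>x. f (x \<bullet> b + c))"
proof (induction k arbitrary: f)
  case 0
  then have "continuous_on UNIV f" by simp
  moreover have "continuous_on UNIV (\<lambda>x. x \<bullet> b + c)"
    by (intro continuous_intros)
  ultimately show ?case
    unfolding Ck.simps by (rule continuous_on_compose2) simp
next
  case (Suc k)
  have D: "((\<lambda>x. f (x \<bullet> b + c)) has_derivative
      (\<lambda>v. frechet_derivative f (at (x \<bullet> b + c)) (v \<bullet> b))) (at x)" for x
  proof -
    have "(f has_derivative frechet_derivative f (at (x \<bullet> b + c))) (at (x \<bullet> b + c))"
      using Suc.prems[unfolded Ck.simps] frechet_derivative_works by blast
    moreover have "((\<lambda>x. x \<bullet> b + c) has_derivative (\<lambda>v. v \<bullet> b)) (at x)"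
      by (intro has_derivative_add_const bounded_linear_imp_has_derivative bounded_linear_inner_left)
    ultimately show ?thesis
      using has_derivative_compose by blast
  qed
  have fd: "frechet_derivative (\<lambda>x. f (x \<bullet> b + c)) (at x) v =
      frechet_derivative f (at (x \<bullet> b + c)) (v \<bullet> b)" for x v
    by (metis frechet_derivative_at[OF D])
  show ?case
    unfolding Ck.simps fd using differentiableI[OF D] Suc.IH Suc.prems[unfolded Ck.simps] by blast
qed

lemma has_field_derivative_frechet:
  fixes f :: "real \<Rightarrow> real"
  assumes "(f has_field_derivative d) (at x)"
  shows "frechet_derivative f (at x) v = d * v"
  using fun_cong[OF frechet_derivative_at[OF assms[unfolded has_field_derivative_def]], of v] by simp

lemma Ck_Suc_real:
  fixes f :: "real \<Rightarrow> real"
  assumes "\<And>x. (f has_field_derivative f' x) (at x)" and "Ck k f'"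
  shows "Ck (Suc k) f"
proof -
  have "frechet_derivative f (at x) v = f' x * v" for x v
    by (rule has_field_derivative_frechet[OF assms(1)])
  then show ?thesis
    using Ck_mult[OF assms(2) Ck_const] differentiableI[OF assms(1)[unfolded has_field_derivative_def]]
    by simp
qed

text \<open>This is exp(-1/x) x^(-m), extended by 0. The whole family in \<open>m\<close> is defined
  because differentiation maps it into its own span, so that smoothness becomes a single induction
  on the order with \<open>m\<close> arbitrary.\<close>

definition flat_exp :: "nat \<Rightarrow> real \<Rightarrow> real" where
  "flat_exp m x = (if x > 0 then exp (- inverse x) * inverse x ^ m else 0)"

lemma flat_exp_tendsto_0: "(flat_exp m \<longlongrightarrow> 0) (at 0)"
proof -
  have "((\<lambda>x. inverse x ^ m / exp (inverse x)) \<longlongrightarrow> (0::real)) (at_right 0)"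
    using tendsto_power_div_exp_0 filterlim_inverse_at_top_right
    by (rule filterlim_compose)
  then have "(flat_exp m \<longlongrightarrow> 0) (at_right 0)"
    by (rule Lim_transform_eventually)
      (auto simp: eventually_at_filter flat_exp_def exp_minus field_simps)
  moreover have "(flat_exp m \<longlongrightarrow> 0) (at_left 0)"
    by (rule Lim_transform_eventually[OF tendsto_const])
      (auto simp: eventually_at_filter flat_exp_def)
  ultimately show ?thesis by (simp add: filterlim_split_at)
qed

lemma flat_exp_has_derivative:
  "(flat_exp m has_field_derivative
     flat_exp (m + 2) x - real m * flat_exp (m + 1) x) (at x)"
proof (cases x "0::real" rule: linorder_cases)
  case less
  have "((\<lambda>x. 0) has_field_derivative 0) (at x)" by simp
  then have "(flat_exp m has_field_derivative 0) (at x)"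
    by (rule has_field_derivative_transform_within_open[of _ _ _ "{..<0}"])
      (use less in \<open>auto simp: flat_exp_def\<close>)
  then show ?thesis using less by (simp add: flat_exp_def)
next
  case equal
  \<comment> \<open>The difference quotient of \<open>flat_exp m\<close> at 0 is exactly
    \<open>flat_exp (m + 1)\<close>.\<close>
  have "((\<lambda>h. flat_exp (m + 1) h) \<longlongrightarrow> 0) (at 0)" by (rule flat_exp_tendsto_0)
  then have "((\<lambda>h. (flat_exp m (0 + h) - flat_exp m 0) / h) \<longlongrightarrow> 0) (at 0)"
    by (rule Lim_transform_eventually)
      (auto simp: eventually_at_filter flat_exp_def field_simps)
  then show ?thesis using equal by (simp add: DERIV_def flat_exp_def)
next
  case greater
  \<comment> \<open>For \<open>m = 0\<close> the exponent \<open>m - Suc 0\<close> truncates, but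
    then the factor \<open>real m\<close> vanishes.\<close>
  have "real m * (inverse x ^ (m - Suc 0) * (inverse x * inverse x)) = real m * (inverse x * inverse x ^ m)"
    by (cases m) auto
  then have "((\<lambda>x. exp (- inverse x) * inverse x ^ m) has_field_derivative
      flat_exp (m + 2) x - real m * flat_exp (m + 1) x) (at x)"
    using greater by (auto intro!: derivative_eq_intros simp: flat_exp_def algebra_simps)
  then show ?thesis
    by (rule has_field_derivative_transform_within_open[of _ _ _ "{0<..}"])
      (use greater in \<open>auto simp: flat_exp_def\<close>)
qed

lemma Ck_flat_exp: "Ck k (flat_exp m)"
proof (induction k arbitrary: m)
  case 0
  then show ?case
    using flat_exp_has_derivative
    by (auto intro!: continuous_at_imp_continuous_on DERIV_isCont)
next
  case (Suc k)
  show ?case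
    by (rule Ck_Suc_real[OF flat_exp_has_derivative]) (intro Ck_diff Ck_mult Ck_const Suc)
qed

text \<open>With a = \<open>flat_exp 0 (y - l) * flat_exp 0 (r - y)\<close> this is 1 - (1 - a)^k, a
  polynomial in a without constant term. It is smooth, takes values in [0, 1], vanishes where a
  does, and tends to 1 where 0 < a, that is, on the open interval. So smooth functions approximate
  the indicator boundedly, with supports that do not depend on \<open>k\<close>.\<close>

definition bump :: "real \<Rightarrow> real \<Rightarrow> nat \<Rightarrow> real \<Rightarrow> real" where
  "bump l r k y = 1 - (1 - flat_exp 0 (y - l) * flat_exp 0 (r - y)) ^ k"

lemma Ck_bump: "Ck j (bump l r k)"
proof -
  have 1: "Ck j (\<lambda>y. flat_exp 0 (y - l))"
    using Ck_compose_inner[OF Ck_flat_exp, of j 0 "1::real" "-l"] by simp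
  have 2: "Ck j (\<lambda>y. flat_exp 0 (r - y))"
    using Ck_compose_inner[OF Ck_flat_exp, of j 0 "-1::real" "r"] by simp
  show ?thesis unfolding bump_def by (intro Ck_diff Ck_const Ck_power Ck_mult 1 2)
qed

lemma flat_exp_0_bounds: "0 \<le> flat_exp 0 x" "flat_exp 0 x \<le> 1" "x > 0 \<Longrightarrow> 0 < flat_exp 0 x"
  by (auto simp: flat_exp_def)

lemma bump_bounds: "0 \<le> bump l r k y" "bump l r k y \<le> 1"
proof -
  have "0 \<le> flat_exp 0 (y - l) * flat_exp 0 (r - y)" "flat_exp 0 (y - l) * flat_exp 0 (r - y) \<le> 1"
    using flat_exp_0_bounds by (auto intro: mult_le_one)
  then show "0 \<le> bump l r k y" "bump l r k y \<le> 1"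
    unfolding bump_def by (auto intro: power_le_one)
qed

lemma bump_eq_0: "y \<notin> {l<..<r} \<Longrightarrow> bump l r k y = 0"
  by (auto simp: bump_def flat_exp_def)

lemma bump_tendsto_1:
  assumes "y \<in> {l<..<r}"
  shows "(\<lambda>k. bump l r k y) \<longlonglongrightarrow> 1"
proof -
  define a where "a = flat_exp 0 (y - l) * flat_exp 0 (r - y)"
  have "0 < a" "a \<le> 1"
    using flat_exp_0_bounds assms by (auto simp: a_def intro: mult_le_one)
  then have "(\<lambda>k. (1 - a) ^ k) \<longlonglongrightarrow> 0" by (intro LIMSEQ_power_zero) auto
  from tendsto_diff[OF tendsto_const this, of 1] show ?thesis
    unfolding bump_def a_def by simp
qed

lemma product_test_function:
  fixes U :: "'a::euclidean_space set" and \<eta> :: "'a \<Rightarrow> real \<Rightarrow> real"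
  assumes "\<And>j k. j \<in> Basis \<Longrightarrow> Ck k (\<eta> j)"
    and "\<And>j y. j \<in> Basis \<Longrightarrow> y \<notin> {l \<bullet> j..r \<bullet> j} \<Longrightarrow> \<eta> j y = 0"
    and "cbox l r \<subseteq> U"
  shows "(\<lambda>x. \<Prod>j\<in>Basis. \<eta> j (x \<bullet> j)) \<in> test_functions U"
proof -
  let ?\<phi> = "\<lambda>x::'a. \<Prod>j\<in>Basis. \<eta> j (x \<bullet> j)"
  have "{x. ?\<phi> x \<noteq> 0} \<subseteq> cbox l r"
    using assms(2) by (auto simp: mem_box prod_zero_iff)+
  then have "closure {x. ?\<phi> x \<noteq> 0} \<subseteq> cbox l r"
    by (intro closure_minimal) auto
  moreover from this have "compact (closure {x. ?\<phi> x \<noteq> 0})"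
    unfolding compact_eq_bounded_closed by (auto intro: bounded_subset[OF bounded_cbox])
  moreover have "Ck k ?\<phi>" for k
    by (intro Ck_prod) (use Ck_compose_inner[OF assms(1), where c = 0] in simp)
  ultimately show ?thesis using assms(3) by (auto simp: test_functions_def)
qed

lemma product_directional_derivative:
  fixes \<eta> :: "'a::euclidean_space \<Rightarrow> real \<Rightarrow> real"
  assumes b: "b \<in> Basis"
    and d: "\<And>j x. j \<in> Basis \<Longrightarrow> \<eta> j differentiable (at x)"
    and b': "\<And>x. (\<eta> b has_field_derivative \<eta>' x) (at x)"
  shows "frechet_derivative (\<lambda>x. \<Prod>j\<in>Basis. \<eta> j (x \<bullet> j)) (at x) b =
    \<eta>' (x \<bullet> b) * (\<Prod>j\<in>Basis - {b}. \<eta> j (x \<bullet> j))"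
proof -
  let ?D = "\<lambda>j. frechet_derivative (\<eta> j) (at (x \<bullet> j))"
  have D: "((\<lambda>x. \<eta> j (x \<bullet> j)) has_derivative (\<lambda>v. ?D j (v \<bullet> j))) (at x)" if "j \<in> Basis" for j
  proof -
    have "((\<lambda>x. x \<bullet> j) has_derivative (\<lambda>v. v \<bullet> j)) (at x)"
      by (auto intro!: derivative_eq_intros)
    moreover have "(\<eta> j has_derivative ?D j) (at (x \<bullet> j))"
      using d[OF that] by (simp add: frechet_derivative_works[symmetric])
    ultimately show ?thesis by (rule has_derivative_compose)
  qed
  have z: "?D j 0 = 0" if "j \<in> Basis" for j
    using linear_0[OF linear_frechet_derivative[OF d[OF that]]] .
  have "((\<lambda>x. \<Prod>j\<in>Basis. \<eta> j (x \<bullet> j)) has_derivative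
      (\<lambda>v. \<Sum>i\<in>Basis. ?D i (v \<bullet> i) * (\<Prod>j\<in>Basis - {i}. \<eta> j (x \<bullet> j)))) (at x)"
    by (rule has_derivative_prod) (rule D)
  from fun_cong[OF frechet_derivative_at[OF this], of b]
  have "frechet_derivative (\<lambda>x. \<Prod>j\<in>Basis. \<eta> j (x \<bullet> j)) (at x) b =
      (\<Sum>i\<in>Basis. ?D i (b \<bullet> i) * (\<Prod>j\<in>Basis - {i}. \<eta> j (x \<bullet> j)))" by simp
  \<comment> \<open>In the product rule every factor with \<open>i \<noteq> b\<close> is
    differentiated in the direction \<open>b \<bullet> i = 0\<close>.\<close>
  also have "\<dots> = (\<Sum>i\<in>{b}. ?D i (b \<bullet> i) * (\<Prod>j\<in>Basis - {i}. \<eta> j (x \<bullet> j)))"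
    using b z by (intro sum.mono_neutral_right) (auto simp: inner_not_same_Basis)
  also have "\<dots> = \<eta>' (x \<bullet> b) * (\<Prod>j\<in>Basis - {b}. \<eta> j (x \<bullet> j))"
    using has_field_derivative_frechet[OF b'] b by simp
  finally show ?thesis .
qed

section \<open>The fundamental lemma for product bumps\<close>

definition product_bump :: "'a::euclidean_space \<Rightarrow> 'a \<Rightarrow> nat \<Rightarrow> 'a \<Rightarrow> real" where
  "product_bump l r k x = (\<Prod>j\<in>Basis. bump (l \<bullet> j) (r \<bullet> j) k (x \<bullet> j))"

lemma continuous_on_bump: "continuous_on A (bump l r k)"
  using Ck_bump[of 0 l r k] continuous_on_subset by auto

lemma borel_measurable_bump [measurable]: "bump l r k \<in> borel_measurable borel"
  by (rule borel_measurable_continuous_onI[OF continuous_on_bump])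

lemma borel_measurable_product_bump [measurable]: "product_bump l r k \<in> borel_measurable borel"
  unfolding product_bump_def[abs_def] by measurable

lemma product_bump_bounds: "0 \<le> product_bump l r k x" "product_bump l r k x \<le> 1"
  unfolding product_bump_def by (auto intro!: prod_nonneg prod_le_1 bump_bounds)

lemma abs_product_bump_le_1: "\<bar>product_bump l r k x\<bar> \<le> 1"
  using product_bump_bounds[of l r k x] by simp

lemma product_bump_tendsto: "(\<lambda>k. product_bump l r k x) \<longlonglongrightarrow> indicator (box l r) x"
proof (cases "x \<in> box l r")
  case True
  then have "(\<lambda>k. product_bump l r k x) \<longlonglongrightarrow> (\<Prod>j\<in>(Basis::'a set). 1)"
    unfolding product_bump_def by (intro tendsto_prod bump_tendsto_1) (auto simp: mem_box)
  then show ?thesis using True by simp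
next
  case False
  then obtain j where "j \<in> Basis" "x \<bullet> j \<notin> {l \<bullet> j<..<r \<bullet> j}" by (auto simp: mem_box)
  then have "product_bump l r k x = 0" for k
    using bump_eq_0[of "x \<bullet> j" "l \<bullet> j" "r \<bullet> j" k] by (auto simp: product_bump_def)
  then show ?thesis using False by simp
qed

text \<open>The positive and the negative part of \<open>W\<close> on the box are densities of two
  finite measures. These agree on all boxes, a generator stable under intersection, hence they
  coincide, and so do their densities almost everywhere.\<close>

lemma AE_zero_on_box:
  fixes W :: "'a::euclidean_space \<Rightarrow> real"
  assumes W: "integrable lborel W"
    and z: "\<And>a b. box a b \<subseteq> box l r \<Longrightarrow> (LBINT x. indicator (box a b) x * W x) = 0"
  shows "AE x in lborel. x \<in> box l r \<longrightarrow> W x = 0"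
proof -
  have [measurable]: "W \<in> borel_measurable borel" using W by auto
  define P where "P = density lborel (\<lambda>x. ennreal (max 0 (W x)) * indicator (box l r) x)"
  define N where "N = density lborel (\<lambda>x. ennreal (max 0 (- W x)) * indicator (box l r) x)"
  have fin: "emeasure P A < \<infinity>" if [measurable]: "A \<in> sets borel" for A
  proof -
    have "emeasure P A \<le> (\<integral>\<^sup>+x. ennreal \<bar>W x\<bar> \<partial>lborel)"
      unfolding P_def by (subst emeasure_density)
        (auto intro!: nn_integral_mono ennreal_leI split: split_indicator)
    also have "\<dots> < \<infinity>" using W unfolding integrable_iff_bounded by simp
    finally show ?thesis .
  qed
  have eq: "emeasure P (box a b) = emeasure N (box a b)" for a b
  proof -
    obtain c d where cd: "box a b \<inter> box l r = box c d" by (rule that[OF box_Int_box])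
    have i: "integrable lborel (\<lambda>x. indicator (box c d) x * max 0 (W x))"
      "integrable lborel (\<lambda>x. indicator (box c d) x * max 0 (- W x))"
      by (rule LBINT_bound[OF W]; force split: split_indicator)+
    have "(LBINT x. indicator (box c d) x * max 0 (W x)) -
        (LBINT x. indicator (box c d) x * max 0 (- W x)) =
        (LBINT x. indicator (box c d) x * W x)"
      unfolding Bochner_Integration.integral_diff[OF i, symmetric]
      by (rule LBINT_cong) (auto split: split_indicator)
    also have "\<dots> = 0" using z[of c d] cd by blast
    finally have e: "(LBINT x. indicator (box c d) x * max 0 (W x)) =
        (LBINT x. indicator (box c d) x * max 0 (- W x))" by simp
    have "emeasure P (box a b) = (\<integral>\<^sup>+x. ennreal (indicator (box c d) x * max 0 (W x)) \<partial>lborel)"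
      unfolding P_def cd[symmetric] by (subst emeasure_density)
        (auto intro!: nn_integral_cong split: split_indicator)
    also have "\<dots> = ennreal (LBINT x. indicator (box c d) x * max 0 (W x))"
      by (rule nn_integral_eq_integral[OF i(1)]) (auto split: split_indicator)
    also have "\<dots> = (\<integral>\<^sup>+x. ennreal (indicator (box c d) x * max 0 (- W x)) \<partial>lborel)"
      unfolding e by (rule nn_integral_eq_integral[OF i(2), symmetric]) (auto split: split_indicator)
    also have "\<dots> = emeasure N (box a b)"
      unfolding N_def cd[symmetric] by (subst emeasure_density)
        (auto intro!: nn_integral_cong split: split_indicator)
    finally show ?thesis .
  qed
  have "P = N"
  proof (rule measure_eqI_generator_eq[where \<Omega> = UNIV and E = "range (\<lambda>(a, b). box a b)"
        and A = "\<lambda>n. box (- (real n *\<^sub>R One)) (real n *\<^sub>R One)"])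
    show "Int_stable (range (\<lambda>(a, b). box a b :: 'a set))"
      by (auto simp: Int_stable_def box_Int_box)
    show "sets P = sigma_sets UNIV (range (\<lambda>(a, b). box a b))"
      "sets N = sigma_sets UNIV (range (\<lambda>(a, b). box a b))"
      by (simp_all add: P_def N_def borel_eq_box)
    show "(\<Union>i. box (- (real i *\<^sub>R One)) (real i *\<^sub>R One)) = (UNIV :: 'a set)"
      by (rule UN_box_eq_UNIV)
    show "emeasure P (box (- (real i *\<^sub>R One)) (real i *\<^sub>R One)) \<noteq> \<infinity>" for i
      using fin[of "box (- (real i *\<^sub>R One)) (real i *\<^sub>R One)"] by auto
  qed (auto simp: eq)
  then have "AE x in lborel. ennreal (max 0 (W x)) * indicator (box l r) x =
      ennreal (max 0 (- W x)) * indicator (box l r) x"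
    unfolding P_def N_def by (intro sigma_finite_measure.density_unique_iff[OF lborel.sigma_finite_measure_axioms, THEN iffD1]) auto
  then show ?thesis
    by eventually_elim (auto simp: max_def split: if_splits)
qed

text \<open>Dominated convergence in \<open>k\<close> turns the product bumps into indicators of
  boxes. The open set is a countable union of closed boxes, whose boundaries are null sets.\<close>

lemma AE_zero_on_open:
  fixes W :: "'a::euclidean_space \<Rightarrow> real"
  assumes W: "integrable lborel W" and "open V"
    and z: "\<And>l r k. cbox l r \<subseteq> V \<Longrightarrow> box l r \<noteq> {} \<Longrightarrow> (LBINT x. product_bump l r k x * W x) = 0"
  shows "AE x in lborel. x \<in> V \<longrightarrow> W x = 0"
proof -
  have [measurable]: "W \<in> borel_measurable borel" using W by auto
  have box0: "(LBINT x. indicator (box l r) x * W x) = 0" if "cbox l r \<subseteq> V" for l r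
  proof (cases "box l r = {}")
    case False
    have "(\<lambda>k. LBINT x. product_bump l r k x * W x) \<longlonglongrightarrow>
        (LBINT x. indicator (box l r) x * W x)"
    proof (rule integral_dominated_convergence[where w = "\<lambda>x. \<bar>W x\<bar>"])
      show "AE x in lborel. (\<lambda>k. product_bump l r k x * W x) \<longlonglongrightarrow> indicator (box l r) x * W x"
        by (intro AE_I2 tendsto_mult product_bump_tendsto tendsto_const)
      show "AE x in lborel. norm (product_bump l r k x * W x) \<le> \<bar>W x\<bar>" for k
        by (auto simp: abs_mult intro!: mult_left_le_one_le abs_product_bump_le_1)
    qed (use W in auto)
    moreover have "(LBINT x. product_bump l r k x * W x) = 0" for k
      by (rule z[OF that False])
    ultimately show ?thesis by (simp add: LIMSEQ_const_iff)
  qed simp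
  obtain D where D: "countable D" "\<And>X. X \<in> D \<Longrightarrow> X \<subseteq> V" "\<And>X. X \<in> D \<Longrightarrow> \<exists>a b. X = cbox a b" "\<Union>D = V"
    by (rule open_countable_Union_open_cbox[OF \<open>open V\<close>]) (blast intro: that)
  have "AE x in lborel. x \<in> X \<longrightarrow> W x = 0" if X: "X \<in> D" for X
  proof -
    obtain l r where lr: "X = cbox l r" using D(3)[OF X] by blast
    have "AE x in lborel. x \<in> box l r \<longrightarrow> W x = 0"
    proof (rule AE_zero_on_box[OF W])
      fix a b assume ab: "box a b \<subseteq> box l r"
      show "(LBINT x. indicator (box a b) x * W x) = 0"
      proof (cases "box a b = {}")
        case False
        with ab have "cbox a b \<subseteq> cbox l r"
          using closure_mono[OF ab] closure_box[of a b] closure_minimal[OF box_subset_cbox closed_cbox, of l r]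
          by simp
        then show ?thesis using box0 D(2)[OF X] lr by blast
      qed simp
    qed
    moreover have "AE x in lborel. x \<notin> cbox l r - box l r"
    proof (rule AE_not_in, rule null_setsI)
      show "emeasure lborel (cbox l r - box l r) = 0"
        by (subst emeasure_Diff) (auto simp: box_subset_cbox emeasure_lborel_box_eq emeasure_lborel_cbox_eq)
    qed simp
    ultimately show ?thesis by eventually_elim (auto simp: lr)
  qed
  then have "AE x in lborel. \<forall>X\<in>D. x \<in> X \<longrightarrow> W x = 0"
    by (subst AE_ball_countable[OF D(1)]) auto
  then show ?thesis by eventually_elim (use D(4) in auto)
qed

section \<open>Increments along coordinate directions\<close>

abbreviation directional :: "('a::euclidean_space \<Rightarrow> real) \<Rightarrow> 'a \<Rightarrow> 'a \<Rightarrow> real" where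
  "directional \<phi> b x \<equiv> frechet_derivative \<phi> (at x) b"

abbreviation weak_partial ::
  "('a::euclidean_space \<Rightarrow> real) \<Rightarrow> 'a \<Rightarrow> ('a \<Rightarrow> real) \<Rightarrow> ('a \<Rightarrow> real) \<Rightarrow> bool" where
  "weak_partial u b G \<phi> \<equiv> (LBINT x. u x * directional \<phi> b x) = - (LBINT x. G x * \<phi> x)"

text \<open>This justifies the exchanges of integrals below: if \<open>x\<close> is integrated
  first, translation invariance makes the inner integral of the absolute value independent of
  \<open>t\<close>.\<close>

lemma integrable_segment_average:
  fixes G :: "'a::euclidean_space \<Rightarrow> real"
  assumes G: "integrable lborel G" and [measurable]: "w \<in> borel_measurable borel"
    and w: "\<And>x. \<bar>w x\<bar> \<le> 1"
  shows "integrable (lborel \<Otimes>\<^sub>M lborel) (\<lambda>(x, t). w x * (indicator {0..s} t * G (x + t *\<^sub>R b)))"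
proof (rule integrableI_bounded)
  have [measurable]: "G \<in> borel_measurable borel" using G by auto
  show "(\<lambda>(x, t). w x * (indicator {0..s} t * G (x + t *\<^sub>R b))) \<in> borel_measurable (lborel \<Otimes>\<^sub>M lborel)"
    by measurable
  have "(\<integral>\<^sup>+z. ennreal (norm (case z of (x, t) \<Rightarrow> w x * (indicator {0..s} t * G (x + t *\<^sub>R b))))
        \<partial>(lborel \<Otimes>\<^sub>M lborel)) \<le>
      (\<integral>\<^sup>+z. (case z of (x, t) \<Rightarrow> indicator {0..s} t * ennreal \<bar>G (x + t *\<^sub>R b)\<bar>) \<partial>(lborel \<Otimes>\<^sub>M lborel))"
    using w by (intro nn_integral_mono)
      (auto simp: abs_mult split: split_indicator intro!: ennreal_leI mult_left_le_one_le)
  also have "\<dots> = (\<integral>\<^sup>+t. \<integral>\<^sup>+x. indicator {0..s} t * ennreal \<bar>G (x + t *\<^sub>R b)\<bar> \<partial>lborel \<partial>lborel)"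
    by (subst lborel_pair.nn_integral_snd[symmetric]) auto
  also have "\<dots> = (\<integral>\<^sup>+t. indicator {0..s} t * (\<integral>\<^sup>+x. ennreal \<bar>G x\<bar> \<partial>lborel) \<partial>lborel)"
    by (intro nn_integral_cong, subst nn_integral_cmult)
      (auto simp: nn_integral_translation[where f = "\<lambda>x. ennreal \<bar>G x\<bar>"])
  also have "\<dots> = emeasure lborel {0..s} * (\<integral>\<^sup>+x. ennreal \<bar>G x\<bar> \<partial>lborel)"
    by (subst nn_integral_multc) auto
  also have "\<dots> < \<infinity>"
    using G by (simp add: integrable_iff_bounded ennreal_mult_less_top emeasure_lborel_Icc_eq)
  finally show "(\<integral>\<^sup>+z. ennreal (norm (case z of (x, t) \<Rightarrow> w x * (indicator {0..s} t * G (x + t *\<^sub>R b))))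
        \<partial>(lborel \<Otimes>\<^sub>M lborel)) < \<infinity>" .
qed

text \<open>Parametrizing every segment by [0, 1] shows the complement as the projection of a closed
  set along a compact factor, hence as closed.\<close>

lemma open_segment_pairs:
  fixes U :: "'a::euclidean_space set"
  assumes "open U"
  shows "open {(x, t). \<forall>\<tau>\<in>closed_segment 0 t. x + \<tau> *\<^sub>R b \<in> U}"
proof -
  define T where "T = (\<lambda>p. fst (snd p) + (fst p * snd (snd p)) *\<^sub>R b) -` (- U)"
  have "closed T"
    unfolding T_def using assms by (intro closed_vimage continuous_intros) auto
  then have "closed {y. \<exists>\<sigma>. \<sigma> \<in> {0..1::real} \<and> (\<sigma>, y) \<in> T}"
    by (intro closed_compact_projection) auto
  moreover have "{y. \<exists>\<sigma>. \<sigma> \<in> {0..1::real} \<and> (\<sigma>, y) \<in> T} =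
      - {(x, t). \<forall>\<tau>\<in>closed_segment 0 t. x + \<tau> *\<^sub>R b \<in> U}"
    by (auto simp: T_def closed_segment_def)
  ultimately show ?thesis unfolding open_closed by simp
qed

text \<open>If \<open>P\<close> is a primitive of the bump, the integral over the translates is
  \<open>P y - P (y - s)\<close>. Its derivative is a difference of two bumps, which is how an
  increment of \<open>u\<close> will come out of a single test function.\<close>

lemma sliding_bump_primitive:
  assumes "0 < s"
  shows "\<exists>H. (\<forall>y. (H has_field_derivative (bump l r k y - bump l r k (y - s))) (at y)) \<and>
    (\<forall>y. (LBINT t. indicator {0..s} t * bump l r k (y - t)) = H y) \<and>
    (\<forall>y. y \<notin> {l..r + s} \<longrightarrow> H y = 0) \<and> (\<forall>j. Ck j H)"
proof -
  have cont: "isCont (bump l r k) y" for y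
    using continuous_on_bump[of UNIV l r k] by (simp add: continuous_on_eq_continuous_at)
  obtain P where P: "\<And>y. (P has_vector_derivative bump l r k y) (at y)"
    using einterval_antiderivative[of "-\<infinity>" "\<infinity>" "bump l r k"] cont by auto
  define H where "H y = P y - P (y - s)" for y
  have P': "(P has_field_derivative bump l r k y) (at y)" for y
    using P by (simp add: has_real_derivative_iff_has_vector_derivative)
  have D: "(H has_field_derivative (bump l r k y - bump l r k (y - s))) (at y)" for y
  proof -
    have "((\<lambda>y. y - s) has_field_derivative 1) (at y)" by (auto intro!: derivative_eq_intros)
    from DERIV_diff[OF P' DERIV_chain2[OF P' this]] show ?thesis by (simp add: H_def[abs_def])
  qed
  have I: "(LBINT t. indicator {0..s} t * bump l r k (y - t)) = H y" for y
  proof -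
    have "(LBINT t. bump l r k (y - t) * indicator {0..s} t) = (- P (y - s)) - (- P (y - 0))"
    proof (rule integral_FTC_Icc_real)
      show "((\<lambda>t. - P (y - t)) has_field_derivative bump l r k (y - t)) (at t)" for t
      proof -
        have "((\<lambda>t. y - t) has_field_derivative - 1) (at t)" by (auto intro!: derivative_eq_intros)
        from DERIV_minus[OF DERIV_chain2[OF P' this]] show ?thesis by simp
      qed
      show "isCont (\<lambda>t. bump l r k (y - t)) t" for t
        by (intro continuous_intros isCont_o2[OF _ cont])
    qed (use assms in auto)
    then show ?thesis by (simp add: H_def mult.commute)
  qed
  have Z: "H y = 0" if "y \<notin> {l..r + s}" for y
  proof -
    have "(\<lambda>t. indicator {0..s} t * bump l r k (y - t)) = (\<lambda>t. 0)"
      using that by (auto simp: bump_eq_0 split: split_indicator)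
    with I[of y] show ?thesis by simp
  qed
  have "Ck (Suc j) H" for j
  proof (rule Ck_Suc_real[OF D])
    show "Ck j (\<lambda>y. bump l r k y - bump l r k (y - s))"
      using Ck_compose_inner[OF Ck_bump, of j l r k "1::real" "-s"] by (intro Ck_diff Ck_bump) simp
  qed
  then have "Ck j H" for j by (rule Ck_Suc_imp_Ck)
  with D I Z show ?thesis by blast
qed

text \<open>Testing against a product bump integrated over a segment in direction \<open>b\<close> gives the
  fundamental theorem of calculus on almost every segment without any mollification.\<close>

lemma AE_increment_eq_integral:
  fixes u G :: "'a::euclidean_space \<Rightarrow> real"
  assumes U: "open U" and b: "b \<in> Basis" and u: "integrable lborel u" and G: "integrable lborel G"
    and weak: "\<And>\<phi>. \<phi> \<in> test_functions U \<Longrightarrow>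
      weak_partial u b G \<phi>"
    and s: "0 < s"
  shows "AE x in lborel. (\<forall>t\<in>{0..s}. x + t *\<^sub>R b \<in> U) \<longrightarrow>
    u (x + s *\<^sub>R b) - u x = (LBINT t. indicator {0..s} t * G (x + t *\<^sub>R b))"
proof -
  have [measurable]: "u \<in> borel_measurable borel" "G \<in> borel_measurable borel" using u G by auto
  define V where "V = {x. \<forall>t\<in>{0..s}. x + t *\<^sub>R b \<in> U}"
  define K where "K x = (LBINT t. indicator {0..s} t * G (x + t *\<^sub>R b))" for x
  have K: "integrable lborel K"
    using lborel_pair.integrable_fst[OF integrable_segment_average[OF G, of "\<lambda>_. 1" s b]]
    unfolding K_def by simp
  then have [measurable]: "K \<in> borel_measurable borel" by auto
  have us: "integrable lborel (\<lambda>x. u (x + s *\<^sub>R b))" by (rule integrable_translation[OF u])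
  have bdd: "integrable lborel (\<lambda>x. product_bump l r k x * h x)" if "integrable lborel h" for l r k and h :: "'a \<Rightarrow> real"
    using that by (rule LBINT_bound)
      (use that in \<open>auto simp: abs_mult intro!: mult_left_le_one_le abs_product_bump_le_1\<close>)
  have "AE x in lborel. x \<in> V \<longrightarrow> u (x + s *\<^sub>R b) - u x - K x = 0"
  proof (rule AE_zero_on_open)
    show "integrable lborel (\<lambda>x. u (x + s *\<^sub>R b) - u x - K x)"
      by (intro Bochner_Integration.integrable_diff us u K)
    show "open V"
    proof -
      have "open ((\<lambda>x. (x, s)) -` {(x, t). \<forall>\<tau>\<in>closed_segment 0 t. x + \<tau> *\<^sub>R b \<in> U})"
        by (intro open_vimage open_segment_pairs U continuous_intros)
      then show ?thesis using s by (simp add: V_def closed_segment_eq_real_ivl)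
    qed
  next
    fix l r :: 'a and k
    assume lr: "cbox l r \<subseteq> V" and ne: "box l r \<noteq> {}"
    let ?w = "product_bump l r k"
    obtain H where H: "\<And>y. (H has_field_derivative (bump (l \<bullet> b) (r \<bullet> b) k y - bump (l \<bullet> b) (r \<bullet> b) k (y - s))) (at y)"
      "\<And>y. (LBINT t. indicator {0..s} t * bump (l \<bullet> b) (r \<bullet> b) k (y - t)) = H y"
      "\<And>y. y \<notin> {l \<bullet> b..r \<bullet> b + s} \<Longrightarrow> H y = 0" "\<And>j. Ck j H"
      using sliding_bump_primitive[OF s, of "l \<bullet> b" "r \<bullet> b" k] by auto
    \<comment> \<open>The test function \<open>\<Phi>\<close> is the product bump \<open>?w\<close>
      integrated over the segment from \<open>x - s *\<^sub>R b\<close> to \<open>x\<close>. In the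
      factor along \<open>b\<close> this replaces the bump by \<open>H\<close>; the other factors
      are constant on the segment.\<close>
    define \<eta> where "\<eta> j = (if j = b then H else bump (l \<bullet> j) (r \<bullet> j) k)" for j
    define R where "R x = (\<Prod>j\<in>Basis - {b}. bump (l \<bullet> j) (r \<bullet> j) k (x \<bullet> j))" for x
    define \<Phi> where "\<Phi> x = (\<Prod>j\<in>Basis. \<eta> j (x \<bullet> j))" for x
    have \<Phi>R: "\<Phi> x = H (x \<bullet> b) * R x" for x
    proof -
      have "(\<Prod>j\<in>Basis - {b}. \<eta> j (x \<bullet> j)) = R x"
        unfolding R_def by (intro prod.cong) (auto simp: \<eta>_def)
      then show ?thesis
        unfolding \<Phi>_def using b by (subst prod.remove[of _ b]) (auto simp: \<eta>_def)
    qed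
    have Rshift: "R (x - t *\<^sub>R b) = R x" for x t
      unfolding R_def using b by (intro prod.cong) (auto simp: inner_diff_left inner_not_same_Basis)
    have wR: "?w x = bump (l \<bullet> b) (r \<bullet> b) k (x \<bullet> b) * R x" for x
      unfolding product_bump_def R_def using b by (subst prod.remove[of _ b]) auto
    have wshift: "?w (x - t *\<^sub>R b) = bump (l \<bullet> b) (r \<bullet> b) k (x \<bullet> b - t) * R x" for x t
      using b by (simp add: wR Rshift inner_diff_left)
    have \<Phi>: "\<Phi> \<in> test_functions U"
      unfolding \<Phi>_def[abs_def]
    proof (rule product_test_function[where l = l and r = "r + s *\<^sub>R b"])
      show "Ck m (\<eta> j)" for m j by (simp add: \<eta>_def H(4) Ck_bump)
      show "\<eta> j y = 0" if "j \<in> Basis" "y \<notin> {l \<bullet> j..(r + s *\<^sub>R b) \<bullet> j}" for j y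
        using that b by (auto simp: \<eta>_def inner_add_left inner_not_same_Basis intro!: H(3) bump_eq_0)
      show "cbox l (r + s *\<^sub>R b) \<subseteq> U"
      proof
        fix x assume x: "x \<in> cbox l (r + s *\<^sub>R b)"
        \<comment> \<open>The smallest shift back along \<open>b\<close> that returns
          \<open>x\<close> to the original box. Since that box lies in \<open>V\<close>, the segment
          of length \<open>s\<close> starting there, and with it \<open>x\<close>, lies in
          \<open>U\<close>.\<close>
        define t where "t = max 0 (x \<bullet> b - r \<bullet> b)"
        have le: "l \<bullet> j \<le> r \<bullet> j" if "j \<in> Basis" for j
          using ne that by (auto simp: box_ne_empty less_imp_le)
        have t: "t \<in> {0..s}" using x b s by (auto simp: t_def mem_box inner_add_left)
        have "x - t *\<^sub>R b \<in> cbox l r"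
          unfolding mem_box
        proof
          fix j :: 'a assume j: "j \<in> Basis"
          show "l \<bullet> j \<le> (x - t *\<^sub>R b) \<bullet> j \<and> (x - t *\<^sub>R b) \<bullet> j \<le> r \<bullet> j"
            using x b j le[OF j]
            by (cases "j = b") (auto simp: t_def mem_box inner_add_left inner_diff_left inner_not_same_Basis dest: bspec[of _ _ j])
        qed
        with lr have "x - t *\<^sub>R b \<in> V" by auto
        from this[unfolded V_def] t have "(x - t *\<^sub>R b) + t *\<^sub>R b \<in> U" by blast
        then show "x \<in> U" by simp
      qed
    qed
    have fd: "directional \<Phi> b x = ?w x - ?w (x - s *\<^sub>R b)" for x
    proof -
      have dif: "\<eta> j differentiable (at y)" for j y
        using Ck_bump[of "Suc 0"] H(4)[of "Suc 0"] by (auto simp: \<eta>_def)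
      have "directional \<Phi> b x =
          (bump (l \<bullet> b) (r \<bullet> b) k (x \<bullet> b) - bump (l \<bullet> b) (r \<bullet> b) k (x \<bullet> b - s)) *
          (\<Prod>j\<in>Basis - {b}. \<eta> j (x \<bullet> j))"
        unfolding \<Phi>_def[abs_def]
        using product_directional_derivative[where \<eta> = \<eta> and b = b, OF b dif, of "\<lambda>y. bump (l \<bullet> b) (r \<bullet> b) k y - bump (l \<bullet> b) (r \<bullet> b) k (y - s)" x] H(1)
        by (simp add: \<eta>_def)
      also have "(\<Prod>j\<in>Basis - {b}. \<eta> j (x \<bullet> j)) = R x"
        unfolding R_def by (intro prod.cong) (auto simp: \<eta>_def)
      finally show ?thesis by (simp add: wshift[of x s] wR[of x] algebra_simps)
    qed
    have \<Phi>I: "(LBINT t. indicator {0..s} t * ?w (x - t *\<^sub>R b)) = \<Phi> x" for x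
    proof -
      have "(LBINT t. indicator {0..s} t * ?w (x - t *\<^sub>R b)) =
          (LBINT t. (indicator {0..s} t * bump (l \<bullet> b) (r \<bullet> b) k (x \<bullet> b - t)) * R x)"
        by (simp add: wshift mult.assoc)
      also have "\<dots> = H (x \<bullet> b) * R x"
        by (subst integral_mult_left_zero) (simp add: H(2))
      finally show ?thesis by (simp add: \<Phi>R)
    qed
    have "(LBINT x. ?w x * K x) =
        (LBINT x. LBINT t. ?w x * (indicator {0..s} t * G (x + t *\<^sub>R b)))"
      unfolding K_def by (subst integral_mult_right_zero) simp
    also have "\<dots> = (LBINT t. LBINT x. ?w x * (indicator {0..s} t * G (x + t *\<^sub>R b)))"
      by (rule lborel_pair.Fubini_integral[symmetric], rule integrable_segment_average[OF G])
        (auto intro: abs_product_bump_le_1)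
    \<comment> \<open>For each \<open>t\<close> the translation is moved from \<open>G\<close> onto
      the bump, after which the integral over \<open>t\<close> produces
      \<open>\<Phi>\<close>.\<close>
    also have "\<dots> = (LBINT t. LBINT x. ?w (x + - t *\<^sub>R b) * (indicator {0..s} t * G (x + - t *\<^sub>R b + t *\<^sub>R b)))"
      by (intro LBINT_cong refl integral_translation[symmetric]) measurable
    also have "\<dots> = (LBINT t. LBINT x. G x * (indicator {0..s} t * ?w (x - t *\<^sub>R b)))"
      by (intro LBINT_cong refl) (simp add: ac_simps)
    also have "\<dots> = (LBINT x. LBINT t. G x * (indicator {0..s} t * ?w (x - t *\<^sub>R b)))"
    proof (rule lborel_pair.Fubini_integral)
      show "integrable (lborel \<Otimes>\<^sub>M lborel) (\<lambda>(x, t). G x * (indicator {0..s} t * ?w (x - t *\<^sub>R b)))"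
      proof (rule LBINT_bound)
        \<comment> \<open>With direction 0 and weight 1 the earlier integrability lemma yields a
          majorant, as the bump is at most 1.\<close>
        show "integrable (lborel \<Otimes>\<^sub>M lborel) (\<lambda>(x::'a, t). 1 * (indicator {0..s} t * G (x + t *\<^sub>R 0)))"
          by (rule integrable_segment_average[OF G]) auto
        show "AE z in lborel \<Otimes>\<^sub>M lborel. norm (case z of (x, t) \<Rightarrow> G x * (indicator {0..s} t * ?w (x - t *\<^sub>R b)))
            \<le> norm (case z of (x, t) \<Rightarrow> 1 * (indicator {0..s} t * G (x + t *\<^sub>R 0)))"
          by (intro AE_I2)
            (auto simp: abs_mult split: split_indicator intro!: mult_right_le_one_le abs_product_bump_le_1)
      qed measurable
    qed
    also have "\<dots> = (LBINT x. G x * \<Phi> x)"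
      by (subst integral_mult_right_zero) (simp add: \<Phi>I)
    also have "\<dots> = - (LBINT x. u x * (?w x - ?w (x - s *\<^sub>R b)))"
      using weak[OF \<Phi>] by (simp add: fd)
    finally have KI: "(LBINT x. ?w x * K x) = - (LBINT x. u x * (?w x - ?w (x - s *\<^sub>R b)))" .
    have shift: "(LBINT x. u x * ?w (x - s *\<^sub>R b)) = (LBINT x. ?w x * u (x + s *\<^sub>R b))"
      using integral_translation[of "\<lambda>x. u x * ?w (x - s *\<^sub>R b)" "s *\<^sub>R b"] by (simp add: mult.commute)
    have ishift: "integrable lborel (\<lambda>x. u x * ?w (x - s *\<^sub>R b))"
      using u by (rule LBINT_bound)
        (auto simp: abs_mult intro!: mult_right_le_one_le abs_product_bump_le_1)
    have "(LBINT x. u x * (?w x - ?w (x - s *\<^sub>R b))) =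
        (LBINT x. ?w x * u x) - (LBINT x. ?w x * u (x + s *\<^sub>R b))"
      unfolding shift[symmetric]
      using Bochner_Integration.integral_diff[OF bdd[OF u, of l r k] ishift] by (simp add: algebra_simps)
    moreover have "(LBINT x. ?w x * (u (x + s *\<^sub>R b) - u x - K x)) =
        (LBINT x. ?w x * u (x + s *\<^sub>R b)) - (LBINT x. ?w x * u x) - (LBINT x. ?w x * K x)"
      unfolding right_diff_distrib
      by (subst Bochner_Integration.integral_diff | intro Bochner_Integration.integrable_diff bdd us u K refl)+
    ultimately show "(LBINT x. ?w x * (u (x + s *\<^sub>R b) - u x - K x)) = 0"
      using KI by simp
  qed
  then show ?thesis
    by eventually_elim (auto simp: V_def K_def)
qed

section \<open>Directional maximal functions\<close>

abbreviation segment_integral :: "('a::euclidean_space \<Rightarrow> real) \<Rightarrow> 'a \<Rightarrow> 'a \<Rightarrow> real \<Rightarrow> ennreal" where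
  "segment_integral f b z r \<equiv> (\<integral>\<^sup>+t. ennreal (f (z + t *\<^sub>R b)) * indicator {-r..r} t \<partial>lborel)"

text \<open>The centred one-dimensional maximal function along \<open>b\<close>, truncated at radius
  \<open>R\<close>. Rational radii make the supremum countable, hence measurable.\<close>

definition dir_max :: "real \<Rightarrow> 'a::euclidean_space \<Rightarrow> ('a \<Rightarrow> real) \<Rightarrow> 'a \<Rightarrow> ennreal" where
  "dir_max R b f z = (SUP r\<in>{r\<in>\<rat>. 0 < r \<and> r \<le> R}.
     ennreal (1 / (2 * r)) * segment_integral f b z r)"

lemma borel_measurable_dir_max [measurable]:
  assumes [measurable]: "f \<in> borel_measurable borel"
  shows "dir_max R b f \<in> borel_measurable borel"
proof -
  have "countable {r\<in>\<rat>. 0 < r \<and> r \<le> R}"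
    by (rule countable_subset[OF _ countable_rat]) auto
  then show ?thesis unfolding dir_max_def[abs_def] by measurable
qed

text \<open>A real radius is enlarged to a rational one below \<open>2 * r\<close>. The loss of a
  factor 2 explains the constant 4, and the room for the enlargement explains
  \<open>2 * r \<le> R\<close>.\<close>

lemma segment_integral_le_dir_max:
  assumes "0 < r" "2 * r \<le> R"
  shows "segment_integral f b z r \<le> ennreal (4 * r) * dir_max R b f z"
proof -
  obtain q where q: "q \<in> \<rat>" "r < q" "q < 2 * r"
    using Rats_dense_in_real[of r "2 * r"] assms by auto
  define J where "J = segment_integral f b z q"
  have "segment_integral f b z r \<le> J"
    unfolding J_def using q by (intro nn_integral_mono) (auto split: split_indicator)
  also have "J = ennreal (2 * q) * (ennreal (1 / (2 * q)) * J)"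
    using q assms by (simp add: mult.assoc[symmetric] ennreal_mult[symmetric])
  also have "ennreal (1 / (2 * q)) * J \<le> dir_max R b f z"
    unfolding dir_max_def J_def using q assms by (intro SUP_upper) auto
  finally have "segment_integral f b z r
      \<le> ennreal (2 * q) * dir_max R b f z" by (simp add: mult_left_mono)
  also have "\<dots> \<le> ennreal (4 * r) * dir_max R b f z"
    using q by (intro mult_right_mono ennreal_leI) auto
  finally show ?thesis .
qed

lemma dir_max_on_line: "dir_max R b f (z + s *\<^sub>R b) = dir_max R 1 (\<lambda>t. f (z + t *\<^sub>R b)) s"
  unfolding dir_max_def by (simp add: scaleR_add_left add.assoc)

text \<open>Each point of the level set is the centre of an interval of radius r that carries mass
  at least \<open>2 * lam * r\<close>. By Vitali's covering lemma a countable disjoint subfamily,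
  enlarged five times, covers the level set; this enlargement is the constant 5.\<close>

lemma dir_max_weak_type:
  fixes f :: "real \<Rightarrow> real"
  assumes f[measurable]: "f \<in> borel_measurable borel" and lam: "0 < lam"
  shows "ennreal lam * emeasure lborel {x. ennreal lam < dir_max R 1 f x} \<le> 5 * (\<integral>\<^sup>+x. ennreal (f x) \<partial>lborel)"
proof -
  define A where "A = {x. ennreal lam < dir_max R 1 f x}"
  define D where "D = density lborel (\<lambda>x. ennreal (f x))"
  have [measurable]: "cball x r \<in> sets borel" for x r :: real by simp
  have ex: "\<exists>r. 0 < r \<and> r \<le> R \<and> ennreal (2 * lam * r) \<le> emeasure D (cball x r)" if "x \<in> A" for x
  proof -
    from that obtain r where r: "r \<in> \<rat>" "0 < r" "r \<le> R"
      "ennreal lam < ennreal (1 / (2 * r)) * segment_integral f 1 x r"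
      unfolding A_def dir_max_def less_SUP_iff by auto
    have "segment_integral f 1 x r =
        (\<integral>\<^sup>+t. ennreal (f (t + x)) * indicator (cball x r) (t + x) \<partial>lborel)"
      by (intro nn_integral_cong) (auto simp: add.commute dist_real_def split: split_indicator)
    also have "\<dots> = emeasure D (cball x r)"
      unfolding D_def
      by (subst emeasure_density) (auto intro!: nn_integral_translation[where f = "\<lambda>t. ennreal (f t) * indicator (cball x r) t"])
    finally have "ennreal lam \<le> ennreal (1 / (2 * r)) * emeasure D (cball x r)"
      using r by simp
    then have "ennreal (2 * r) * ennreal lam \<le> ennreal (2 * r) * (ennreal (1 / (2 * r)) * emeasure D (cball x r))"
      by (intro mult_left_mono) auto
    also have "\<dots> = emeasure D (cball x r)"
      using r by (simp add: mult.assoc[symmetric] ennreal_mult[symmetric])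
    also have "ennreal (2 * r) * ennreal lam = ennreal (2 * lam * r)"
      using r lam by (subst ennreal_mult[symmetric]) (auto simp: ac_simps)
    finally show ?thesis using r by blast
  qed
  then obtain r where r: "\<And>x. x \<in> A \<Longrightarrow> 0 < r x \<and> r x \<le> R"
    and rD: "\<And>x. x \<in> A \<Longrightarrow> ennreal (2 * lam * r x) \<le> emeasure D (cball x (r x))"
    by metis
  have "A \<subseteq> (\<Union>i\<in>A. cball i (r i))" using r by (fastforce simp: less_imp_le)
  then obtain C where C: "countable C" "C \<subseteq> A"
    and dis: "pairwise (\<lambda>i j. disjnt (cball i (r i)) (cball j (r j))) C"
    and cov: "A \<subseteq> (\<Union>i\<in>C. cball i (5 * r i))"
    by (rule Vitali_covering_lemma_cballs[OF _ r])
  have disj: "disjoint_family_on (\<lambda>i. cball i (r i)) C"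
    using dis by (auto simp: disjoint_family_on_def pairwise_def disjnt_def)
  have "emeasure lborel A \<le> emeasure lborel (\<Union>i\<in>C. cball i (5 * r i))"
    using C(1) by (intro emeasure_mono cov sets.countable_UN') auto
  also have "\<dots> = (\<integral>\<^sup>+x. indicator (\<Union>i\<in>C. cball i (5 * r i)) x \<partial>lborel)"
    using C(1) by (intro nn_integral_indicator[symmetric] sets.countable_UN') auto
  \<comment> \<open>Subadditivity over the countable index set \<open>C\<close> is written as an
    integral over \<open>count_space C\<close>, which avoids enumerating \<open>C\<close>.\<close>
  also have "\<dots> \<le> (\<integral>\<^sup>+x. (\<integral>\<^sup>+i. indicator (cball i (5 * r i)) x \<partial>count_space C) \<partial>lborel)"
  proof (intro nn_integral_mono)
    fix x
    show "indicator (\<Union>i\<in>C. cball i (5 * r i)) x \<le> (\<integral>\<^sup>+i. indicator (cball i (5 * r i)) x \<partial>count_space C)"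
    proof (cases "x \<in> (\<Union>i\<in>C. cball i (5 * r i))")
      case True
      then obtain i where i: "i \<in> C" "x \<in> cball i (5 * r i)" by blast
      have "(1::ennreal) = (\<integral>\<^sup>+j. indicator {i} j \<partial>count_space C)"
        using i by (subst nn_integral_indicator) auto
      also have "\<dots> \<le> (\<integral>\<^sup>+j. indicator (cball j (5 * r j)) x \<partial>count_space C)"
        using i by (intro nn_integral_mono) (auto split: split_indicator)
      finally show ?thesis using True by simp
    qed simp
  qed
  also have "\<dots> = (\<integral>\<^sup>+i. (\<integral>\<^sup>+x. indicator (cball i (5 * r i)) x \<partial>lborel) \<partial>count_space C)"
    by (rule nn_integral_count_space_nn_integral[OF C(1)]) auto
  also have "\<dots> = (\<integral>\<^sup>+i. ennreal (10 * r i) \<partial>count_space C)"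
  proof (intro nn_integral_cong)
    fix i assume "i \<in> space (count_space C)"
    then have "0 < r i" using C(2) r by auto
    then show "(\<integral>\<^sup>+x. indicator (cball i (5 * r i)) x \<partial>lborel) = ennreal (10 * r i)"
      by (simp add: cball_eq_atLeastAtMost)
  qed
  finally have "ennreal lam * emeasure lborel A \<le> ennreal lam * (\<integral>\<^sup>+i. ennreal (10 * r i) \<partial>count_space C)"
    by (rule mult_left_mono) simp
  also have "\<dots> = (\<integral>\<^sup>+i. ennreal lam * ennreal (10 * r i) \<partial>count_space C)"
    by (subst nn_integral_cmult) auto
  also have "\<dots> \<le> (\<integral>\<^sup>+i. 5 * emeasure D (cball i (r i)) \<partial>count_space C)"
  proof (intro nn_integral_mono)
    fix i assume "i \<in> space (count_space C)"
    then have i: "i \<in> A" using C(2) by auto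
    have "ennreal lam * ennreal (10 * r i) = 5 * ennreal (2 * lam * r i)"
      using lam r[OF i] by (simp add: ennreal_mult[symmetric] ennreal_numeral[symmetric] del: ennreal_numeral)
    also have "\<dots> \<le> 5 * emeasure D (cball i (r i))" by (intro mult_left_mono rD i) auto
    finally show "ennreal lam * ennreal (10 * r i) \<le> 5 * emeasure D (cball i (r i))" .
  qed
  also have "\<dots> = 5 * (\<integral>\<^sup>+i. emeasure D (cball i (r i)) \<partial>count_space C)"
    by (subst nn_integral_cmult) auto
  also have "(\<integral>\<^sup>+i. emeasure D (cball i (r i)) \<partial>count_space C) = emeasure D (\<Union>i\<in>C. cball i (r i))"
    using C(1) disj by (intro emeasure_UN_countable[symmetric]) (auto simp: D_def)
  also have "\<dots> \<le> emeasure D (space D)" by (rule emeasure_space)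
  also have "\<dots> = (\<integral>\<^sup>+x. ennreal (f x) \<partial>lborel)"
    unfolding D_def by (subst emeasure_density) auto
  finally show ?thesis unfolding A_def by (simp add: mult_left_mono)
qed

text \<open>The part of \<open>f\<close> below \<open>lam / 2\<close> contributes at most
  \<open>lam / 2\<close> to the maximal function. So the weak type bound may be applied to the upper
  part alone at level \<open>lam / 2\<close>, with constant 5 * 2 = 10.\<close>

lemma dir_max_truncated_weak_type:
  fixes f :: "real \<Rightarrow> real"
  assumes f[measurable]: "f \<in> borel_measurable borel" and f0: "\<And>x. 0 \<le> f x" and lam: "0 < lam"
  shows "emeasure lborel {x. ennreal lam < dir_max R 1 f x} \<le>
    ennreal (10 / lam) * (\<integral>\<^sup>+x. ennreal (f x * indicator {x. lam / 2 < f x} x) \<partial>lborel)"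
proof -
  define h where "h x = f x * indicator {x. lam / 2 < f x} x" for x
  have [measurable]: "h \<in> borel_measurable borel" unfolding h_def by measurable
  have h0: "0 \<le> h x" for x using f0 by (auto simp: h_def)
  have "dir_max R 1 f x \<le> dir_max R 1 h x + ennreal (lam / 2)" for x
    unfolding dir_max_def[of R 1 f]
  proof (rule SUP_least)
    fix r assume r: "r \<in> {r \<in> \<rat>. 0 < r \<and> r \<le> R}"
    define c where "c = ennreal (1 / (2 * r))"
    have "segment_integral f 1 x r \<le>
        (\<integral>\<^sup>+t. ennreal (h (x + t *\<^sub>R 1)) * indicator {-r..r} t + ennreal (lam / 2) * indicator {-r..r} t \<partial>lborel)"
      using f0 lam by (intro nn_integral_mono) (auto simp: h_def ennreal_leI split: split_indicator)
    also have "\<dots> = segment_integral h 1 x r + ennreal (lam / 2) * ennreal (2 * r)"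
      using r by (subst nn_integral_add) (auto simp: nn_integral_cmult)
    finally have "c * segment_integral f 1 x r \<le>
        c * segment_integral h 1 x r + c * (ennreal (lam / 2) * ennreal (2 * r))"
      unfolding distrib_left[symmetric] by (rule mult_left_mono) simp
    also have "c * (ennreal (lam / 2) * ennreal (2 * r)) = ennreal (lam / 2)"
      using r lam unfolding c_def by (subst ennreal_mult[symmetric]; simp?)+
    also have "c * segment_integral h 1 x r \<le> dir_max R 1 h x"
      unfolding c_def dir_max_def using r by (intro SUP_upper) auto
    finally show "ennreal (1 / (2 * r)) * segment_integral f 1 x r \<le> dir_max R 1 h x + ennreal (lam / 2)"
      unfolding c_def by (simp add: add_right_mono)
  qed
  then have "{x. ennreal lam < dir_max R 1 f x} \<subseteq> {x. ennreal (lam / 2) < dir_max R 1 h x}"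
  proof (intro subsetI CollectI, elim CollectE)
    fix x assume "ennreal lam < dir_max R 1 f x"
    also note \<open>dir_max R 1 f x \<le> dir_max R 1 h x + ennreal (lam / 2)\<close>
    also have "ennreal lam = ennreal (lam / 2) + ennreal (lam / 2)"
      using lam by (simp flip: ennreal_plus)
    finally show "ennreal (lam / 2) < dir_max R 1 h x"
      by (metis add_right_mono linorder_not_le)
  qed
  then have "emeasure lborel {x. ennreal lam < dir_max R 1 f x} \<le> emeasure lborel {x. ennreal (lam / 2) < dir_max R 1 h x}"
    by (intro emeasure_mono) auto
  also have "\<dots> = ennreal (2 / lam) * (ennreal (lam / 2) * emeasure lborel {x. ennreal (lam / 2) < dir_max R 1 h x})"
    using lam by (simp add: mult.assoc[symmetric] ennreal_mult[symmetric])
  also have "\<dots> \<le> ennreal (2 / lam) * (5 * (\<integral>\<^sup>+x. ennreal (h x) \<partial>lborel))"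
    using lam by (intro mult_left_mono dir_max_weak_type) auto
  also have "\<dots> = ennreal (10 / lam) * (\<integral>\<^sup>+x. ennreal (h x) \<partial>lborel)"
    using lam by (simp add: mult.assoc[symmetric] ennreal_mult[symmetric] ennreal_numeral[symmetric] del: ennreal_numeral)
  finally show ?thesis unfolding h_def .
qed

text \<open>The layer-cake form of the \<open>p\<close>-th power; unlike \<open>powr\<close> it is meaningful at infinity.\<close>

definition layer :: "real \<Rightarrow> ennreal \<Rightarrow> ennreal" where
  "layer p y = (\<integral>\<^sup>+s. (if 0 < s \<and> ennreal s < y then ennreal (p * s powr (p - 1)) else 0) \<partial>lborel)"

lemma nn_integral_powr_less:
  assumes "0 < q" "0 \<le> a"
  shows "(\<integral>\<^sup>+s. (if 0 < s \<and> s < a then ennreal (s powr (q - 1)) else 0) \<partial>lborel) = ennreal (a powr q / q)"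
proof -
  have "((\<lambda>s. s powr (q - 1)) has_integral (a powr (q - 1 + 1) / (q - 1 + 1))) {0..a}"
    using assms by (intro has_integral_powr_from_0) auto
  then have "(\<integral>\<^sup>+s. ennreal (s powr (q - 1)) * indicator {0..a} s \<partial>lborel) = ennreal (a powr q / q)"
    by (subst nn_integral_has_integral_lebesgue') auto
  moreover have "AE s in lborel. s \<noteq> 0" "AE s in lborel. s \<noteq> a"
    by (rule AE_lborel_singleton)+
  then have "(\<integral>\<^sup>+s. ennreal (s powr (q - 1)) * indicator {0..a} s \<partial>lborel) =
      (\<integral>\<^sup>+s. (if 0 < s \<and> s < a then ennreal (s powr (q - 1)) else 0) \<partial>lborel)"
    by (intro nn_integral_cong_AE, eventually_elim) (auto split: split_indicator)
  ultimately show ?thesis by simp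
qed

lemma layer_ennreal:
  assumes "0 < p" "0 \<le> a"
  shows "layer p (ennreal a) = ennreal (a powr p)"
proof -
  have "layer p (ennreal a) =
      (\<integral>\<^sup>+s. ennreal p * (if 0 < s \<and> s < a then ennreal (s powr (p - 1)) else 0) \<partial>lborel)"
    unfolding layer_def using assms
    by (intro nn_integral_cong) (auto simp: ennreal_less_iff ennreal_mult)
  also have "\<dots> = ennreal p * ennreal (a powr p / p)"
    by (subst nn_integral_cmult) (use nn_integral_powr_less[OF assms] in auto)
  also have "\<dots> = ennreal (a powr p)"
    using assms by (simp flip: ennreal_mult)
  finally show ?thesis .
qed

lemma layer_mono: "y \<le> y' \<Longrightarrow> layer p y \<le> layer p y'"
  unfolding layer_def by (intro nn_integral_mono) auto

lemma layer_top:
  assumes "0 < p"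
  shows "layer p \<infinity> = \<infinity>"
proof (rule ccontr)
  assume "layer p \<infinity> \<noteq> \<infinity>"
  then obtain c where c: "layer p \<infinity> = ennreal c" "0 \<le> c" by (cases "layer p \<infinity>") auto
  have "ennreal (((c + 1) powr (1 / p)) powr p) \<le> layer p \<infinity>"
    using layer_mono[of "ennreal ((c + 1) powr (1 / p))" \<infinity> p] assms by (simp add: layer_ennreal)
  then show False using c assms by (simp add: powr_powr)
qed

lemma layer_eq_enn2real: "0 < p \<Longrightarrow> y \<noteq> \<infinity> \<Longrightarrow> layer p y = ennreal (enn2real y powr p)"
  using layer_ennreal[of p "enn2real y"] by (cases y) auto

lemma borel_measurable_layer [measurable]: "layer p \<in> borel_measurable borel"
  unfolding layer_def[abs_def] by measurable

text \<open>Marcinkiewicz interpolation: the truncated weak type bound is integrated over the levels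
  s with weight p s^(p-1), and the order of integration is exchanged. What remains is the integral
  of s^(p-2) from 0 to \<open>2 * f x\<close>, which converges because p > 1 and supplies the factor
  2^(p-1) / (p - 1).\<close>

lemma dir_max_strong_type_real:
  fixes f :: "real \<Rightarrow> real"
  assumes f[measurable]: "f \<in> borel_measurable borel" and f0: "\<And>x. 0 \<le> f x" and p: "1 < p"
  shows "(\<integral>\<^sup>+x. layer p (dir_max R 1 f x) \<partial>lborel) \<le>
    ennreal (10 * p * 2 powr (p - 1) / (p - 1)) * (\<integral>\<^sup>+x. ennreal (f x powr p) \<partial>lborel)"
proof -
  let ?L = "\<lambda>s x. (if 0 < s \<and> ennreal s < dir_max R 1 f x then ennreal (p * s powr (p - 1)) else 0)"
  let ?K = "\<lambda>s x. (if 0 < s \<and> s < 2 * f x then ennreal (s powr (p - 1 - 1)) else 0) * ennreal (10 * p * f x)"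
  have "(\<integral>\<^sup>+x. layer p (dir_max R 1 f x) \<partial>lborel) =
      (\<integral>\<^sup>+s. \<integral>\<^sup>+x. ?L s x \<partial>lborel \<partial>lborel)"
    unfolding layer_def by (rule lborel_pair.Fubini'[symmetric]) measurable
  also have "\<dots> \<le> (\<integral>\<^sup>+s. \<integral>\<^sup>+x. ?K s x \<partial>lborel \<partial>lborel)"
  proof (rule nn_integral_mono)
    fix s :: real
    show "(\<integral>\<^sup>+x. ?L s x \<partial>lborel) \<le>
      (\<integral>\<^sup>+x. ?K s x \<partial>lborel)"
    proof (cases "0 < s")
      case True
      have "(\<integral>\<^sup>+x. ?L s x \<partial>lborel) =
          (\<integral>\<^sup>+x. ennreal (p * s powr (p - 1)) * indicator {x. ennreal s < dir_max R 1 f x} x \<partial>lborel)"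
        using True by (intro nn_integral_cong) auto
      also have "\<dots> = ennreal (p * s powr (p - 1)) * emeasure lborel {x. ennreal s < dir_max R 1 f x}"
        by (subst nn_integral_cmult_indicator) auto
      also have "\<dots> \<le> ennreal (p * s powr (p - 1)) *
          (ennreal (10 / s) * (\<integral>\<^sup>+x. ennreal (f x * indicator {x. s / 2 < f x} x) \<partial>lborel))"
        by (intro mult_left_mono dir_max_truncated_weak_type f f0 True) auto
      also have "\<dots> = (\<integral>\<^sup>+x. ennreal (p * s powr (p - 1) * (10 / s)) * ennreal (f x * indicator {x. s / 2 < f x} x) \<partial>lborel)"
        using True p by (subst nn_integral_cmult)
          (auto simp: mult.assoc[symmetric] ennreal_mult[symmetric] intro!: arg_cong2[where f = "(*)"])
      also have "\<dots> = (\<integral>\<^sup>+x. ?K s x \<partial>lborel)"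
      proof (intro nn_integral_cong)
        fix x
        have "s powr (p - 1) = s powr (p - 1 - 1) * s"
          using True powr_add[of s "p - 1 - 1" 1] by simp
        then show "ennreal (p * s powr (p - 1) * (10 / s)) * ennreal (f x * indicator {x. s / 2 < f x} x) =
            ?K s x"
          using True p f0[of x] by (auto simp: ennreal_mult[symmetric] ac_simps split: split_indicator)
      qed
      finally show ?thesis .
    qed auto
  qed
  also have "\<dots> = (\<integral>\<^sup>+x. \<integral>\<^sup>+s. ?K s x \<partial>lborel \<partial>lborel)"
    by (rule lborel_pair.Fubini') measurable
  also have "\<dots> = (\<integral>\<^sup>+x. ennreal (10 * p * 2 powr (p - 1) / (p - 1)) * ennreal (f x powr p) \<partial>lborel)"
  proof (intro nn_integral_cong)
    fix x
    have "(\<integral>\<^sup>+s. ?K s x \<partial>lborel) =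
        ennreal ((2 * f x) powr (p - 1) / (p - 1)) * ennreal (10 * p * f x)"
      using p f0[of x] by (subst nn_integral_multc) (auto simp: nn_integral_powr_less)
    also have "\<dots> = ennreal ((2 * f x) powr (p - 1) / (p - 1) * (10 * p * f x))"
      using p f0[of x] by (intro ennreal_mult[symmetric]) auto
    also have "(2 * f x) powr (p - 1) / (p - 1) * (10 * p * f x) = 10 * p * 2 powr (p - 1) / (p - 1) * f x powr p"
    proof (cases "f x = 0")
      case False
      then have "f x powr p = f x powr (p - 1) * f x"
        using f0[of x] powr_add[of "f x" "p - 1" 1] by simp
      then show ?thesis using f0[of x] by (simp add: powr_mult)
    qed simp
    finally show "(\<integral>\<^sup>+s. ?K s x \<partial>lborel) =
        ennreal (10 * p * 2 powr (p - 1) / (p - 1)) * ennreal (f x powr p)"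
      using p by (subst ennreal_mult[symmetric]) auto
  qed
  also have "\<dots> = ennreal (10 * p * 2 powr (p - 1) / (p - 1)) * (\<integral>\<^sup>+x. ennreal (f x powr p) \<partial>lborel)"
    by (rule nn_integral_cmult) measurable
  finally show ?thesis .
qed

text \<open>Transference: averaging over translates along \<open>b\<close> reduces to the maximal function of functions
  of one real variable, without splitting the Lebesgue measure into a product.\<close>

lemma dir_max_strong_type:
  fixes f :: "'a::euclidean_space \<Rightarrow> real"
  assumes f[measurable]: "f \<in> borel_measurable borel" and f0: "\<And>x. 0 \<le> f x" and p: "1 < p" and R: "0 < R"
    and fin: "(\<integral>\<^sup>+x. ennreal (f x powr p) \<partial>lborel) < \<infinity>"
  shows "(\<integral>\<^sup>+z. layer p (dir_max R b f z) \<partial>lborel) < \<infinity>"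
proof -
  define C where "C = ennreal (10 * p * 2 powr (p - 1) / (p - 1))"
  \<comment> \<open>For \<open>t\<close> in [-R, R] the maximal function of radius \<open>R\<close>
    sees only parameters in [-2R, 2R]. The cut-off makes the average over \<open>z\<close> finite:
    averaging over length 2R on the left costs length 4R on the right.\<close>
  define F where "F z t = f (z + t *\<^sub>R b) * indicator {-(2*R)..2*R} t" for z t
  have [measurable]: "F z \<in> borel_measurable borel" for z unfolding F_def by measurable
  have loc: "dir_max R b f (z + t *\<^sub>R b) = dir_max R 1 (F z) t" if "t \<in> {-R..R}" for z t
  proof -
    have "(\<integral>\<^sup>+s. ennreal (f (z + (t + s *\<^sub>R 1) *\<^sub>R b)) * indicator {-r..r} s \<partial>lborel) =
        (\<integral>\<^sup>+s. ennreal (F z (t + s *\<^sub>R 1)) * indicator {-r..r} s \<partial>lborel)" if "r \<le> R" for r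
      using that \<open>t \<in> {-R..R}\<close> by (intro nn_integral_cong) (auto simp: F_def split: split_indicator)
    then show ?thesis unfolding dir_max_on_line unfolding dir_max_def by (intro SUP_cong) auto
  qed
  have "ennreal (2 * R) * (\<integral>\<^sup>+z. layer p (dir_max R b f z) \<partial>lborel) =
      (\<integral>\<^sup>+t. indicator {-R..R} t * (\<integral>\<^sup>+z. layer p (dir_max R b f z) \<partial>lborel) \<partial>lborel)"
    using R by (subst nn_integral_multc) auto
  also have "\<dots> = (\<integral>\<^sup>+t. \<integral>\<^sup>+z. indicator {-R..R} t * layer p (dir_max R b f (z + t *\<^sub>R b)) \<partial>lborel \<partial>lborel)"
    by (intro nn_integral_cong, subst nn_integral_cmult)
      (auto simp: nn_integral_translation[where f = "\<lambda>z. layer p (dir_max R b f z)"])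
  also have "\<dots> = (\<integral>\<^sup>+z. \<integral>\<^sup>+t. indicator {-R..R} t * layer p (dir_max R b f (z + t *\<^sub>R b)) \<partial>lborel \<partial>lborel)"
    by (rule lborel_pair.Fubini') measurable
  also have "\<dots> \<le> (\<integral>\<^sup>+z. \<integral>\<^sup>+t. layer p (dir_max R 1 (F z) t) \<partial>lborel \<partial>lborel)"
    by (intro nn_integral_mono) (auto simp: loc split: split_indicator)
  also have "\<dots> \<le> (\<integral>\<^sup>+z. C * (\<integral>\<^sup>+t. ennreal (F z t powr p) \<partial>lborel) \<partial>lborel)"
    unfolding C_def using f0 p by (intro nn_integral_mono dir_max_strong_type_real) (auto simp: F_def)
  also have "\<dots> = (\<integral>\<^sup>+z. C * (\<integral>\<^sup>+t. indicator {-(2*R)..2*R} t * ennreal (f (z + t *\<^sub>R b) powr p) \<partial>lborel) \<partial>lborel)"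
    unfolding F_def using p by (intro nn_integral_cong arg_cong2[where f = "(*)"] refl) (auto split: split_indicator)
  also have "\<dots> = C * (\<integral>\<^sup>+z. (\<integral>\<^sup>+t. indicator {-(2*R)..2*R} t * ennreal (f (z + t *\<^sub>R b) powr p) \<partial>lborel) \<partial>lborel)"
    by (rule nn_integral_cmult) measurable
  also have "(\<integral>\<^sup>+z. (\<integral>\<^sup>+t. indicator {-(2*R)..2*R} t * ennreal (f (z + t *\<^sub>R b) powr p) \<partial>lborel) \<partial>lborel) =
      (\<integral>\<^sup>+t. \<integral>\<^sup>+z. indicator {-(2*R)..2*R} t * ennreal (f (z + t *\<^sub>R b) powr p) \<partial>lborel \<partial>lborel)"
    by (rule lborel_pair.Fubini'[symmetric]) measurable
  also have "\<dots> = (\<integral>\<^sup>+t. indicator {-(2*R)..2*R} t * (\<integral>\<^sup>+z. ennreal (f z powr p) \<partial>lborel) \<partial>lborel)"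
    by (intro nn_integral_cong, subst nn_integral_cmult)
      (auto simp: nn_integral_translation[where f = "\<lambda>z. ennreal (f z powr p)"])
  also have "\<dots> = ennreal (4 * R) * (\<integral>\<^sup>+z. ennreal (f z powr p) \<partial>lborel)"
    using R by (subst nn_integral_multc) auto
  also have "C * \<dots> < \<infinity>"
    using fin by (simp add: C_def ennreal_mult_less_top)
  finally show ?thesis using R by (auto simp: ennreal_mult_less_top)
qed

section \<open>Nonnegative Borel functions in L^p of the whole space\<close>

definition Lp_fun :: "ennreal \<Rightarrow> ('a::euclidean_space \<Rightarrow> real) \<Rightarrow> bool" where
  "Lp_fun p f \<longleftrightarrow> f \<in> borel_measurable borel \<and> (\<forall>x. 0 \<le> f x) \<and>
     (if p = \<infinity> then \<exists>C. AE x in lborel. f x \<le> C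
      else (\<integral>\<^sup>+x. ennreal (f x powr enn2real p) \<partial>lborel) < \<infinity>)"

lemma enn2real_gt_1: "1 < p \<Longrightarrow> p \<noteq> \<infinity> \<Longrightarrow> 1 < enn2real p"
  by (cases p) (auto simp: ennreal_less_iff simp flip: ennreal_1)

lemma powr_add_le:
  assumes "0 \<le> (x::real)" "0 \<le> y" "0 < q"
  shows "(x + y) powr q \<le> 2 powr q * (x powr q + y powr q)"
proof -
  have "(x + y) powr q \<le> (2 * max x y) powr q"
    using assms by (intro powr_mono2) auto
  also have "\<dots> = 2 powr q * max x y powr q"
    using assms by (simp add: powr_mult)
  also have "\<dots> \<le> 2 powr q * (x powr q + y powr q)"
    using assms by (intro mult_left_mono) (auto simp: max_def)
  finally show ?thesis .
qed

lemma Lp_fun_add: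
  assumes f: "Lp_fun p f" and g: "Lp_fun p g" and p: "1 < p"
  shows "Lp_fun p (\<lambda>x. f x + g x)"
proof (cases "p = \<infinity>")
  case True
  obtain C D where "AE x in lborel. f x \<le> C" "AE x in lborel. g x \<le> D"
    using f g True by (auto simp: Lp_fun_def)
  then have "AE x in lborel. f x + g x \<le> C + D" by eventually_elim auto
  then show ?thesis using f g True by (auto simp: Lp_fun_def)
next
  case False
  define q where "q = enn2real p"
  have q: "1 < q" using enn2real_gt_1[OF p False] by (simp add: q_def)
  have [measurable]: "f \<in> borel_measurable borel" "g \<in> borel_measurable borel"
    and fin: "(\<integral>\<^sup>+x. ennreal (f x powr q) \<partial>lborel) < \<infinity>" "(\<integral>\<^sup>+x. ennreal (g x powr q) \<partial>lborel) < \<infinity>"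
    and nn: "\<And>x. 0 \<le> f x" "\<And>x. 0 \<le> g x"
    using f g False by (auto simp: Lp_fun_def q_def)
  have "(\<integral>\<^sup>+x. ennreal ((f x + g x) powr q) \<partial>lborel) \<le>
      (\<integral>\<^sup>+x. ennreal (2 powr q) * (ennreal (f x powr q) + ennreal (g x powr q)) \<partial>lborel)"
    using nn q powr_add_le[OF nn, of q]
    by (intro nn_integral_mono) (auto simp: ennreal_mult[symmetric] ennreal_leI simp flip: ennreal_plus)
  also have "\<dots> = ennreal (2 powr q) * ((\<integral>\<^sup>+x. ennreal (f x powr q) \<partial>lborel) + (\<integral>\<^sup>+x. ennreal (g x powr q) \<partial>lborel))"
    by (subst nn_integral_cmult, measurable, subst nn_integral_add) auto
  also have "\<dots> < \<infinity>" using fin by (simp add: ennreal_mult_less_top)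
  finally show ?thesis using nn False by (simp add: Lp_fun_def q_def)
qed

text \<open>For p infinite, Fubini turns the almost sure bound on space into one on almost every
  line. For finite p, the integrability of \<open>layer\<close> forces finiteness almost everywhere,
  because \<open>layer\<close> is infinite at infinity; \<open>enn2real\<close> then loses nothing
  but a null set.\<close>

lemma Lp_fun_dir_max:
  fixes f :: "'a::euclidean_space \<Rightarrow> real"
  assumes f: "Lp_fun p f" and p: "1 < p" and R: "0 < R"
  shows "AE z in lborel. dir_max R b f z < \<infinity>" and "Lp_fun p (\<lambda>z. enn2real (dir_max R b f z))"
proof -
  have [measurable]: "f \<in> borel_measurable borel" and f0: "\<And>x. 0 \<le> f x"
    using f by (auto simp: Lp_fun_def)
  have "(AE z in lborel. dir_max R b f z < \<infinity>) \<and> Lp_fun p (\<lambda>z. enn2real (dir_max R b f z))"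
  proof (cases "p = \<infinity>")
    case True
    obtain C where C: "AE x in lborel. f x \<le> C" using f True by (auto simp: Lp_fun_def)
    have "AE z in lborel. AE t in lborel. f (z + t *\<^sub>R b) \<le> C"
    proof (subst lborel_pair.AE_commute)
      show "{x \<in> space (lborel \<Otimes>\<^sub>M lborel). f (fst x + snd x *\<^sub>R b) \<le> C} \<in> sets (lborel \<Otimes>\<^sub>M lborel)"
        by measurable
    qed (auto intro!: AE_I2 AE_translation[OF C])
    then have "AE z in lborel. dir_max R b f z \<le> ennreal (max 0 C)"
    proof eventually_elim
      case (elim z)
      show ?case
        unfolding dir_max_def
      proof (rule SUP_least)
        fix r assume r: "r \<in> {r \<in> \<rat>. 0 < r \<and> r \<le> R}"
        have "segment_integral f b z r \<le>
            (\<integral>\<^sup>+t. ennreal (max 0 C) * indicator {-r..r} t \<partial>lborel)"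
          using elim by (intro nn_integral_mono_AE, eventually_elim) (auto intro!: ennreal_leI split: split_indicator)
        also have "\<dots> = ennreal (max 0 C) * ennreal (2 * r)"
          using r by (subst nn_integral_cmult_indicator) auto
        finally have "ennreal (1 / (2 * r)) * segment_integral f b z r \<le>
            ennreal (1 / (2 * r)) * (ennreal (max 0 C) * ennreal (2 * r))"
          by (rule mult_left_mono) simp
        also have "\<dots> = ennreal (max 0 C)"
          using r by (simp add: ennreal_mult[symmetric])
        finally show "ennreal (1 / (2 * r)) * segment_integral f b z r
            \<le> ennreal (max 0 C)" .
      qed
    qed
    then have "AE z in lborel. dir_max R b f z < \<infinity> \<and> enn2real (dir_max R b f z) \<le> max 0 C"
    proof eventually_elim
      case (elim z)
      then show ?case by (auto intro: enn2real_leI le_less_trans)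
    qed
    then show ?thesis using True by (auto simp: Lp_fun_def)
  next
    case False
    define q where "q = enn2real p"
    have q: "1 < q" using enn2real_gt_1[OF p False] by (simp add: q_def)
    have fin: "(\<integral>\<^sup>+z. layer q (dir_max R b f z) \<partial>lborel) < \<infinity>"
      using f False f0 q R by (intro dir_max_strong_type) (auto simp: Lp_fun_def q_def)
    have "AE z in lborel. layer q (dir_max R b f z) \<noteq> \<infinity>"
      using fin by (intro nn_integral_PInf_AE) auto
    then have ae: "AE z in lborel. dir_max R b f z < \<infinity>"
    proof eventually_elim
      case (elim z)
      then show ?case using layer_top[of q] q by (cases "dir_max R b f z = \<infinity>") (auto simp: less_top)
    qed
    have "(\<integral>\<^sup>+z. ennreal (enn2real (dir_max R b f z) powr q) \<partial>lborel) = (\<integral>\<^sup>+z. layer q (dir_max R b f z) \<partial>lborel)"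
      using ae by (intro nn_integral_cong_AE, eventually_elim) (use q in \<open>auto simp: layer_eq_enn2real\<close>)
    with fin ae show ?thesis using False by (simp add: Lp_fun_def q_def)
  qed
  then show "AE z in lborel. dir_max R b f z < \<infinity>" "Lp_fun p (\<lambda>z. enn2real (dir_max R b f z))"
    by auto
qed

section \<open>Weak compactness of bounded sequences\<close>

text \<open>A substitute for the convex hull of the tail of \<open>f\<close> from index
  \<open>k\<close> on. Midpoints are all that the parallelogram law asks for, and rule induction
  carries measurability, bounds and closeness of integrals from the tail to the hull.\<close>

inductive midpoint_hull :: "(nat \<Rightarrow> 'a \<Rightarrow> real) \<Rightarrow> nat \<Rightarrow> ('a \<Rightarrow> real) \<Rightarrow> bool" for f k where
  base: "k \<le> j \<Longrightarrow> midpoint_hull f k (f j)"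
| mid: "midpoint_hull f k g \<Longrightarrow> midpoint_hull f k h \<Longrightarrow> midpoint_hull f k (\<lambda>x. (g x + h x) / 2)"

lemma midpoint_hull_antimono:
  "midpoint_hull f k g \<Longrightarrow> k' \<le> k \<Longrightarrow> midpoint_hull f k' g"
  by (induction rule: midpoint_hull.induct) (auto intro: midpoint_hull.intros)

lemma midpoint_hull_measurable:
  "midpoint_hull f k g \<Longrightarrow> (\<And>j. f j \<in> borel_measurable M) \<Longrightarrow> g \<in> borel_measurable M"
  by (induction rule: midpoint_hull.induct) auto

lemma midpoint_hull_bound:
  "midpoint_hull f k g \<Longrightarrow> (\<And>j x. \<bar>f j x\<bar> \<le> B) \<Longrightarrow> \<bar>g x\<bar> \<le> B"
  by (induction rule: midpoint_hull.induct) (auto simp: abs_le_iff field_simps intro: add_mono)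

context finite_measure
begin

lemma integrable_bounded:
  fixes f :: "'a \<Rightarrow> real"
  assumes "f \<in> borel_measurable M" "\<And>x. \<bar>f x\<bar> \<le> B"
  shows "integrable M f"
  using assms by (intro integrable_const_bound[of _ B]) auto

text \<open>Weak compactness by choosing midpoint combinations of minimal \<open>L\<^sup>2\<close> norm: by the
  parallelogram law these form a Cauchy sequence.\<close>

lemma bounded_weak_limit:
  fixes f :: "nat \<Rightarrow> 'a \<Rightarrow> real"
  assumes meas: "\<And>k. f k \<in> borel_measurable M" and bound: "\<And>k x. \<bar>f k x\<bar> \<le> B"
  shows "\<exists>h\<in>borel_measurable M. (\<forall>x. \<bar>h x\<bar> \<le> B) \<and>
    (\<forall>\<phi>\<in>borel_measurable M. \<forall>c l. (\<forall>x. \<bar>\<phi> x\<bar> \<le> c) \<longrightarrow>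
      (\<lambda>k. \<integral>x. \<phi> x * f k x \<partial>M) \<longlonglongrightarrow> l \<longrightarrow> (\<integral>x. \<phi> x * h x \<partial>M) = l)"
proof -
  have B: "0 \<le> B" using bound[of 0 undefined] by linarith
  note mm = midpoint_hull_measurable[OF _ meas] and mb = midpoint_hull_bound[OF _ bound]
  define n where "n g = (\<integral>x. (g x)\<^sup>2 \<partial>M)" for g :: "'a \<Rightarrow> real"
  define S where "S k = n ` {g. midpoint_hull f k g}" for k
  \<comment> \<open>The hulls shrink as \<open>k\<close> grows, so these infima increase. Being
    bounded they converge, which makes near-minimizers of far tails close to each other.\<close>
  define d where "d k = Inf (S k)" for k
  have n0: "0 \<le> n g" for g by (simp add: n_def)
  have bdd: "bdd_below (S k)" for k by (rule bdd_belowI[of _ 0]) (auto simp: S_def n0)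
  have ne: "S k \<noteq> {}" for k by (auto simp: S_def intro: base)
  have S_anti: "S j \<subseteq> S k" if "k \<le> j" for j k
    using that by (auto simp: S_def intro: midpoint_hull_antimono)
  have sq: "integrable M (\<lambda>x. (g x)\<^sup>2)" if "midpoint_hull f k g" for g k
  proof -
    note [measurable] = mm[OF that]
    show ?thesis
      using mb[OF that] B by (intro integrable_bounded[of _ "B\<^sup>2"]) (auto simp: abs_le_square_iff[symmetric])
  qed
  have d_mono: "d k \<le> d j" if "k \<le> j" for j k
    unfolding d_def by (intro cInf_superset_mono ne bdd S_anti that)
  have d_le: "d k \<le> n g" if "midpoint_hull f k g" for k g
    unfolding d_def using that by (intro cInf_lower bdd) (auto simp: S_def)
  have d_bound: "d k \<le> B\<^sup>2 * measure M (space M)" for k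
  proof -
    have "n (f k) \<le> (\<integral>x. B\<^sup>2 \<partial>M)"
      unfolding n_def using bound B sq[OF base[OF order_refl], of k]
      by (intro integral_mono) (auto simp: abs_le_square_iff[symmetric])
    then show ?thesis using d_le[OF base[OF order_refl], of k] by (simp add: mult.commute)
  qed
  then have "convergent d"
    using d_mono by (intro Bseq_mono_convergent BseqI'[of _ "\<bar>d 0\<bar> + B\<^sup>2 * measure M (space M)"])
      (smt (verit) real_norm_def d_mono le0 zero_le_power2 measure_nonneg mult_nonneg_nonneg)+
  then obtain D where D: "d \<longlonglongrightarrow> D" by (auto simp: convergent_def)
  have dD: "d k \<le> D" for k using D d_mono by (intro incseq_le) (auto simp: incseq_def)
  have "\<exists>g. midpoint_hull f k g \<and> n g < d k + 1 / Suc k" for k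
    using cInf_lessD[OF ne, of k "d k + 1 / Suc k"] by (auto simp: d_def S_def)
  then obtain e where e: "\<And>k. midpoint_hull f k (e k)" "\<And>k. n (e k) < d k + 1 / Suc k" by metis
  note [measurable] = mm[OF e(1)]
  have cauchy: "n (\<lambda>x. e j x - e k x) \<le> 2 * (D - d k) + 4 / Suc k" if "k \<le> j" for j k
  proof -
    \<comment> \<open>The midpoint still belongs to the \<open>k\<close>-th hull, so its squared
      norm is at least \<open>d k\<close>.\<close>
    have h: "midpoint_hull f k (\<lambda>x. (e j x + e k x) / 2)"
      by (intro mid e(1) midpoint_hull_antimono[OF e(1) that])
    have "n (\<lambda>x. e j x - e k x) =
        (\<integral>x. 2 * (e j x)\<^sup>2 + 2 * (e k x)\<^sup>2 - 4 * ((e j x + e k x) / 2)\<^sup>2 \<partial>M)"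
      unfolding n_def by (intro LBINT_cong) (auto simp: power2_eq_square field_simps)
    also have "\<dots> = 2 * n (e j) + 2 * n (e k) - 4 * n (\<lambda>x. (e j x + e k x) / 2)"
      unfolding n_def using sq[OF e(1), of j] sq[OF e(1), of k] sq[OF h] by simp
    also have "\<dots> \<le> 2 * (d j + 1 / Suc j) + 2 * (d k + 1 / Suc k) - 4 * d k"
      by (intro diff_mono add_mono mult_left_mono d_le[OF h] less_imp_le[OF e(2)]) auto
    also have "\<dots> \<le> 2 * (D - d k) + 4 / Suc k"
    proof -
      define \<alpha> where "\<alpha> = 1 / real (Suc j)"
      define \<beta> where "\<beta> = 1 / real (Suc k)"
      have le: "\<alpha> \<le> \<beta>" unfolding \<alpha>_def \<beta>_def using that by (intro divide_left_mono) auto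
      have eq: "4 / real (Suc k) = 4 * \<beta>" by (simp add: \<beta>_def)
      show ?thesis
        unfolding eq \<alpha>_def[symmetric] \<beta>_def[symmetric] using le dD[of j] by (simp add: algebra_simps)
    qed
    finally show ?thesis .
  qed
  have "(\<lambda>k. 2 * (D - d k) + 4 / Suc k) \<longlonglongrightarrow> 2 * (D - D) + 0"
    by (intro tendsto_intros D) (rule LIMSEQ_Suc[OF lim_const_over_n])
  then have lim0: "(\<lambda>k. 2 * (D - d k) + 4 / Suc k) \<longlonglongrightarrow> 0" by simp
  have "\<exists>K. \<forall>j\<ge>K. \<forall>k\<ge>K. k \<le> j \<longrightarrow> n (\<lambda>x. e j x - e k x) \<le> (1 / 8) ^ i" for i
  proof -
    have "eventually (\<lambda>k. 2 * (D - d k) + 4 / Suc k < (1 / 8) ^ i) sequentially"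
      using lim0 by (rule order_tendstoD) simp
    then obtain K where "\<And>k. K \<le> k \<Longrightarrow> 2 * (D - d k) + 4 / Suc k < (1 / 8) ^ i"
      by (auto simp: eventually_sequentially)
    then show ?thesis using cauchy by (intro exI[of _ K]) (meson less_imp_le order_trans)
  qed
  then obtain K where K: "\<And>i j k. K i \<le> j \<Longrightarrow> K i \<le> k \<Longrightarrow> k \<le> j \<Longrightarrow> n (\<lambda>x. e j x - e k x) \<le> (1 / 8) ^ i"
    by metis
  \<comment> \<open>Adding up all earlier thresholds makes \<open>r\<close> nondecreasing, past
    \<open>K i\<close>, and at least \<open>i\<close>.\<close>
  define r where "r i = i + (\<Sum>m\<le>i. K m)" for i
  have r: "K i \<le> r i" "r i \<le> r (Suc i)" "i \<le> r i" for i
    by (auto simp: r_def intro!: member_le_sum trans_le_add2)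
  define a where "a i x = e (r (Suc i)) x - e (r i) x" for i x
  have [measurable]: "a i \<in> borel_measurable M" for i unfolding a_def by measurable
  have na: "n (a i) \<le> (1 / 8) ^ i" for i
    unfolding a_def using r by (intro K[of i]) (auto intro: order_trans)
  \<comment> \<open>The weight 2^i still leaves the convergent series of (2/8)^i. Having the weight,
    the inequality 2 |a| \<le> 2^(-i) + 2^i a^2 turns summability of the weighted squares into
    absolute summability of the increments.\<close>
  have "(\<integral>\<^sup>+x. (\<Sum>i. ennreal (2 ^ i * (a i x)\<^sup>2)) \<partial>M) = (\<Sum>i. \<integral>\<^sup>+x. ennreal (2 ^ i * (a i x)\<^sup>2) \<partial>M)"
    by (rule nn_integral_suminf) measurable
  also have "\<dots> \<le> (\<Sum>i. ennreal ((1 / 4) ^ i))"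
  proof (intro suminf_le)
    fix i
    have bnd: "\<bar>a i x\<bar> \<le> 2 * B" for x
      unfolding a_def using mb[OF e(1), of "r (Suc i)" x] mb[OF e(1), of "r i" x] by linarith
    have "integrable M (\<lambda>x. (a i x)\<^sup>2)"
      using power_mono[OF bnd abs_ge_zero, of _ 2]
      by (intro integrable_bounded[of _ "(2 * B)\<^sup>2"]) (auto simp: power_mult_distrib)
    then have "(\<integral>\<^sup>+x. ennreal (2 ^ i * (a i x)\<^sup>2) \<partial>M) = ennreal (2 ^ i * n (a i))"
      unfolding n_def by (subst nn_integral_eq_integral) auto
    also have "\<dots> \<le> ennreal (2 ^ i * (1 / 8) ^ i)"
      using na[of i] by (intro ennreal_leI mult_left_mono) auto
    also have "(2::real) ^ i * (1 / 8) ^ i = (1 / 4) ^ i" by (simp flip: power_mult_distrib)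
    finally show "(\<integral>\<^sup>+x. ennreal (2 ^ i * (a i x)\<^sup>2) \<partial>M) \<le> ennreal ((1 / 4) ^ i)" .
  qed auto
  also have "\<dots> < \<infinity>"
    by (subst suminf_ennreal2) (auto intro!: summable_geometric)
  finally have "AE x in M. (\<Sum>i. ennreal (2 ^ i * (a i x)\<^sup>2)) \<noteq> \<infinity>"
    by (intro nn_integral_PInf_AE) auto
  then have conv: "AE x in M. convergent (\<lambda>i. e (r i) x)"
  proof eventually_elim
    case (elim x)
    have s1: "summable (\<lambda>i. 2 ^ i * (a i x)\<^sup>2)"
      using elim by (intro summable_suminf_not_top) auto
    have s2: "summable (\<lambda>i. (1 / 2) ^ i :: real)" by (rule summable_geometric) simp
    have "summable (\<lambda>i. a i x)"
    proof (rule summable_comparison_test'[OF summable_add[OF s2 s1]])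
      fix i :: nat
      have "0 \<le> (2 ^ i * \<bar>a i x\<bar> - 1)\<^sup>2 / 2 ^ i" by simp
      also have "\<dots> = 2 ^ i * (a i x)\<^sup>2 - 2 * \<bar>a i x\<bar> + (1 / 2) ^ i"
        by (simp add: power2_eq_square field_simps)
      finally show "norm (a i x) \<le> (1 / 2) ^ i + 2 ^ i * (a i x)\<^sup>2" by simp
    qed
    then have "convergent (\<lambda>m. (\<Sum>i<m. a i x) + e (r 0) x)"
      by (intro convergent_add convergent_const) (simp add: summable_iff_convergent)
    moreover have "(\<Sum>i<m. a i x) + e (r 0) x = e (r m) x" for m
      unfolding a_def by (subst sum_lessThan_telescope) simp
    ultimately show ?case by simp
  qed
  \<comment> \<open>Clipping enforces the bound at every point, including those where the sequence
    diverges and \<open>lim\<close> is arbitrary.\<close>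
  define h where "h x = max (- B) (min B (lim (\<lambda>i. e (r i) x)))" for x
  have [measurable]: "h \<in> borel_measurable M"
    unfolding h_def[abs_def] by (intro borel_measurable_max borel_measurable_min borel_measurable_lim_metric) auto
  have hB: "\<bar>h x\<bar> \<le> B" for x using B by (auto simp: h_def)
  have hlim: "AE x in M. (\<lambda>i. e (r i) x) \<longlonglongrightarrow> h x"
    using conv
  proof eventually_elim
    case (elim x)
    then have l: "(\<lambda>i. e (r i) x) \<longlonglongrightarrow> lim (\<lambda>i. e (r i) x)" by (simp add: convergent_LIMSEQ_iff)
    then have "\<bar>lim (\<lambda>i. e (r i) x)\<bar> \<le> B"
      using mb[OF e(1)] by (intro LIMSEQ_le_const2[OF tendsto_rabs[OF l]]) auto
    then show ?case using l by (simp add: h_def max_absorb2 min_absorb2 abs_le_iff)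
  qed
  have "(\<integral>x. \<phi> x * h x \<partial>M) = l"
    if [measurable]: "\<phi> \<in> borel_measurable M" and c: "\<And>x. \<bar>\<phi> x\<bar> \<le> c"
      and l: "(\<lambda>k. \<integral>x. \<phi> x * f k x \<partial>M) \<longlonglongrightarrow> l" for \<phi> c l
  proof -
    have c0: "0 \<le> c" using c[of undefined] by linarith
    have int: "integrable M (\<lambda>x. \<phi> x * g x)" if "midpoint_hull f k g" for k g
    proof -
      note [measurable] = mm[OF that]
      show ?thesis using mb[OF that] c B c0
        by (intro integrable_bounded[of _ "c * B"]) (auto simp: abs_mult intro!: mult_mono)
    qed
    \<comment> \<open>An interval around \<open>l\<close> is closed under midpoints, so a bound for
      all integrals of the tail passes to its hull. This is why convergence against \<phi>
      determines the integral against \<open>h\<close> without passing to a subsequence of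
      \<open>f\<close>.\<close>
    have near: "\<bar>(\<integral>x. \<phi> x * g x \<partial>M) - l\<bar> \<le> \<epsilon>"
      if "midpoint_hull f k g" and "\<And>j. k \<le> j \<Longrightarrow> \<bar>(\<integral>x. \<phi> x * f j x \<partial>M) - l\<bar> \<le> \<epsilon>" for k g \<epsilon>
      using that
    proof (induction rule: midpoint_hull.induct)
      case (mid g h)
      have "(\<integral>x. \<phi> x * ((g x + h x) / 2) \<partial>M) = ((\<integral>x. \<phi> x * g x \<partial>M) + (\<integral>x. \<phi> x * h x \<partial>M)) / 2"
        using int[OF mid.hyps(1)] int[OF mid.hyps(2)] by (simp add: distrib_left add_divide_distrib)
      then show ?case using mid.IH[OF mid.prems] by (simp add: abs_le_iff field_simps)
    qed auto
    have "(\<lambda>i. \<integral>x. \<phi> x * e (r i) x \<partial>M) \<longlonglongrightarrow> l"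
    proof (rule LIMSEQ_I)
      fix \<epsilon> :: real assume "0 < \<epsilon>"
      then obtain N where N: "\<And>j. N \<le> j \<Longrightarrow> norm ((\<integral>x. \<phi> x * f j x \<partial>M) - l) < \<epsilon> / 2"
        using LIMSEQ_D[OF l, of "\<epsilon> / 2"] by auto
      have "norm ((\<integral>x. \<phi> x * e (r i) x \<partial>M) - l) < \<epsilon>" if "N \<le> i" for i
      proof -
        have "\<bar>(\<integral>x. \<phi> x * e (r i) x \<partial>M) - l\<bar> \<le> \<epsilon> / 2"
          using N r(3)[of i] that by (intro near[OF e(1)]) (simp add: less_imp_le)
        then show ?thesis using \<open>0 < \<epsilon>\<close> by simp
      qed
      then show "\<exists>N. \<forall>i\<ge>N. norm ((\<integral>x. \<phi> x * e (r i) x \<partial>M) - l) < \<epsilon>" by blast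
    qed
    moreover have "(\<lambda>i. \<integral>x. \<phi> x * e (r i) x \<partial>M) \<longlonglongrightarrow> (\<integral>x. \<phi> x * h x \<partial>M)"
    proof (rule integral_dominated_convergence[where w = "\<lambda>_. c * B"])
      show "AE x in M. (\<lambda>i. \<phi> x * e (r i) x) \<longlonglongrightarrow> \<phi> x * h x"
        using hlim by eventually_elim (intro tendsto_intros)
      show "AE x in M. norm (\<phi> x * e (r i) x) \<le> c * B" for i
        using c mb[OF e(1)] c0 by (intro AE_I2) (auto simp: abs_mult intro!: mult_mono)
    qed auto
    ultimately show ?thesis by (metis LIMSEQ_unique)
  qed
  then show ?thesis using hB by (intro bexI[of _ h]) auto
qed

end

section \<open>From pointwise inequalities to weak gradients\<close>

lemma test_function_directional:
  fixes \<phi> :: "'a::euclidean_space \<Rightarrow> real"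
  assumes "\<phi> \<in> test_functions U"
  shows "continuous_on UNIV \<phi>"
    and "continuous_on UNIV (\<lambda>x. directional \<phi> b x)"
    and "((\<lambda>t. \<phi> (x + t *\<^sub>R b)) has_field_derivative directional \<phi> b (x + t *\<^sub>R b)) (at t)"
    and "\<exists>c. \<forall>x. \<bar>\<phi> x\<bar> \<le> c"
    and "\<exists>c. \<forall>x. \<bar>directional \<phi> b x\<bar> \<le> c"
proof -
  define S where "S = closure {x. \<phi> x \<noteq> 0}"
  have C: "Ck (Suc 0) \<phi>" and S: "compact S" using assms by (auto simp: test_functions_def S_def)
  have d: "\<phi> differentiable (at x)" for x using C by simp
  show c1: "continuous_on UNIV \<phi>" using Ck_Suc_imp_Ck[OF C] by simp
  show c2: "continuous_on UNIV (\<lambda>x. directional \<phi> b x)" using C by simp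
  have z: "\<phi> x = 0" if "x \<notin> S" for x
    using that closure_subset[of "{x. \<phi> x \<noteq> 0}"] by (auto simp: S_def)
  have dz: "directional \<phi> b x = 0" if "x \<notin> S" for x
  proof -
    have 1: "((\<lambda>x. 0) has_derivative (\<lambda>v. 0)) (at x)" by (rule has_derivative_const)
    have 2: "open (- S)" by (simp add: S_def open_Compl)
    have 3: "0 = \<phi> y" if "y \<in> - S" for y using z[of y] that by simp
    have "(\<phi> has_derivative (\<lambda>v. 0)) (at x)"
      using that by (intro has_derivative_transform_within_open[OF 1 2 _ 3]) auto
    from fun_cong[OF frechet_derivative_at[OF this], of b] show ?thesis by simp
  qed
  have bounded: "\<exists>c. \<forall>x. \<bar>\<psi> x\<bar> \<le> c"
    if "continuous_on UNIV \<psi>" and "\<And>x. x \<notin> S \<Longrightarrow> \<psi> x = 0" for \<psi> :: "'a \<Rightarrow> real"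
  proof -
    have "bounded (\<psi> ` S)"
      by (intro compact_imp_bounded compact_continuous_image S continuous_on_subset[OF that(1)]) auto
    then obtain c where c: "\<And>x. x \<in> S \<Longrightarrow> \<bar>\<psi> x\<bar> \<le> c" by (auto simp: bounded_iff)
    have "\<bar>\<psi> x\<bar> \<le> max 0 c" for x
      using c[of x] that(2)[of x] by (cases "x \<in> S") auto
    then show ?thesis by blast
  qed
  show "\<exists>c. \<forall>x. \<bar>\<phi> x\<bar> \<le> c" by (rule bounded[OF c1 z])
  show "\<exists>c. \<forall>x. \<bar>directional \<phi> b x\<bar> \<le> c" by (rule bounded[OF c2 dz])
  have "(\<phi> has_derivative frechet_derivative \<phi> (at (x + t *\<^sub>R b))) (at (x + t *\<^sub>R b))"
    using d frechet_derivative_works by blast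
  moreover have "((\<lambda>t. x + t *\<^sub>R b) has_derivative (\<lambda>h. h *\<^sub>R b)) (at t)"
    by (auto intro!: derivative_eq_intros)
  ultimately have "((\<lambda>t. \<phi> (x + t *\<^sub>R b)) has_derivative
      (\<lambda>h. frechet_derivative \<phi> (at (x + t *\<^sub>R b)) (h *\<^sub>R b))) (at t)"
    using has_derivative_compose by blast
  moreover have "frechet_derivative \<phi> (at y) (h *\<^sub>R b) = frechet_derivative \<phi> (at y) b * h" for y h
    using linear_scale[OF linear_frechet_derivative[OF d], of y h b] by simp
  ultimately show "((\<lambda>t. \<phi> (x + t *\<^sub>R b)) has_field_derivative
      directional \<phi> b (x + t *\<^sub>R b)) (at t)"
    by (simp add: has_field_derivative_def)
qed

text \<open>Write the difference quotient as \<theta>(x) (g(x) + g(x + v)) with |\<theta>| \<le> 1.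
  Translating back the term with g(x + v) turns its integral against \<phi> into one of \<phi>
  \<tau> against g dx, where \<tau>(x) = \<theta>(x) + \<theta>(x - v), up to an error that vanishes
  with \<open>v\<close> by continuity of \<phi>. A weak limit \<open>h\<close> of \<tau> gives the
  derivative \<open>g x * h x\<close>, and |\<tau>| \<le> 2 gives the bound
  \<open>2 * g x\<close>.\<close>

lemma hajlasz_weak_derivative:
  fixes u g :: "'a::euclidean_space \<Rightarrow> real"
  assumes U: "open U" and u: "integrable lborel u" and g: "integrable lborel g" and g0: "\<And>x. 0 \<le> g x"
    and N: "N \<in> null_sets lborel"
    and haj: "\<And>x y. x \<in> U - N \<Longrightarrow> y \<in> U - N \<Longrightarrow> \<bar>u x - u y\<bar> \<le> norm (x - y) * (g x + g y)"
    and b: "b \<in> Basis"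
  shows "\<exists>G\<in>borel_measurable borel. (\<forall>x. \<bar>G x\<bar> \<le> 2 * g x) \<and>
    (\<forall>\<phi>\<in>test_functions U.
      weak_partial u b G \<phi>)"
proof -
  have [measurable]: "u \<in> borel_measurable borel" "g \<in> borel_measurable borel" using u g by auto
  define \<epsilon> where "\<epsilon> k = 1 / real (Suc k)" for k
  have \<epsilon>: "0 < \<epsilon> k" "\<epsilon> \<longlonglongrightarrow> 0" for k
    unfolding \<epsilon>_def[abs_def] using LIMSEQ_Suc[OF lim_const_over_n[of 1]] by auto
  define v where "v k = \<epsilon> k *\<^sub>R b" for k
  have v0: "v \<longlonglongrightarrow> 0" unfolding v_def[abs_def] using tendsto_scaleR[OF \<epsilon>(2) tendsto_const[of b]] by simp
  have nv: "norm (v k) = \<epsilon> k" for k using \<epsilon>(1)[of k] b by (simp add: v_def)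
  define D where "D k x = (u (x + v k) - u x) / \<epsilon> k" for k x
  define s where "s k x = g x + g (x + v k)" for k x
  \<comment> \<open>The case distinction keeps |\<theta>| \<le> 1 everywhere, also outside
    \<open>U\<close> and on \<open>N\<close>. If \<open>s k x = 0\<close> in the first case then
    \<open>D k x = 0\<close>, so the division by 0 does no harm.\<close>
  define \<theta> where "\<theta> k x = (if \<bar>D k x\<bar> \<le> s k x then D k x / s k x else 0)" for k x
  define \<tau> where "\<tau> k x = \<theta> k x + \<theta> k (x - v k)" for k x
  have [measurable]: "D k \<in> borel_measurable borel" "s k \<in> borel_measurable borel" for k
    unfolding D_def s_def by measurable
  then have [measurable]: "\<theta> k \<in> borel_measurable borel" for k unfolding \<theta>_def[abs_def] by measurable
  then have [measurable]: "\<tau> k \<in> borel_measurable borel" for k unfolding \<tau>_def[abs_def] by measurable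
  have s0: "0 \<le> s k x" for k x using g0 by (simp add: s_def)
  have \<theta>1: "\<bar>\<theta> k x\<bar> \<le> 1" for k x using s0[of k x] by (auto simp: \<theta>_def abs_divide divide_le_eq_1)
  have \<theta>s: "\<theta> k x * s k x = D k x" if "\<bar>D k x\<bar> \<le> s k x" for k x using that by (auto simp: \<theta>_def)
  have \<tau>2: "\<bar>\<tau> k x\<bar> \<le> 2" for k x
    unfolding \<tau>_def using \<theta>1[of k x] \<theta>1[of k "x - v k"] by linarith
  define M where "M = density lborel (\<lambda>x. ennreal (g x))"
  interpret M: finite_measure M
  proof
    have "emeasure M (space M) = (\<integral>\<^sup>+x. ennreal (g x) \<partial>lborel)"
      unfolding M_def by (subst emeasure_density) auto
    also have "\<dots> < \<infinity>" using g g0 by (simp add: integrable_iff_bounded)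
    finally show "emeasure M (space M) \<noteq> \<infinity>" by simp
  qed
  have [simp]: "sets M = sets borel" by (simp add: M_def)
  have bM: "f \<in> borel_measurable M \<longleftrightarrow> f \<in> borel_measurable borel" for f :: "'a \<Rightarrow> real"
    by (simp add: M_def)
  have M_int: "(\<integral>x. f x \<partial>M) = (LBINT x. g x * f x)" if "f \<in> borel_measurable borel" for f :: "'a \<Rightarrow> real"
    unfolding M_def using that g0 by (subst integral_density) auto
  let ?lim = "\<lambda>h. \<forall>\<phi>\<in>borel_measurable M. \<forall>c l. (\<forall>x. \<bar>\<phi> x\<bar> \<le> c) \<longrightarrow>
      (\<lambda>k. \<integral>x. \<phi> x * \<tau> k x \<partial>M) \<longlonglongrightarrow> l \<longrightarrow> (\<integral>x. \<phi> x * h x \<partial>M) = l"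
  have "\<exists>h\<in>borel_measurable M. (\<forall>x. \<bar>h x\<bar> \<le> 2) \<and> ?lim h"
    by (rule M.bounded_weak_limit) (simp_all add: bM \<tau>2)
  then obtain h where h: "h \<in> borel_measurable M" and h2: "\<forall>x. \<bar>h x\<bar> \<le> 2" and hlim: "?lim h"
    by (elim bexE conjE)
  have [measurable]: "h \<in> borel_measurable borel" using h by (simp add: bM)
  have "(LBINT x. u x * directional \<phi> b x) = - (LBINT x. (g x * h x) * \<phi> x)"
    if \<phi>: "\<phi> \<in> test_functions U" for \<phi>
  proof -
    note test = test_function_directional[OF \<phi>]
    have [measurable]: "\<phi> \<in> borel_measurable borel"
      by (rule borel_measurable_continuous_onI[OF test(1)])
    have [measurable]: "(\<lambda>x. directional \<phi> b x) \<in> borel_measurable borel"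
      by (rule borel_measurable_continuous_onI[OF test(2)])
    obtain c where c: "\<And>x. \<bar>\<phi> x\<bar> \<le> c" using test(4) by blast
    obtain c' where c': "\<And>x. \<bar>directional \<phi> b x\<bar> \<le> c'" using test(5) by blast
    have c0: "0 \<le> c" using c[of 0] by linarith
    have bdd: "integrable lborel (\<lambda>x. w x * f x)"
      if "integrable lborel f" "w \<in> borel_measurable borel" "\<And>x. \<bar>w x\<bar> \<le> C" for w f :: "'a \<Rightarrow> real" and C
    proof (rule LBINT_bound)
      show "integrable lborel (\<lambda>x. C * f x)" using that(1) by simp
      show "(\<lambda>x. w x * f x) \<in> borel_measurable lborel" using that by auto
      have "\<bar>w x\<bar> \<le> \<bar>C\<bar>" for x using that(3)[of x] by linarith
      then show "AE x in lborel. norm (w x * f x) \<le> norm (C * f x)"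
        by (intro AE_I2) (auto simp: abs_mult intro!: mult_right_mono)
    qed
    define q where "q k x = (\<phi> (x - v k) - \<phi> x) / \<epsilon> k" for k x
    have [measurable]: "q k \<in> borel_measurable borel" for k unfolding q_def[abs_def] by measurable
    have q_bound: "\<bar>q k x\<bar> \<le> c'" for k x
    proof -
      have "\<exists>z. - \<epsilon> k < z \<and> z < 0 \<and> \<phi> (x + 0 *\<^sub>R b) - \<phi> (x + - \<epsilon> k *\<^sub>R b) =
          (0 - - \<epsilon> k) * directional \<phi> b (x + z *\<^sub>R b)"
        using \<epsilon>(1)[of k] by (intro MVT2 test(3)) auto
      then obtain z where "\<phi> x - \<phi> (x - v k) = \<epsilon> k * directional \<phi> b (x + z *\<^sub>R b)"
        by (auto simp: v_def)
      then have "q k x = - directional \<phi> b (x + z *\<^sub>R b)"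
        using \<epsilon>(1)[of k] by (simp add: q_def field_simps)
      then show ?thesis using c' by simp
    qed
    have q_lim: "(\<lambda>k. q k x) \<longlonglongrightarrow> - directional \<phi> b x" for x
    proof -
      have "((\<lambda>t. (\<phi> (x + (0 + t) *\<^sub>R b) - \<phi> (x + 0 *\<^sub>R b)) / t) \<longlongrightarrow> directional \<phi> b (x + 0 *\<^sub>R b)) (at 0)"
        using test(3)[where x = x and b = b and t = 0] unfolding DERIV_def by simp
      moreover have "filterlim (\<lambda>k. - \<epsilon> k) (at 0) sequentially"
        using tendsto_minus[OF \<epsilon>(2)] \<epsilon>(1)[THEN less_imp_neq, THEN not_sym] by (simp add: filterlim_at)
      ultimately have "(\<lambda>k. (\<phi> (x + (0 + - \<epsilon> k) *\<^sub>R b) - \<phi> (x + 0 *\<^sub>R b)) / - \<epsilon> k)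
          \<longlonglongrightarrow> directional \<phi> b (x + 0 *\<^sub>R b)"
        by (rule filterlim_compose)
      from tendsto_minus[OF this] show ?thesis by (simp add: q_def[abs_def] v_def)
    qed
    \<comment> \<open>The price for testing the translated half of \<tau> with
      \<open>\<phi> x\<close> instead of \<open>\<phi> (x - v k)\<close>.\<close>
    define err where "err k x = (\<phi> x - \<phi> (x - v k)) * \<theta> k (x - v k) * g x" for k x
    have [measurable]: "err k \<in> borel_measurable borel" for k unfolding err_def[abs_def] by measurable
    have err_le: "\<bar>err k x\<bar> \<le> \<bar>\<phi> x - \<phi> (x - v k)\<bar> * g x" for k x
      using \<theta>1[of k "x - v k"] g0[of x]
      by (auto simp: err_def abs_mult intro!: mult_right_mono mult_right_le_one_le)
    have "(\<lambda>k. LBINT x. err k x) \<longlonglongrightarrow> (LINT x::'a|lborel. 0)"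
    proof (rule integral_dominated_convergence[where w = "\<lambda>x. (2 * c) * g x"])
      show "AE x in lborel. (\<lambda>k. err k x) \<longlonglongrightarrow> 0"
      proof (rule AE_I2)
        fix x
        have "isCont \<phi> x" using test(1) by (simp add: continuous_on_eq_continuous_at)
        moreover have "(\<lambda>k. x - v k) \<longlonglongrightarrow> x" using tendsto_diff[OF tendsto_const v0, of x] by simp
        ultimately have "(\<lambda>k. \<phi> (x - v k)) \<longlonglongrightarrow> \<phi> x" by (rule isCont_tendsto_compose)
        then have "(\<lambda>k. \<bar>\<phi> x - \<phi> (x - v k)\<bar> * g x) \<longlonglongrightarrow> \<bar>\<phi> x - \<phi> x\<bar> * g x"
          by (intro tendsto_intros)
        then show "(\<lambda>k. err k x) \<longlonglongrightarrow> 0"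
          using err_le by (intro Lim_null_comparison[of "\<lambda>k. err k x"]) auto
      qed
      show "AE x in lborel. norm (err k x) \<le> (2 * c) * g x" for k
      proof (rule AE_I2)
        fix x
        have "\<bar>\<phi> x - \<phi> (x - v k)\<bar> \<le> 2 * c" using c[of x] c[of "x - v k"] by linarith
        then have "\<bar>\<phi> x - \<phi> (x - v k)\<bar> * g x \<le> 2 * c * g x" using g0 by (intro mult_right_mono)
        with err_le[of k x] show "norm (err k x) \<le> (2 * c) * g x" by simp
      qed
    qed (use g in auto)
    then have err0: "(\<lambda>k. LBINT x. err k x) \<longlonglongrightarrow> 0" by simp
    have qu: "(\<lambda>k. LBINT x. u x * q k x) \<longlonglongrightarrow> (LBINT x. u x * - directional \<phi> b x)"
    proof (rule integral_dominated_convergence[where w = "\<lambda>x. \<bar>u x\<bar> * c'"])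
      show "AE x in lborel. (\<lambda>k. u x * q k x) \<longlonglongrightarrow> u x * - directional \<phi> b x"
        by (intro AE_I2 tendsto_intros q_lim)
      show "AE x in lborel. norm (u x * q k x) \<le> \<bar>u x\<bar> * c'" for k
        using q_bound by (intro AE_I2) (auto simp: abs_mult intro!: mult_left_mono)
    qed (use u in auto)
    have iu: "integrable lborel (\<lambda>x. u (x + v k))" and ig: "integrable lborel (\<lambda>x. g (x + v k))" for k
      by (rule integrable_translation u g)+
    have split: "(\<integral>x. \<phi> x * \<tau> k x \<partial>M) = (LBINT x. (\<phi> x * \<theta> k x) * s k x) + (LBINT x. err k x)" for k
    proof -
      have c\<theta>: "\<bar>\<phi> x * \<theta> k y\<bar> \<le> c" for x y
        using mult_mono[OF c \<theta>1 c0 abs_ge_zero] by (simp add: abs_mult)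
      have 1: "integrable lborel (\<lambda>x. (\<phi> x * \<theta> k x) * g x)"
        by (intro bdd[OF g, of _ c] c\<theta>) auto
      have 2: "integrable lborel (\<lambda>x. (\<phi> (x - v k) * \<theta> k (x - v k)) * g x)"
        by (intro bdd[OF g, of _ c] c\<theta>) auto
      have 3: "integrable lborel (err k)"
      proof -
        have "\<bar>(\<phi> x - \<phi> (x - v k)) * \<theta> k (x - v k)\<bar> \<le> (2 * c) * 1" for x
          unfolding abs_mult using c[of x] c[of "x - v k"] c0 by (intro mult_mono \<theta>1) auto
        then show ?thesis unfolding err_def[abs_def] by (intro bdd[OF g, of _ "2 * c * 1"]) auto
      qed
      have 4: "integrable lborel (\<lambda>x. (\<phi> x * \<theta> k x) * g (x + v k))"
        by (intro bdd[OF ig, of _ c] c\<theta>) auto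
      have "(\<integral>x. \<phi> x * \<tau> k x \<partial>M) = (LBINT x. g x * (\<phi> x * \<tau> k x))"
        by (rule M_int) measurable
      also have "\<dots> = (LBINT x. (\<phi> x * \<theta> k x) * g x + (\<phi> (x - v k) * \<theta> k (x - v k)) * g x + err k x)"
        by (intro LBINT_cong) (auto simp: \<tau>_def err_def algebra_simps)
      also have "\<dots> = (LBINT x. (\<phi> x * \<theta> k x) * g x) +
          (LBINT x. (\<phi> (x - v k) * \<theta> k (x - v k)) * g x) + (LBINT x. err k x)"
        using 1 2 3 by simp
      also have "(LBINT x. (\<phi> (x - v k) * \<theta> k (x - v k)) * g x) = (LBINT x. (\<phi> x * \<theta> k x) * g (x + v k))"
        using integral_translation[of "\<lambda>x. (\<phi> (x - v k) * \<theta> k (x - v k)) * g x" "v k"] by simp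
      also have "(LBINT x. (\<phi> x * \<theta> k x) * g x) + \<dots> = (LBINT x. (\<phi> x * \<theta> k x) * s k x)"
        unfolding s_def distrib_left by (rule Bochner_Integration.integral_add[OF 1 4, symmetric])
      finally show ?thesis .
    qed
    define S where "S = closure {x. \<phi> x \<noteq> 0}"
    have S: "compact S" "S \<subseteq> U" using \<phi> by (auto simp: test_functions_def S_def)
    \<comment> \<open>The support has positive distance from the complement of \<open>U\<close>.
      Once \<open>\<epsilon> k\<close> is below it, both ends of the difference quotient lie in
      \<open>U\<close> wherever \<phi> does not vanish.\<close>
    obtain \<delta> where \<delta>: "0 < \<delta>" "\<And>x y. x \<in> S \<Longrightarrow> dist x y < \<delta> \<Longrightarrow> y \<in> U"
    proof -
      obtain \<delta> where "0 < \<delta>" "(\<Union>x\<in>S. ball x \<delta>) \<subseteq> U"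
        using compact_subset_open_imp_ball_epsilon_subset[OF S(1) U S(2)] by blast
      moreover have "y \<in> U" if "x \<in> S" "dist x y < \<delta>" for x y
        using subsetD[OF calculation(2)] that by (auto simp: mem_ball)
      ultimately show ?thesis by (intro that[of \<delta>])
    qed
    have "eventually (\<lambda>k. \<epsilon> k < \<delta>) sequentially" using \<epsilon>(2) \<delta>(1) by (rule order_tendstoD)
    then have "eventually (\<lambda>k. (LBINT x. (\<phi> x * \<theta> k x) * s k x) = (LBINT x. u x * q k x)) sequentially"
    proof eventually_elim
      case (elim k)
      have "AE x in lborel. x \<notin> N" by (rule AE_not_in[OF N])
      moreover have "AE x in lborel. x + v k \<notin> N" by (rule AE_translation[OF AE_not_in[OF N]])
      ultimately have "AE x in lborel. (\<phi> x * \<theta> k x) * s k x = \<phi> x * D k x"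
      proof eventually_elim
        case (elim x)
        show ?case
        proof (cases "\<phi> x = 0")
          case False
          then have "x \<in> S" using closure_subset[of "{x. \<phi> x \<noteq> 0}"] by (auto simp: S_def)
          then have "x \<in> U" "x + v k \<in> U"
            using S(2) \<delta>(2)[of x "x + v k"] \<open>\<epsilon> k < \<delta>\<close> nv[of k] by (auto simp: dist_norm)
          then have "\<bar>u (x + v k) - u x\<bar> \<le> \<epsilon> k * s k x"
            using haj[of "x + v k" x] elim nv[of k] by (simp add: s_def add.commute)
          then have "\<bar>D k x\<bar> \<le> s k x"
            using \<epsilon>(1)[of k] by (simp add: D_def abs_divide field_simps)
          from \<theta>s[OF this] show ?thesis by simp
        qed simp
      qed
      then have "(LBINT x. (\<phi> x * \<theta> k x) * s k x) = (LBINT x. \<phi> x * D k x)"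
        by (intro integral_cong_AE) auto
      also have "\<dots> = (LBINT x. (\<phi> x * u (x + v k) - \<phi> x * u x) / \<epsilon> k)"
        by (intro LBINT_cong) (auto simp: D_def field_simps)
      also have "\<dots> = ((LBINT x. \<phi> x * u (x + v k)) - (LBINT x. \<phi> x * u x)) / \<epsilon> k"
        using bdd[OF iu, of \<phi> c k] bdd[OF u, of \<phi> c] c by simp
      also have "(LBINT x. \<phi> x * u (x + v k)) = (LBINT x. \<phi> (x - v k) * u x)"
        using integral_translation[of "\<lambda>x. \<phi> (x - v k) * u x" "v k"] by simp
      also have "((LBINT x. \<phi> (x - v k) * u x) - (LBINT x. \<phi> x * u x)) / \<epsilon> k =
          (LBINT x. (\<phi> (x - v k) * u x - \<phi> x * u x) / \<epsilon> k)"
        using bdd[OF u, of "\<lambda>x. \<phi> (x - v k)" c] bdd[OF u, of \<phi> c] c by simp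
      also have "\<dots> = (LBINT x. u x * q k x)"
        by (intro LBINT_cong) (auto simp: q_def field_simps)
      finally show ?case .
    qed
    then have "(\<lambda>k. LBINT x. (\<phi> x * \<theta> k x) * s k x) \<longlonglongrightarrow> (LBINT x. u x * - directional \<phi> b x)"
      using qu by (subst tendsto_cong)
    from tendsto_add[OF this err0]
    have "(\<lambda>k. \<integral>x. \<phi> x * \<tau> k x \<partial>M) \<longlonglongrightarrow> (LBINT x. u x * - directional \<phi> b x)"
      by (simp add: split)
    then have "(\<integral>x. \<phi> x * h x \<partial>M) = (LBINT x. u x * - directional \<phi> b x)"
      by (intro hlim[rule_format, of \<phi> c]) (simp_all add: c bM)
    also have "(\<integral>x. \<phi> x * h x \<partial>M) = (LBINT x. (g x * h x) * \<phi> x)"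
      by (subst M_int) (auto simp: ac_simps)
    finally show ?thesis by simp
  qed
  moreover have "\<bar>g x * h x\<bar> \<le> 2 * g x" for x
    using mult_left_mono[OF h2[rule_format, of x] g0[of x]] g0[of x] by (simp add: abs_mult mult.commute)
  ultimately show ?thesis by (intro bexI[of _ "\<lambda>x. g x * h x"]) auto
qed

section \<open>Geometry of the cuspidal domains\<close>

lemma length_Omega: "x \<in> Omega I \<psi> c m \<Longrightarrow> length x = m"
  by (cases "(I, \<psi>, c, m)" rule: Omega.cases) auto

text \<open>Points are read as functions of the coordinate index, restricted to indices below
  \<open>m\<close>, so that changing one coordinate is a function update and rescaling is
  pointwise.\<close>

definition in_Omega ::
  "real set \<Rightarrow> (nat \<Rightarrow> real \<Rightarrow> real) \<Rightarrow> (nat \<Rightarrow> real list) \<Rightarrow> nat \<Rightarrow> (nat \<Rightarrow> real) \<Rightarrow> bool" where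
  "in_Omega I \<psi> c m f \<longleftrightarrow> map f [0..<m] \<in> Omega I \<psi> c m"

lemma in_Omega_cong: "(\<And>j. j < m \<Longrightarrow> f j = h j) \<Longrightarrow> in_Omega I \<psi> c m f = in_Omega I \<psi> c m h"
  unfolding in_Omega_def by (intro arg_cong[where f = "\<lambda>x. x \<in> Omega I \<psi> c m"] map_cong) auto

lemma in_Omega_1: "in_Omega I \<psi> c (Suc 0) f \<longleftrightarrow> f 0 \<in> I"
  by (simp add: in_Omega_def)

lemma rescale_map:
  "length a = m \<Longrightarrow> rescale r a (map f [0..<m]) = map (\<lambda>j. (f j - a ! j) / r + a ! j) [0..<m]"
  by (auto simp: rescale_def intro!: nth_equalityI)

text \<open>The piece over [1, 2) repeats the slice at 1, so both pieces obey one formula with the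
  first coordinate capped at 1.\<close>

lemma in_Omega_Suc_Suc:
  assumes "length (c (Suc k)) = Suc k"
  shows "in_Omega I \<psi> c (Suc (Suc k)) f \<longleftrightarrow> 0 < f 0 \<and> f 0 < 2 \<and>
    in_Omega I \<psi> c (Suc k) (\<lambda>j. (f (Suc j) - c (Suc k) ! j) / \<psi> (Suc (Suc k)) (min (f 0) 1) + c (Suc k) ! j)"
proof -
  have m: "map f [0..<Suc (Suc k)] = f 0 # map (\<lambda>j. f (Suc j)) [0..<Suc k]"
    by (simp only: upt_conv_Cons[OF zero_less_Suc] map_Suc_upt[symmetric] list.map map_map comp_def)
  show ?thesis
    unfolding in_Omega_def m
    by (cases "f 0 < 1") (simp_all add: rescale_map[OF assms] min_def del: upt_Suc)
qed

locale cuspidal =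
  fixes I :: "real set" and \<psi> :: "nat \<Rightarrow> real \<Rightarrow> real" and c :: "nat \<Rightarrow> real list" and n :: nat
  assumes I: "is_interval I" "open I" "bounded I"
    and pos: "\<And>i t. i \<in> {1..n} \<Longrightarrow> t \<in> {0<..1} \<Longrightarrow> \<psi> i t > 0"
    and mono: "\<And>i. i \<in> {1..n} \<Longrightarrow> mono_on {0<..1} (\<psi> i)"
    and left_cont: "\<And>i t. i \<in> {1..n} \<Longrightarrow> t \<in> {0<..1} \<Longrightarrow> continuous (at_left t) (\<psi> i)"
    and star: "\<And>i. i \<in> {2..n} \<Longrightarrow> star_center (Omega I \<psi> c (i - 1)) (c (i - 1))"
begin

abbreviation dom :: "nat \<Rightarrow> (nat \<Rightarrow> real) \<Rightarrow> bool" where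
  "dom \<equiv> in_Omega I \<psi> c"

lemma star_center_c: "Suc k < n \<Longrightarrow> star_center (Omega I \<psi> c (Suc k)) (c (Suc k))"
  using star[of "Suc (Suc k)"] by simp

lemma length_c: "Suc k < n \<Longrightarrow> length (c (Suc k)) = Suc k"
  using star_center_c[of k] length_Omega by (auto simp: star_center_def)

lemma dom_star:
  assumes "Suc k < n" "dom (Suc k) f" "s \<in> {0..1}"
  shows "dom (Suc k) (\<lambda>j. (1 - s) * f j + s * c (Suc k) ! j)"
proof -
  have "map2 (\<lambda>xj aj. (1 - s) * xj + s * aj) (map f [0..<Suc k]) (c (Suc k)) \<in> Omega I \<psi> c (Suc k)"
    using star_center_c[OF assms(1)] assms(2,3) unfolding star_center_def in_Omega_def by blast
  also have "map2 (\<lambda>xj aj. (1 - s) * xj + s * aj) (map f [0..<Suc k]) (c (Suc k)) =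
      map (\<lambda>j. (1 - s) * f j + s * c (Suc k) ! j) [0..<Suc k]"
    using length_c[OF assms(1)] by (auto intro!: nth_equalityI simp del: upt_Suc)
  finally show ?thesis by (simp add: in_Omega_def)
qed

text \<open>The point rescaled by \<open>r'\<close> is a convex combination of the point rescaled by
  \<open>r\<close> and the star center, the latter with weight \<open>1 - r / r'\<close>.\<close>

lemma dom_rescale_mono:
  assumes "Suc k < n" "0 < r" "r \<le> r'"
    and "dom (Suc k) (\<lambda>j. (f j - c (Suc k) ! j) / r + c (Suc k) ! j)"
  shows "dom (Suc k) (\<lambda>j. (f j - c (Suc k) ! j) / r' + c (Suc k) ! j)"
proof -
  have "dom (Suc k) (\<lambda>j. (1 - (1 - r / r')) * ((f j - c (Suc k) ! j) / r + c (Suc k) ! j) +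
      (1 - r / r') * c (Suc k) ! j)"
    using assms by (intro dom_star) auto
  also have "(\<lambda>j. (1 - (1 - r / r')) * ((f j - c (Suc k) ! j) / r + c (Suc k) ! j) + (1 - r / r') * c (Suc k) ! j) =
      (\<lambda>j. (f j - c (Suc k) ! j) / r' + c (Suc k) ! j)"
    using assms(2,3) by (intro ext) (simp add: field_simps)
  finally show ?thesis .
qed

lemma psi_min:
  assumes "Suc (Suc k) \<le> n" "0 < t"
  shows "0 < \<psi> (Suc (Suc k)) (min t 1)"
    and "t \<le> t' \<or> 1 \<le> t' \<Longrightarrow> \<psi> (Suc (Suc k)) (min t 1) \<le> \<psi> (Suc (Suc k)) (min t' 1)"
    and "\<psi> (Suc (Suc k)) (min t 1) \<le> \<psi> (Suc (Suc k)) 1"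
  using assms pos[of "Suc (Suc k)" "min t 1"] mono[of "Suc (Suc k)"]
  by (auto intro!: mono_onD[of "{0<..1}" "\<psi> (Suc (Suc k))"])

text \<open>By monotonicity no slice at a given level is scaled by more than the value of \<psi> at
  1.\<close>

lemma dom_bounded:
  assumes "m \<in> {1..n}"
  shows "\<exists>B. \<forall>f j. dom m f \<longrightarrow> j < m \<longrightarrow> \<bar>f j\<bar> \<le> B"
proof -
  have "\<exists>B. \<forall>f j. dom (Suc k) f \<longrightarrow> j < Suc k \<longrightarrow> \<bar>f j\<bar> \<le> B" if "Suc k \<le> n" for k
    using that
  proof (induction k)
    case 0
    then show ?case using I(3) by (auto simp: bounded_iff in_Omega_1)
  next
    case (Suc k)
    then obtain B where B: "\<And>f j. dom (Suc k) f \<Longrightarrow> j < Suc k \<Longrightarrow> \<bar>f j\<bar> \<le> B" by auto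
    define A where "A = (\<Sum>j<Suc k. \<bar>c (Suc k) ! j\<bar>)"
    define P where "P = \<psi> (Suc (Suc k)) 1"
    have P: "0 < P" using pos[of "Suc (Suc k)" 1] Suc.prems by (simp add: P_def)
    show ?case
    proof (intro exI allI impI)
      fix f j assume f: "dom (Suc (Suc k)) f" and j: "j < Suc (Suc k)"
      define r where "r = \<psi> (Suc (Suc k)) (min (f 0) 1)"
      define y where "y j = (f (Suc j) - c (Suc k) ! j) / r + c (Suc k) ! j" for j
      have f0: "0 < f 0" "f 0 < 2" and y: "dom (Suc k) y"
        using f length_c[of k] Suc.prems by (auto simp: in_Omega_Suc_Suc r_def y_def[abs_def])
      have r: "0 < r" "r \<le> P"
        using psi_min(1,3)[of k "f 0"] Suc.prems f0 by (auto simp: r_def P_def)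
      show "\<bar>f j\<bar> \<le> 2 + P * (\<bar>B\<bar> + A) + A"
      proof (cases j)
        case 0
        have "0 \<le> A" by (simp add: A_def sum_nonneg del: sum.lessThan_Suc)
        then have "0 \<le> P * (\<bar>B\<bar> + A) + A" using P by simp
        then show ?thesis using f0 0 by simp
      next
        case (Suc i)
        then have i: "i < Suc k" using j by simp
        have a: "\<bar>c (Suc k) ! i\<bar> \<le> A"
          unfolding A_def using i by (intro member_le_sum) auto
        have "f j = r * (y i - c (Suc k) ! i) + c (Suc k) ! i"
          using r(1) Suc by (simp add: y_def field_simps)
        also have "\<bar>\<dots>\<bar> \<le> r * \<bar>y i - c (Suc k) ! i\<bar> + \<bar>c (Suc k) ! i\<bar>"
          using r(1) by (intro order_trans[OF abs_triangle_ineq]) (simp add: abs_mult)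
        also have "\<dots> \<le> P * (\<bar>B\<bar> + A) + A"
          using r a B[OF y i] P by (intro add_mono mult_mono) auto
        finally show ?thesis by simp
      qed
    qed
  qed
  from this[of "m - 1"] assms show ?thesis by auto
qed

text \<open>If the first coordinate increases, or passes 1, the slice grows and only the other
  coordinates have to be perturbed inside the old slice. If it decreases below 1, the slice shrinks,
  and left continuity of \<psi> keeps the new scaling factor close to the old one.\<close>

lemma dom_open:
  assumes "m \<in> {1..n}" "dom m f"
  shows "\<exists>\<delta>>0. \<forall>h. (\<forall>j<m. \<bar>h j - f j\<bar> < \<delta>) \<longrightarrow> dom m h"
proof -
  have "\<exists>\<delta>>0. \<forall>h. (\<forall>j<Suc k. \<bar>h j - f j\<bar> < \<delta>) \<longrightarrow> dom (Suc k) h" if "Suc k \<le> n" "dom (Suc k) f" for k f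
    using that
  proof (induction k arbitrary: f)
    case 0
    then obtain \<delta> where "0 < \<delta>" "\<And>y. dist y (f 0) < \<delta> \<Longrightarrow> y \<in> I"
      using I(2) by (auto simp: open_dist in_Omega_1)
    then show ?case by (auto simp: in_Omega_1 dist_real_def)
  next
    case (Suc k)
    let ?a = "\<lambda>j. c (Suc k) ! j" and ?\<psi> = "\<lambda>t. \<psi> (Suc (Suc k)) (min t 1)"
    have k: "Suc k < n" "Suc (Suc k) \<le> n" using Suc.prems by auto
    define y where "y j = (f (Suc j) - ?a j) / ?\<psi> (f 0) + ?a j" for j
    have f0: "0 < f 0" "f 0 < 2" and y: "dom (Suc k) y"
      using Suc.prems length_c[OF k(1)] by (auto simp: in_Omega_Suc_Suc y_def[abs_def])
    obtain \<epsilon> where \<epsilon>: "0 < \<epsilon>" "\<And>h. (\<And>j. j < Suc k \<Longrightarrow> \<bar>h j - y j\<bar> < \<epsilon>) \<Longrightarrow> dom (Suc k) h"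
      using Suc.IH[OF _ y] k by auto
    define r where "r = ?\<psi> (f 0)"
    have r: "0 < r" using psi_min(1)[OF k(2) f0(1)] by (simp add: r_def)
    define B where "B = (\<Sum>j<Suc k. \<bar>f (Suc j) - ?a j\<bar>) + 1"
    have B: "\<bar>f (Suc j) - ?a j\<bar> \<le> B" if "j < Suc k" for j
      using that member_le_sum[of j "{..<Suc k}" "\<lambda>j. \<bar>f (Suc j) - ?a j\<bar>"] by (simp add: B_def)
    have B0: "0 < B" by (auto simp: B_def intro!: add_nonneg_pos sum_nonneg)
    \<comment> \<open>The first bound gives \<open>r' > r / 2\<close>. The second bounds the error
      \<open>B * \<bar>r' - r\<bar> / (r * r')\<close> from the change of scale by
      \<open>\<epsilon> / 2\<close>; the other half of \<epsilon> is left for the displacement,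
      through \<open>\<delta> \<le> \<epsilon> * r / 4\<close>.\<close>
    define \<eta> where "\<eta> = min (r / 2) (\<epsilon> * r\<^sup>2 / (4 * B))"
    have \<eta>: "0 < \<eta>" using r \<epsilon>(1) B0 by (simp add: \<eta>_def)
    define t where "t = min (f 0) 1"
    have t: "t \<in> {0<..1}" using f0 by (auto simp: t_def)
    have "((\<lambda>s. \<psi> (Suc (Suc k)) s) \<longlongrightarrow> \<psi> (Suc (Suc k)) t) (at_left t)"
      using left_cont[of "Suc (Suc k)" t] k t by (simp add: continuous_within)
    then have "eventually (\<lambda>s. dist (\<psi> (Suc (Suc k)) s) (\<psi> (Suc (Suc k)) t) < \<eta>) (at_left t)"
      using \<eta> by (rule tendstoD)
    then obtain l where l: "l < t" "\<And>s. l < s \<Longrightarrow> s < t \<Longrightarrow> \<bar>\<psi> (Suc (Suc k)) s - r\<bar> < \<eta>"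
      unfolding eventually_at_left_field dist_real_def by (auto simp: r_def t_def)
    obtain \<delta> where \<delta>: "0 < \<delta>" "\<delta> \<le> f 0" "\<delta> \<le> 2 - f 0" "\<delta> \<le> t - l" "\<delta> \<le> \<epsilon> * r / 4"
    proof -
      have "0 < \<epsilon> * r / 4" using \<epsilon>(1) r by simp
      then show ?thesis
        using f0 l(1) that[of "min (min (f 0) (2 - f 0)) (min (t - l) (\<epsilon> * r / 4))"]
        by (metis diff_gt_0_iff_gt min.cobounded1 min.cobounded2 min.coboundedI1 min.coboundedI2 min_less_iff_conj)
    qed
    show ?case
    proof (intro exI[of _ \<delta>] conjI allI impI \<delta>(1))
      fix h assume h: "\<forall>j<Suc (Suc k). \<bar>h j - f j\<bar> < \<delta>"
      have h0: "\<bar>h 0 - f 0\<bar> < \<delta>" and hS: "\<And>j. j < Suc k \<Longrightarrow> \<bar>h (Suc j) - f (Suc j)\<bar> < \<delta>" using h by auto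
      have h02: "0 < h 0" "h 0 < 2" using h0 \<delta> by auto
      define r' where "r' = ?\<psi> (h 0)"
      have "dom (Suc k) (\<lambda>j. (h (Suc j) - ?a j) / r' + ?a j)"
      proof (cases "f 0 \<le> h 0 \<or> 1 \<le> h 0")
        case True
        then have "r \<le> r'" unfolding r_def r'_def by (rule psi_min(2)[OF k(2) f0(1)])
        moreover have "dom (Suc k) (\<lambda>j. (h (Suc j) - ?a j) / r + ?a j)"
        proof (rule \<epsilon>(2))
          fix j assume j: "j < Suc k"
          have "(h (Suc j) - ?a j) / r + ?a j - y j = (h (Suc j) - f (Suc j)) / r"
            using r by (simp add: y_def r_def field_simps)
          also have "\<bar>\<dots>\<bar> = \<bar>h (Suc j) - f (Suc j)\<bar> / r" using r by simp
          also have "\<dots> < (\<epsilon> * r) / r"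
            using hS[OF j] \<delta>(5) r \<epsilon>(1) mult_pos_pos[OF \<epsilon>(1) r] by (intro divide_strict_right_mono) auto
          finally show "\<bar>(h (Suc j) - ?a j) / r + ?a j - y j\<bar> < \<epsilon>" using r by simp
        qed
        ultimately show ?thesis by (rule dom_rescale_mono[OF k(1) r, where f = "\<lambda>j. h (Suc j)"])
      next
        case False
        then have "l < min (h 0) 1" "min (h 0) 1 < t" using h0 \<delta>(4) by (auto simp: t_def)
        then have "\<bar>r' - r\<bar> < \<eta>" unfolding r'_def by (rule l(2))
        then have rr: "\<bar>r' - r\<bar> < r / 2" "\<bar>r' - r\<bar> < \<epsilon> * r\<^sup>2 / (4 * B)" by (auto simp: \<eta>_def)
        then have r': "r / 2 < r'" by linarith
        show ?thesis
        proof (rule \<epsilon>(2))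
          fix j assume j: "j < Suc k"
          let ?x = "h (Suc j) - f (Suc j)" and ?d = "f (Suc j) - ?a j"
          have "(h (Suc j) - ?a j) / r' + ?a j - y j = ?x / r' + ?d * (r - r') / (r * r')"
            using r r' by (simp add: y_def r_def field_simps)
          also have "\<bar>\<dots>\<bar> \<le> \<bar>?x\<bar> / r' + \<bar>?d\<bar> * \<bar>r' - r\<bar> / (r * r')"
            using r r' by (intro order_trans[OF abs_triangle_ineq]) (simp add: abs_mult abs_divide abs_minus_commute)
          also have "\<dots> < \<epsilon> / 2 + \<epsilon> / 2"
          proof (rule add_less_le_mono)
            have "\<bar>?x\<bar> / r' \<le> \<bar>?x\<bar> / (r / 2)" using r r' by (intro divide_left_mono) auto
            also have "\<dots> < (\<epsilon> * r / 4) / (r / 2)"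
              using hS[OF j] \<delta>(5) r by (intro divide_strict_right_mono) auto
            also have "\<dots> = \<epsilon> / 2" using r by simp
            finally show "\<bar>?x\<bar> / r' < \<epsilon> / 2" .
            have "\<bar>?d\<bar> * \<bar>r' - r\<bar> / (r * r') \<le> B * (\<epsilon> * r\<^sup>2 / (4 * B)) / (r * (r / 2))"
              using B[OF j] B0 rr(2) r r' \<epsilon>(1) by (intro frac_le mult_mono mult_left_mono mult_pos_pos) auto
            also have "\<dots> = \<epsilon> / 2" using r B0 by (simp add: power2_eq_square)
            finally show "\<bar>?d\<bar> * \<bar>r' - r\<bar> / (r * r') \<le> \<epsilon> / 2" .
          qed
          finally show "\<bar>(h (Suc j) - ?a j) / r' + ?a j - y j\<bar> < \<epsilon>" by simp
        qed
      qed
      then show "dom (Suc (Suc k)) h"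
        using h02 length_c[OF k(1)] by (simp add: in_Omega_Suc_Suc r'_def)
    qed
  qed
  from this[of "m - 1" f] assms show ?thesis by auto
qed

text \<open>Fixing the first \<open>i\<close> coordinates fixes \<open>i\<close> nested rescalings,
  and a composition of such maps again has the form (y - v) / r. Hence the section is an affine copy
  of the domain \<open>i\<close> levels below.\<close>

lemma dom_slice:
  assumes "1 \<le> m" "i + m \<le> n" "dom (i + m) f"
  shows "\<exists>r v. 0 < r \<and> (\<forall>h. (\<forall>j<i. h j = f j) \<longrightarrow> dom (i + m) h = dom m (\<lambda>j. (h (i + j) - v j) / r))"
  using assms
proof (induction i arbitrary: f)
  case 0
  show ?case by (intro exI[of _ 1] exI[of _ "\<lambda>_. 0"]) simp
next
  case (Suc i)
  obtain k where k: "i + m = Suc k" using Suc.prems by (cases "i + m") auto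
  then have k': "Suc k < n" "Suc i + m = Suc (Suc k)" "Suc (Suc k) \<le> n" using Suc.prems by auto
  let ?a = "\<lambda>j. c (Suc k) ! j"
  define \<rho> where "\<rho> = \<psi> (Suc (Suc k)) (min (f 0) 1)"
  have f0: "0 < f 0" "f 0 < 2" and F: "dom (i + m) (\<lambda>j. (f (Suc j) - ?a j) / \<rho> + ?a j)"
    using Suc.prems(3) length_c[OF k'(1)] unfolding k'(2) k by (auto simp: in_Omega_Suc_Suc \<rho>_def)
  have \<rho>: "0 < \<rho>" using psi_min(1)[OF k'(3) f0(1)] by (simp add: \<rho>_def)
  obtain r v where r: "0 < r" and v: "\<And>h. (\<And>j. j < i \<Longrightarrow> h j = (f (Suc j) - ?a j) / \<rho> + ?a j) \<Longrightarrow>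
      dom (i + m) h = dom m (\<lambda>j. (h (i + j) - v j) / r)"
    using Suc.IH[OF _ _ F] Suc.prems by auto
  \<comment> \<open>Chosen so that subtracting \<open>w\<close> and dividing by
    \<open>\<rho> * r\<close> is the composition of the two affine maps.\<close>
  define w where "w j = ?a (i + j) - \<rho> * ?a (i + j) + \<rho> * v j" for j
  have "dom (Suc i + m) h = dom m (\<lambda>j. (h (Suc i + j) - w j) / (\<rho> * r))" if h: "\<forall>j<Suc i. h j = f j" for h
  proof -
    have h0: "h 0 = f 0" using h by simp
    have "dom (Suc i + m) h = dom (i + m) (\<lambda>j. (h (Suc j) - ?a j) / \<rho> + ?a j)"
      using f0 length_c[OF k'(1)] unfolding k'(2) k by (simp add: in_Omega_Suc_Suc h0 \<rho>_def)
    also have "\<dots> = dom m (\<lambda>j. (((h (Suc (i + j)) - ?a (i + j)) / \<rho> + ?a (i + j)) - v j) / r)"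
      using h by (intro v) auto
    also have "(\<lambda>j. (((h (Suc (i + j)) - ?a (i + j)) / \<rho> + ?a (i + j)) - v j) / r) =
        (\<lambda>j. (h (Suc i + j) - w j) / (\<rho> * r))"
      using \<rho> r by (intro ext) (simp add: w_def field_simps)
    finally show ?thesis .
  qed
  then show ?case using \<rho> r by (intro exI[of _ "\<rho> * r"] exI[of _ w]) auto
qed

text \<open>Slices grow in the first coordinate and are constant beyond \<open>1\<close>, so both points can be moved
  along it.\<close>

lemma dom_move_first:
  assumes "Suc (Suc k) \<le> n" "dom (Suc (Suc k)) f" "min (f 0) 1 \<le> t" "t < 2"
  shows "dom (Suc (Suc k)) (f(0 := t))"
proof -
  have k: "Suc k < n" using assms(1) by simp
  have f0: "0 < f 0" and D: "dom (Suc k) (\<lambda>j. (f (Suc j) - c (Suc k) ! j) / \<psi> (Suc (Suc k)) (min (f 0) 1) + c (Suc k) ! j)"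
    using assms(2) length_c[OF k] by (auto simp: in_Omega_Suc_Suc)
  have "dom (Suc k) (\<lambda>j. (f (Suc j) - c (Suc k) ! j) / \<psi> (Suc (Suc k)) (min t 1) + c (Suc k) ! j)"
    using assms(3) by (intro dom_rescale_mono[OF k _ _ D] psi_min assms(1) f0) linarith
  moreover have "0 < t" using f0 assms(3) by linarith
  ultimately show ?thesis using assms(4) length_c[OF k] by (simp add: in_Omega_Suc_Suc)
qed

abbreviation reach :: "nat \<Rightarrow> (nat \<Rightarrow> real) \<Rightarrow> real \<Rightarrow> bool" where
  "reach m f s \<equiv> \<forall>t\<in>closed_segment (f 0) s. dom m (f(0 := t))"

text \<open>Moving right never leaves the domain below 2, and there is room 1/2 if
  \<open>h 0 < 3 / 2\<close>. Otherwise the interval is placed to the left of \<open>h 0\<close>;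
  having length at most 1/2 it stays beyond 1, where the slices are constant and moving left is
  harmless.\<close>

lemma common_interval:
  assumes k: "Suc (Suc k) \<le> n" and f: "dom (Suc (Suc k)) f" and h: "dom (Suc (Suc k)) h"
    and d: "\<bar>f 0 - h 0\<bar> \<le> d" "0 < d" and le: "f 0 \<le> h 0"
  shows "\<exists>\<alpha> \<beta>. \<beta> - \<alpha> = min d 1 / 2 \<and> (\<forall>s\<in>{\<alpha><..<\<beta>}. \<bar>s - f 0\<bar> \<le> 2 * d \<and> \<bar>s - h 0\<bar> \<le> 2 * d \<and>
    reach (Suc (Suc k)) f s \<and>
    reach (Suc (Suc k)) h s)"
proof -
  have k': "Suc k < n" using k by simp
  have h2: "h 0 < 2" using h length_c[OF k'] by (auto simp: in_Omega_Suc_Suc)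
  define e where "e = min d 1 / 2"
  have e: "0 < e" "e \<le> d / 2" "e \<le> 1 / 2" using d by (auto simp: e_def)
  define \<alpha> where "\<alpha> = (if h 0 < 3 / 2 then h 0 else h 0 - e)"
  have len: "(\<alpha> + e) - \<alpha> = min d 1 / 2" by (simp add: e_def)
  show ?thesis
  proof (rule exI[of _ \<alpha>], rule exI[of _ "\<alpha> + e"], intro conjI[OF len] ballI)
    fix s assume s: "s \<in> {\<alpha><..<\<alpha> + e}"
    have "\<bar>s - f 0\<bar> \<le> 2 * d" "\<bar>s - h 0\<bar> \<le> 2 * d"
      using s e d le by (auto simp: \<alpha>_def split: if_splits)
    moreover have "dom (Suc (Suc k)) (f(0 := t))" if "t \<in> closed_segment (f 0) s" for t
      using that s e d le h2 by (intro dom_move_first k f)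
        (auto simp: \<alpha>_def closed_segment_eq_real_ivl split: if_splits)
    moreover have "dom (Suc (Suc k)) (h(0 := t))" if "t \<in> closed_segment (h 0) s" for t
      using that s e d le h2 by (intro dom_move_first k h)
        (auto simp: \<alpha>_def closed_segment_eq_real_ivl split: if_splits)
    ultimately show "\<bar>s - f 0\<bar> \<le> 2 * d \<and> \<bar>s - h 0\<bar> \<le> 2 * d \<and>
      reach (Suc (Suc k)) f s \<and>
      reach (Suc (Suc k)) h s" by blast
  qed
qed

lemma common_interval_1:
  assumes f: "dom (Suc 0) f" and h: "dom (Suc 0) h" and le: "f 0 < h 0" and s: "s \<in> {f 0<..<h 0}"
  shows "t \<in> closed_segment (f 0) s \<Longrightarrow> dom (Suc 0) (f(0 := t))"
    and "t \<in> closed_segment (h 0) s \<Longrightarrow> dom (Suc 0) (h(0 := t))"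
  using f h s mem_is_interval_1_I[OF I(1), of "f 0" "h 0" t] by (auto simp: in_Omega_1 closed_segment_eq_real_ivl split: if_splits)

section \<open>Joining intervals in arbitrary coordinates\<close>

lemma slice_diameter:
  "\<exists>L\<ge>1. \<forall>m\<in>{1..n}. \<forall>f h. dom m f \<longrightarrow> dom m h \<longrightarrow> (\<Sum>j<m. \<bar>f j - h j\<bar>) \<le> L"
proof -
  have "\<forall>m. \<exists>B. m \<in> {1..n} \<longrightarrow> (\<forall>f j. dom m f \<longrightarrow> j < m \<longrightarrow> \<bar>f j\<bar> \<le> B)"
    using dom_bounded by blast
  then obtain B where B: "\<And>m f j. m \<in> {1..n} \<Longrightarrow> dom m f \<Longrightarrow> j < m \<Longrightarrow> \<bar>f j\<bar> \<le> B m" by metis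
  define L where "L = 1 + (\<Sum>m\<in>{1..n}. real m * (2 * \<bar>B m\<bar>))"
  have "(\<Sum>j<m. \<bar>f j - h j\<bar>) \<le> L" if m: "m \<in> {1..n}" and f: "dom m f" and h: "dom m h" for m f h
  proof -
    have "(\<Sum>j<m. \<bar>f j - h j\<bar>) \<le> (\<Sum>j<m. 2 * \<bar>B m\<bar>)"
    proof (intro sum_mono)
      fix j assume "j \<in> {..<m}"
      then have "\<bar>f j\<bar> \<le> B m" "\<bar>h j\<bar> \<le> B m" using B[OF m f] B[OF m h] by auto
      then show "\<bar>f j - h j\<bar> \<le> 2 * \<bar>B m\<bar>" by linarith
    qed
    also have "\<dots> = real m * (2 * \<bar>B m\<bar>)" by simp
    also have "\<dots> \<le> (\<Sum>m\<in>{1..n}. real m * (2 * \<bar>B m\<bar>))"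
      using m by (intro member_le_sum) auto
    finally show ?thesis by (simp add: L_def)
  qed
  moreover have "1 \<le> L" unfolding L_def by (simp add: sum_nonneg)
  ultimately show ?thesis by blast
qed

definition joins :: "nat \<Rightarrow> (nat \<Rightarrow> real) \<Rightarrow> real \<Rightarrow> real \<Rightarrow> bool" where
  "joins i z d s \<longleftrightarrow> \<bar>s - z i\<bar> \<le> 2 * d \<and> (\<forall>t\<in>closed_segment (z i) s. dom n (z(i := t)))"

abbreviation joined :: "real \<Rightarrow> nat \<Rightarrow> (nat \<Rightarrow> real) \<Rightarrow> (nat \<Rightarrow> real) \<Rightarrow> real \<Rightarrow> bool" where
  "joined e i z w d \<equiv> \<exists>\<alpha> \<beta>. e \<le> \<beta> - \<alpha> \<and> (\<forall>s\<in>{\<alpha><..<\<beta>}. joins i z d s \<and> joins i w d s)"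

text \<open>Within the affine copy cut out by the common first \<open>i\<close> coordinates,
  distances are divided by \<open>r\<close>, so scaling back gives an interval of length min(d, r) /
  2. As both points lie in this copy, \<open>d \<le> r * L\<close>, and the length is at least
  \<open>d / (2 * L)\<close> whatever the size of \<open>r\<close>.\<close>

lemma joining_interval_le:
  assumes L: "1 \<le> L" "\<And>m f h. m \<in> {1..n} \<Longrightarrow> dom m f \<Longrightarrow> dom m h \<Longrightarrow> (\<Sum>j<m. \<bar>f j - h j\<bar>) \<le> L"
    and i: "i < n" and z: "dom n z" and w: "dom n w" and eq: "\<And>j. j < i \<Longrightarrow> z j = w j"
    and d: "\<And>j. j < n \<Longrightarrow> \<bar>z j - w j\<bar> \<le> d" "d \<le> (\<Sum>j<n. \<bar>z j - w j\<bar>)" "0 < d"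
    and le: "z i \<le> w i"
  shows "joined (d / (2 * L)) i z w d"
proof -
  obtain m where m: "n = i + m" "1 \<le> m" using i by (metis add.commute less_imp_add_positive less_eq_Suc_le One_nat_def)
  obtain r v where r: "0 < r" and slice: "\<And>h. (\<And>j. j < i \<Longrightarrow> h j = z j) \<Longrightarrow>
      dom n h = dom m (\<lambda>j. (h (i + j) - v j) / r)"
    using dom_slice[of m i z] z m by auto
  define f where "f j = (z (i + j) - v j) / r" for j
  define h where "h j = (w (i + j) - v j) / r" for j
  have f: "dom m f" and h: "dom m h"
    using slice[of z] slice[of w] z w eq by (auto simp: f_def[abs_def] h_def[abs_def])
  have upd: "(\<lambda>j. ((y(i := t)) (i + j) - v j) / r) = (\<lambda>j. (y (i + j) - v j) / r)(0 := (t - v 0) / r)" for y t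
    by (auto simp: fun_eq_iff)
  have fz: "dom n (z(i := t)) = dom m (f(0 := (t - v 0) / r))" for t
    unfolding f_def[abs_def] upd[symmetric] by (rule slice) simp
  have hw: "dom n (w(i := t)) = dom m (h(0 := (t - v 0) / r))" for t
    unfolding h_def[abs_def] upd[symmetric] by (rule slice) (simp add: eq)
  have fh: "z (i + j) - w (i + j) = r * (f j - h j)" for j using r by (simp add: f_def h_def field_simps)
  \<comment> \<open>The first \<open>i\<close> coordinates do not contribute, so the whole l^1
    distance is \<open>r\<close> times one measured inside a domain of diameter at most
    \<open>L\<close>.\<close>
  have dr: "d \<le> r * L"
  proof -
    have "(\<Sum>j<i + m'. g j) = (\<Sum>j<i. g j) + (\<Sum>j<m'. g (i + j))" for m' and g :: "nat \<Rightarrow> real"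
      by (induction m') auto
    then have "(\<Sum>j<n. \<bar>z j - w j\<bar>) = (\<Sum>j<i. \<bar>z j - w j\<bar>) + (\<Sum>j<m. \<bar>z (i + j) - w (i + j)\<bar>)"
      unfolding m(1) .
    also have "\<dots> = r * (\<Sum>j<m. \<bar>f j - h j\<bar>)"
      using eq r by (simp add: fh abs_mult sum_distrib_left)
    also have "\<dots> \<le> r * L" using L(2)[OF _ f h] m r by (intro mult_left_mono) auto
    finally show ?thesis using d(2) by linarith
  qed
  have scale: "(t - v 0) / r \<in> closed_segment ((y - v 0) / r) ((s - v 0) / r)" if "t \<in> closed_segment y s" for t y s
    using that r by (auto simp: closed_segment_eq_real_ivl divide_le_cancel split: if_splits)
  have scz: "(t - v 0) / r \<in> closed_segment (f 0) ((s - v 0) / r)" if "t \<in> closed_segment (z i) s" for t s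
    using scale[OF that] by (simp add: f_def)
  have scw: "(t - v 0) / r \<in> closed_segment (h 0) ((s - v 0) / r)" if "t \<in> closed_segment (w i) s" for t s
    using scale[OF that] by (simp add: h_def)
  consider "m = 1" | k where "m = Suc (Suc k)" using m(2) by (metis One_nat_def Suc_le_D not0_implies_Suc)
  then show ?thesis
  proof cases
    case 1
    \<comment> \<open>Only the innermost coordinate is left. It ranges over a copy of the interval
      \<open>I\<close>, where the segment between the points serves as joining interval; all other
      coordinates agree, so its length is at least \<open>d\<close>.\<close>
    have "d \<le> w i - z i"
      using d(2) eq le unfolding m(1) 1 by simp
    show ?thesis
    proof (rule exI[of _ "z i"], rule exI[of _ "w i"], intro conjI ballI)
      show "d / (2 * L) \<le> w i - z i"
      proof -
        have "d / (2 * L) \<le> d / 1" using L(1) d(3) by (intro divide_left_mono) auto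
        with \<open>d \<le> w i - z i\<close> show ?thesis by simp
      qed
      fix s assume s: "s \<in> {z i<..<w i}"
      have sd: "\<bar>s - z i\<bar> \<le> 2 * d" "\<bar>s - w i\<bar> \<le> 2 * d" using s d(1)[OF i] d(3) by auto
      have fh0: "f 0 < h 0" "(s - v 0) / r \<in> {f 0<..<h 0}"
        using s r by (auto simp: f_def h_def divide_strict_right_mono)
      have f': "dom (Suc 0) f" and h': "dom (Suc 0) h" using f h 1 by auto
      show "joins i z d s"
        unfolding joins_def fz 1 One_nat_def using sd common_interval_1(1)[OF f' h' fh0 scz] by blast
      show "joins i w d s"
        unfolding joins_def hw 1 One_nat_def using sd common_interval_1(2)[OF f' h' fh0 scw] by blast
    qed
  next
    case (2 k)
    have k: "Suc (Suc k) \<le> n" using m 2 by simp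
    have "\<bar>z i - w i\<bar> = r * \<bar>f 0 - h 0\<bar>" using fh[of 0] r by (simp add: abs_mult)
    then have d0: "\<bar>f 0 - h 0\<bar> \<le> d / r" using d(1)[OF i] r by (simp add: pos_le_divide_eq mult.commute)
    have le0: "f 0 \<le> h 0" using le r by (simp add: f_def h_def divide_right_mono)
    obtain \<alpha> \<beta> where len: "\<beta> - \<alpha> = min (d / r) 1 / 2"
      and ab: "\<And>s. s \<in> {\<alpha><..<\<beta>} \<Longrightarrow> \<bar>s - f 0\<bar> \<le> 2 * (d / r) \<and> \<bar>s - h 0\<bar> \<le> 2 * (d / r) \<and>
        reach m f s \<and> reach m h s"
      using common_interval[OF k f[unfolded 2] h[unfolded 2] d0 _ le0] d(3) r unfolding 2 by auto
    show ?thesis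
    proof (rule exI[of _ "v 0 + r * \<alpha>"], rule exI[of _ "v 0 + r * \<beta>"], intro conjI ballI)
      have "d / (2 * L) \<le> min d r / 2"
        using dr L(1) d(3) by (auto simp: min_def field_simps)
      also have "\<dots> = r * (\<beta> - \<alpha>)" using r by (simp add: len min_def field_simps)
      finally show "d / (2 * L) \<le> v 0 + r * \<beta> - (v 0 + r * \<alpha>)" by (simp add: algebra_simps)
      fix s assume s: "s \<in> {v 0 + r * \<alpha><..<v 0 + r * \<beta>}"
      then have s': "(s - v 0) / r \<in> {\<alpha><..<\<beta>}" using r by (simp add: field_simps)
      have e: "s - z i = r * ((s - v 0) / r - f 0)" "s - w i = r * ((s - v 0) / r - h 0)"
        using r by (simp_all add: f_def h_def field_simps)
      have "\<bar>s - z i\<bar> \<le> 2 * d" "\<bar>s - w i\<bar> \<le> 2 * d"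
        unfolding e using mult_left_mono[OF conjunct1[OF ab[OF s']], of r]
          mult_left_mono[OF conjunct1[OF conjunct2[OF ab[OF s']]], of r] r by (simp_all add: abs_mult)
      then show "joins i z d s" "joins i w d s"
        unfolding joins_def fz hw using ab[OF s'] scz[of _ s] scw[of _ s] by blast+
    qed
  qed
qed

text \<open>Here \<open>d\<close> may be anything between the maximum and the l^1 distance, so that
  the Euclidean distance can be inserted directly. Joining is symmetric in the two points, which
  removes the order assumption.\<close>

lemma joining_interval:
  "\<exists>\<kappa>>0. \<forall>i z w d. i < n \<longrightarrow> dom n z \<longrightarrow> dom n w \<longrightarrow> (\<forall>j<i. z j = w j) \<longrightarrow>
    (\<forall>j<n. \<bar>z j - w j\<bar> \<le> d) \<longrightarrow> d \<le> (\<Sum>j<n. \<bar>z j - w j\<bar>) \<longrightarrow> 0 < d \<longrightarrow>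
    joined (\<kappa> * d) i z w d"
proof -
  obtain L where L: "1 \<le> L" "\<And>m f h. m \<in> {1..n} \<Longrightarrow> dom m f \<Longrightarrow> dom m h \<Longrightarrow> (\<Sum>j<m. \<bar>f j - h j\<bar>) \<le> L"
    using slice_diameter by blast
  show ?thesis
  proof (rule exI[of _ "1 / (2 * L)"], intro conjI allI impI)
    show "0 < 1 / (2 * L)" using L by simp
    fix i z w d
    assume a: "i < n" "dom n z" "dom n w" "\<forall>j<i. z j = w j" "\<forall>j<n. \<bar>z j - w j\<bar> \<le> d"
      "d \<le> (\<Sum>j<n. \<bar>z j - w j\<bar>)" "0 < d"
    have "joined (d / (2 * L)) i z w d"
    proof (cases "z i \<le> w i")
      case True
      show ?thesis
        by (rule joining_interval_le[OF L a(1-3)]) (use a(4-7) True in auto)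
    next
      case False
      have "joined (d / (2 * L)) i w z d"
        by (rule joining_interval_le[OF L a(1) a(3) a(2)]) (use a(4-7) False in \<open>auto simp: abs_minus_commute\<close>)
      then show ?thesis by blast
    qed
    then show "joined (1 / (2 * L) * d) i z w d"
      by (simp only: mult_1 times_divide_eq_left)
  qed
qed

end

section \<open>From weak gradients to pointwise inequalities\<close>

abbreviation increment_le ::
  "'a::euclidean_space set \<Rightarrow> ('a \<Rightarrow> real) \<Rightarrow> ('a \<Rightarrow> real) \<Rightarrow> 'a \<Rightarrow> 'a \<Rightarrow> real \<Rightarrow> bool" where
  "increment_le U u F b z t \<equiv> (\<forall>\<tau>\<in>closed_segment 0 t. z + \<tau> *\<^sub>R b \<in> U) \<longrightarrow>
     ennreal \<bar>u (z + t *\<^sub>R b) - u z\<bar> \<le> segment_integral F b z \<bar>t\<bar>"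

abbreviation movable :: "'a::euclidean_space set \<Rightarrow> 'a \<Rightarrow> real \<Rightarrow> real \<Rightarrow> 'a \<Rightarrow> bool" where
  "movable U b d s y \<equiv> \<bar>s - y \<bullet> b\<bar> \<le> 2 * d \<and>
     (\<forall>t\<in>closed_segment 0 (s - y \<bullet> b). y + t *\<^sub>R b \<in> U)"

abbreviation pointwise_le ::
  "('a::euclidean_space \<Rightarrow> real) \<Rightarrow> real \<Rightarrow> ('a \<Rightarrow> real) \<Rightarrow> 'a \<Rightarrow> 'a \<Rightarrow> bool" where
  "pointwise_le u C g z w \<equiv> \<bar>u z - u w\<bar> \<le> C * norm (z - w) * (g z + g w)"

abbreviation joinable :: "'a::euclidean_space set \<Rightarrow> 'a \<Rightarrow> real \<Rightarrow> 'a \<Rightarrow> 'a \<Rightarrow> bool" where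
  "joinable U b \<kappa> z w \<equiv> \<exists>\<alpha> \<beta>. \<kappa> * norm (z - w) \<le> \<beta> - \<alpha> \<and>
     (\<forall>s\<in>{\<alpha><..<\<beta>}. \<forall>y\<in>{z, w}. movable U b (norm (z - w)) s y)"

text \<open>The exceptional set of the fundamental theorem depends on the length \<open>t\<close>.
  Fubini exchanges the quantifiers: for almost every \<open>z\<close> the bound holds for almost
  every \<open>t\<close>, which is enough once slices are averaged.\<close>

lemma AE_increment_bound:
  fixes u G F :: "'a::euclidean_space \<Rightarrow> real"
  assumes U: "open U" and b: "b \<in> Basis" and u: "integrable lborel u" and G: "integrable lborel G"
    and weak: "\<And>\<phi>. \<phi> \<in> test_functions U \<Longrightarrow>
      weak_partial u b G \<phi>"
    and F[measurable]: "F \<in> borel_measurable borel" and GF: "\<And>x. \<bar>G x\<bar> \<le> F x"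
  shows "AE z in lborel. AE t in lborel. increment_le U u F b z t"
proof -
  have [measurable]: "u \<in> borel_measurable borel" "G \<in> borel_measurable borel" using u G by auto
  \<comment> \<open>On a line where \<open>G\<close> is not integrable the Bochner integral is 0 by
    default and the bound is trivial.\<close>
  have step: "ennreal \<bar>LBINT t. indicator {0..s} t * G (x + t *\<^sub>R b)\<bar> \<le>
      (\<integral>\<^sup>+t. ennreal (F (x + t *\<^sub>R b)) * indicator {0..s} t \<partial>lborel)" for x s
  proof (cases "integrable lborel (\<lambda>t. indicator {0..s} t * G (x + t *\<^sub>R b))")
    case True
    have "ennreal (norm (LBINT t. indicator {0..s} t * G (x + t *\<^sub>R b))) \<le>
        (\<integral>\<^sup>+t. ennreal (norm (indicator {0..s} t * G (x + t *\<^sub>R b))) \<partial>lborel)"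
      by (rule integral_norm_bound_ennreal[OF True])
    also have "\<dots> \<le> (\<integral>\<^sup>+t. ennreal (F (x + t *\<^sub>R b)) * indicator {0..s} t \<partial>lborel)"
      using GF by (intro nn_integral_mono) (auto intro!: ennreal_leI split: split_indicator)
    finally show ?thesis by simp
  qed (simp add: not_integrable_integral_eq)
  have pos: "AE z in lborel. increment_le U u F b z t"
    if t: "0 < t" for t
  proof -
    have "AE z in lborel. (\<forall>\<tau>\<in>{0..t}. z + \<tau> *\<^sub>R b \<in> U) \<longrightarrow>
        u (z + t *\<^sub>R b) - u z = (LBINT \<tau>. indicator {0..t} \<tau> * G (z + \<tau> *\<^sub>R b))"
      by (rule AE_increment_eq_integral[OF U b u G _ t]) (rule weak)
    then show ?thesis
    proof eventually_elim
      case (elim z)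
      show ?case
      proof
        assume "\<forall>\<tau>\<in>closed_segment 0 t. z + \<tau> *\<^sub>R b \<in> U"
        then have "u (z + t *\<^sub>R b) - u z = (LBINT \<tau>. indicator {0..t} \<tau> * G (z + \<tau> *\<^sub>R b))"
          using elim t by (simp add: closed_segment_eq_real_ivl)
        then have "ennreal \<bar>u (z + t *\<^sub>R b) - u z\<bar> \<le> (\<integral>\<^sup>+\<tau>. ennreal (F (z + \<tau> *\<^sub>R b)) * indicator {0..t} \<tau> \<partial>lborel)"
          using step[of t z] by simp
        also have "\<dots> \<le> segment_integral F b z \<bar>t\<bar>"
          by (intro nn_integral_mono) (auto split: split_indicator)
        finally show "ennreal \<bar>u (z + t *\<^sub>R b) - u z\<bar> \<le> segment_integral F b z \<bar>t\<bar>" .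
      qed
    qed
  qed
  have neg: "AE z in lborel. increment_le U u F b z t"
    if t: "t < 0" for t
  proof -
    have "AE z in lborel. (\<forall>\<tau>\<in>{0..-t}. z + \<tau> *\<^sub>R b \<in> U) \<longrightarrow>
        u (z + (- t) *\<^sub>R b) - u z = (LBINT \<tau>. indicator {0..-t} \<tau> * G (z + \<tau> *\<^sub>R b))"
      by (rule AE_increment_eq_integral[OF U b u G]) (use weak t in auto)
    \<comment> \<open>For negative \<open>t\<close> the same segment is traversed in direction
      \<open>b\<close> from its other end \<open>z + t *\<^sub>R b\<close>.\<close>
    from AE_translation[OF this, of "t *\<^sub>R b"] show ?thesis
    proof eventually_elim
      case (elim z)
      show ?case
      proof
        assume seg: "\<forall>\<tau>\<in>closed_segment 0 t. z + \<tau> *\<^sub>R b \<in> U"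
        have "\<forall>\<sigma>\<in>{0..-t}. z + t *\<^sub>R b + \<sigma> *\<^sub>R b \<in> U"
        proof
          fix \<sigma> assume "\<sigma> \<in> {0..-t}"
          then have "t + \<sigma> \<in> closed_segment 0 t" using t by (auto simp: closed_segment_eq_real_ivl)
          from seg[rule_format, OF this] show "z + t *\<^sub>R b + \<sigma> *\<^sub>R b \<in> U" by (simp add: scaleR_add_left add.assoc)
        qed
        then have "u z - u (z + t *\<^sub>R b) = (LBINT \<tau>. indicator {0..-t} \<tau> * G (z + t *\<^sub>R b + \<tau> *\<^sub>R b))"
          using elim by auto
        then have "ennreal \<bar>u (z + t *\<^sub>R b) - u z\<bar> \<le>
            (\<integral>\<^sup>+\<tau>. ennreal (F (z + t *\<^sub>R b + \<tau> *\<^sub>R b)) * indicator {0..-t} \<tau> \<partial>lborel)"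
          using step[of "- t" "z + t *\<^sub>R b"] by (simp add: abs_minus_commute)
        also have "\<dots> = (\<integral>\<^sup>+\<tau>. ennreal (F (z + (\<tau> + t) *\<^sub>R b)) * indicator {t..0} (\<tau> + t) \<partial>lborel)"
          by (intro nn_integral_cong) (auto simp: scaleR_add_left ac_simps split: split_indicator)
        also have "\<dots> = (\<integral>\<^sup>+\<tau>. ennreal (F (z + \<tau> *\<^sub>R b)) * indicator {t..0} \<tau> \<partial>lborel)"
          by (rule nn_integral_translation[where f = "\<lambda>\<tau>. ennreal (F (z + \<tau> *\<^sub>R b)) * indicator {t..0} \<tau>"]) measurable
        also have "\<dots> \<le> segment_integral F b z \<bar>t\<bar>"
          using t by (intro nn_integral_mono) (auto split: split_indicator)
        finally show "ennreal \<bar>u (z + t *\<^sub>R b) - u z\<bar> \<le> segment_integral F b z \<bar>t\<bar>" .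
      qed
    qed
  qed
  have all: "AE z in lborel. increment_le U u F b z t" for t
    using pos[of t] neg[of t] by (cases t "0::real" rule: linorder_cases) auto
  have "AE z in lborel. AE t in lborel. increment_le U u F b z t"
  proof (subst lborel_pair.AE_commute)
    \<comment> \<open>The exchange asks for joint measurability. The condition on segments is
      measurable because it is open in the pair.\<close>
    have [measurable]: "Measurable.pred (borel \<Otimes>\<^sub>M borel) (\<lambda>x. \<forall>\<tau>\<in>closed_segment 0 (snd x). fst x + \<tau> *\<^sub>R b \<in> U)"
    proof -
      have "{x. \<forall>\<tau>\<in>closed_segment 0 (snd x). fst x + \<tau> *\<^sub>R b \<in> U} \<in> sets borel"
        using borel_open[OF open_segment_pairs[OF U, of b]] by (simp add: case_prod_beta')
      then show ?thesis unfolding pred_def borel_prod by simp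
    qed
    have [measurable]: "(\<lambda>x. segment_integral F b (fst x) \<bar>snd x\<bar>) \<in> borel_measurable (borel \<Otimes>\<^sub>M borel)"
    proof -
      have "(\<lambda>x. segment_integral F b (fst x) \<bar>snd x\<bar>) = (\<lambda>x. \<integral>\<^sup>+\<tau>. ennreal (F (fst x + \<tau> *\<^sub>R b)) *
          (if -\<bar>snd x\<bar> \<le> \<tau> \<and> \<tau> \<le> \<bar>snd x\<bar> then 1 else 0) \<partial>lborel)"
        by (intro ext nn_integral_cong) (auto split: split_indicator)
      then show ?thesis by simp
    qed
    show "{x \<in> space (lborel \<Otimes>\<^sub>M lborel). (\<forall>\<tau>\<in>closed_segment 0 (snd x). fst x + \<tau> *\<^sub>R b \<in> U) \<longrightarrow>
      ennreal \<bar>u (fst x + snd x *\<^sub>R b) - u (fst x)\<bar> \<le> segment_integral F b (fst x) \<bar>snd x\<bar>} \<in> sets (lborel \<Otimes>\<^sub>M lborel)"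
      by measurable
  qed (auto intro!: AE_I2 all)
  then show ?thesis .
qed

lemma norm_remove_coordinate_le:
  assumes "b \<in> (Basis :: 'a::euclidean_space set)"
  shows "norm (x - (x \<bullet> b) *\<^sub>R b) \<le> norm x"
  using assms by (intro norm_le_componentwise) (auto simp: inner_diff_left inner_Basis)

lemma AE_lborel_null_set:
  assumes "AE x in lborel. P x"
  obtains N where "N \<in> null_sets lborel" "\<And>x. x \<notin> N \<Longrightarrow> P x"
  using assms that by (auto simp: eventually_ae_filter)

text \<open>Going from \<open>z\<close> to \<open>w\<close> through the hyperplane with
  \<open>b\<close>-coordinate \<open>s\<close> costs two segment integrals of \<open>F\<close> and
  one application of the bound with \<open>g\<close> at the moved points. Averaging over
  \<open>s\<close> turns the values of \<open>g\<close> into segment integrals through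
  \<open>z\<close> and \<open>w\<close>, so everything is bounded by the maximal function of
  \<open>F + g\<close> along \<open>b\<close>. The bound on pairs whose difference has no
  \<open>b\<close>-component is passed as a premise for the given \<open>z\<close> and
  \<open>w\<close>, so that the induction can supply it under its own conditions.\<close>

lemma join_step:
  fixes u F g :: "'a::euclidean_space \<Rightarrow> real" and U :: "'a set"
  assumes b: "b \<in> Basis" and p: "1 < p" and F: "Lp_fun p F" and g: "Lp_fun p g"
    and C: "0 \<le> C" and N: "N \<in> null_sets lborel" and \<kappa>: "0 < \<kappa>"
    and diam: "\<And>z w. z \<in> U \<Longrightarrow> w \<in> U \<Longrightarrow> norm (z - w) \<le> R"
    and incr: "AE z in lborel. AE t in lborel. increment_le U u F b z t"
  obtains g' C' N' where "Lp_fun p g'" "0 \<le> C'" "N' \<in> null_sets lborel"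
    "\<And>z w \<alpha> \<beta>. z \<in> U - N' \<Longrightarrow> w \<in> U - N' \<Longrightarrow> \<kappa> * norm (z - w) \<le> \<beta> - \<alpha> \<Longrightarrow>
      (\<And>s y. s \<in> {\<alpha><..<\<beta>} \<Longrightarrow> y = z \<or> y = w \<Longrightarrow> movable U b (norm (z - w)) s y) \<Longrightarrow>
      (\<And>z' w'. z' \<in> U - N \<Longrightarrow> w' \<in> U - N \<Longrightarrow> z' - w' = (z - w) - ((z - w) \<bullet> b) *\<^sub>R b \<Longrightarrow>
         pointwise_le u C g z' w') \<Longrightarrow>
      pointwise_le u C' g' z w"
proof -
  have F0: "0 \<le> F x" and g0: "0 \<le> g x" for x using F g by (auto simp: Lp_fun_def)
  have [measurable]: "F \<in> borel_measurable borel" "g \<in> borel_measurable borel"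
    using F g by (auto simp: Lp_fun_def)
  define h where "h x = F x + g x" for x
  have h: "Lp_fun p h" unfolding h_def[abs_def] by (rule Lp_fun_add[OF F g p])
  \<comment> \<open>Moves have length up to \<open>2 * d\<close>, and comparing with
    \<open>dir_max\<close> doubles the radius: \<open>4 * d\<close> has to stay below
    \<open>R'\<close>.\<close>
  define R' where "R' = 4 * \<bar>R\<bar> + 1"
  have R': "0 < R'" by (simp add: R'_def)
  define M where "M = dir_max R' b h"
  define g' where "g' z = enn2real (M z)" for z
  \<comment> \<open>A segment integral over radius \<open>2 * d\<close> is at most
    \<open>8 * d\<close> times the maximal function. The two moves give 8. The middle term carries
    \<open>C * d\<close> and is divided by the length of the interval, at least
    \<open>\<kappa> * d\<close>, which gives \<open>8 * C / \<kappa>\<close>.\<close>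
  define C' where "C' = 8 + 8 * C / \<kappa>"
  have g': "Lp_fun p g'" unfolding g'_def[abs_def] M_def by (rule Lp_fun_dir_max(2)[OF h p R'])
  have Mfin: "AE z in lborel. M z < \<infinity>" unfolding M_def by (rule Lp_fun_dir_max(1)[OF h p R'])
  \<comment> \<open>For almost every \<open>z\<close> the line through \<open>z\<close> along
    \<open>b\<close> meets \<open>N\<close> in a null set, so almost every moved point is admissible
    for the bound with \<open>g\<close>.\<close>
  have offN: "AE z in lborel. AE t in lborel. z + t *\<^sub>R b \<notin> N"
  proof (subst lborel_pair.AE_commute)
    have [measurable]: "N \<in> sets borel" using N by auto
    show "{x \<in> space (lborel \<Otimes>\<^sub>M lborel). fst x + snd x *\<^sub>R b \<notin> N} \<in> sets (lborel \<Otimes>\<^sub>M lborel)"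
      by measurable
  qed (auto intro!: AE_I2 AE_translation[OF AE_not_in[OF N]])
  have "AE z in lborel. M z < \<infinity> \<and> (AE t in lborel. z + t *\<^sub>R b \<notin> N \<and>
      (increment_le U u F b z t))"
    using Mfin offN incr by eventually_elim auto
  then obtain N' where N': "N' \<in> null_sets lborel"
    and good: "\<And>z. z \<notin> N' \<Longrightarrow> M z < \<infinity>" "\<And>z. z \<notin> N' \<Longrightarrow> (AE t in lborel. z + t *\<^sub>R b \<notin> N \<and>
      (increment_le U u F b z t))"
    by (rule AE_lborel_null_set) blast
  have "pointwise_le u C' g' z w"
    if z: "z \<in> U - N'" and w: "w \<in> U - N'" and ab: "\<kappa> * norm (z - w) \<le> \<beta> - \<alpha>"
      and join: "\<And>s y. s \<in> {\<alpha><..<\<beta>} \<Longrightarrow> y = z \<or> y = w \<Longrightarrow> movable U b (norm (z - w)) s y"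
      and IH: "\<And>z' w'. z' \<in> U - N \<Longrightarrow> w' \<in> U - N \<Longrightarrow> z' - w' = (z - w) - ((z - w) \<bullet> b) *\<^sub>R b \<Longrightarrow>
         pointwise_le u C g z' w'" for z w \<alpha> \<beta>
  proof (cases "z = w")
    case False
    define d where "d = norm (z - w)"
    have d: "0 < d" "2 * (2 * d) \<le> R'" using False diam[of z w] z w by (auto simp: d_def R'_def)
    have len: "\<kappa> * d \<le> \<beta> - \<alpha>" using ab by (simp add: d_def)
    then have len': "0 < \<beta> - \<alpha>" using mult_pos_pos[OF \<kappa> d(1)] by linarith
    note len = len len'
    define I where "I f y = segment_integral f b y (2*d)" for f :: "'a \<Rightarrow> real" and y
    define P where "P y s = y + (s - y \<bullet> b) *\<^sub>R b" for y s
    have [measurable]: "P y \<in> borel_measurable borel" for y unfolding P_def by measurable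
    have Ih: "I F y \<le> ennreal (8 * d) * M y" "I g y \<le> ennreal (8 * d) * M y" for y
    proof -
      have "I h y \<le> ennreal (4 * (2 * d)) * M y"
        unfolding I_def M_def using d by (intro segment_integral_le_dir_max) auto
      moreover have "I F y \<le> I h y" "I g y \<le> I h y"
        unfolding I_def h_def using F0 g0
        by (auto intro!: nn_integral_mono mult_right_mono ennreal_leI)
      ultimately show "I F y \<le> ennreal (8 * d) * M y" "I g y \<le> ennreal (8 * d) * M y"
        by auto
    qed
    have ae: "AE s in lborel. s \<in> {\<alpha><..<\<beta>} \<longrightarrow> P y s \<in> U - N \<and> ennreal \<bar>u (P y s) - u y\<bar> \<le> I F y"
      if y: "y = z \<or> y = w" for y
    proof -
      have "y \<notin> N'" using y z w by auto
      from AE_translation[OF good(2)[OF this], of "- (y \<bullet> b)"] show ?thesis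
      proof eventually_elim
        case (elim s)
        show ?case
        proof
          assume s: "s \<in> {\<alpha><..<\<beta>}"
          from join[OF s y] have sd: "\<bar>s - y \<bullet> b\<bar> \<le> 2 * d"
            and seg: "\<And>t. t \<in> closed_segment 0 (s - y \<bullet> b) \<Longrightarrow> y + t *\<^sub>R b \<in> U"
            by (auto simp: d_def)
          have "ennreal \<bar>u (P y s) - u y\<bar> \<le> segment_integral F b y (\<bar>s - y \<bullet> b\<bar>)"
            using elim seg by (simp add: P_def)
          also have "\<dots> \<le> I F y"
            unfolding I_def using sd by (intro nn_integral_mono) (auto split: split_indicator)
          finally have "ennreal \<bar>u (P y s) - u y\<bar> \<le> I F y" .
          moreover have "P y s \<in> U" unfolding P_def by (rule seg) simp
          moreover have "P y s \<notin> N" using elim by (simp add: P_def)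
          ultimately show "P y s \<in> U - N \<and> ennreal \<bar>u (P y s) - u y\<bar> \<le> I F y" by simp
        qed
      qed
    qed
    have Pdiff: "P z s - P w s = (z - w) - ((z - w) \<bullet> b) *\<^sub>R b" for s
      by (simp add: P_def inner_diff_left algebra_simps)
    have Pnorm: "norm (P z s - P w s) \<le> d" for s
      unfolding Pdiff d_def by (rule norm_remove_coordinate_le[OF b])
    define A where "A = I F z + I F w"
    have "AE s in lborel. s \<in> {\<alpha><..<\<beta>} \<longrightarrow>
        ennreal \<bar>u z - u w\<bar> \<le> A + ennreal (C * d) * (ennreal (g (P z s)) + ennreal (g (P w s)))"
      using ae[OF disjI1[OF refl]] ae[OF disjI2[OF refl]]
    proof eventually_elim
      case (elim s)
      show ?case
      proof
        assume "s \<in> {\<alpha><..<\<beta>}"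
        with elim have U: "P z s \<in> U - N" "P w s \<in> U - N"
          and uz: "ennreal \<bar>u (P z s) - u z\<bar> \<le> I F z" and uw: "ennreal \<bar>u (P w s) - u w\<bar> \<le> I F w" by auto
        have "\<bar>u (P z s) - u (P w s)\<bar> \<le> C * norm (P z s - P w s) * (g (P z s) + g (P w s))"
          by (rule IH[OF U Pdiff])
        also have "\<dots> \<le> C * d * (g (P z s) + g (P w s))"
          using Pnorm[of s] C g0 by (intro mult_right_mono mult_left_mono) auto
        finally have mid: "ennreal \<bar>u (P z s) - u (P w s)\<bar> \<le> ennreal (C * d) * (ennreal (g (P z s)) + ennreal (g (P w s)))"
          using C d(1) g0 by (simp add: ennreal_mult[symmetric] ennreal_leI flip: ennreal_plus)
        have "ennreal \<bar>u z - u w\<bar> \<le> ennreal (\<bar>u (P z s) - u z\<bar> + \<bar>u (P w s) - u w\<bar> + \<bar>u (P z s) - u (P w s)\<bar>)"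
          by (intro ennreal_leI) linarith
        also have "\<dots> = ennreal \<bar>u (P z s) - u z\<bar> + ennreal \<bar>u (P w s) - u w\<bar> + ennreal \<bar>u (P z s) - u (P w s)\<bar>"
          by simp
        also have "\<dots> \<le> A + ennreal (C * d) * (ennreal (g (P z s)) + ennreal (g (P w s)))"
          unfolding A_def by (intro add_mono uz uw mid)
        finally show "ennreal \<bar>u z - u w\<bar> \<le> A + ennreal (C * d) * (ennreal (g (P z s)) + ennreal (g (P w s)))" .
      qed
    qed
    \<comment> \<open>Integration over \<open>s\<close> multiplies the left side and the terms
      independent of \<open>s\<close> by \<open>\<beta> - \<alpha>\<close>, which is cancelled at
      the end.\<close>
    then have "(\<integral>\<^sup>+s. ennreal \<bar>u z - u w\<bar> * indicator {\<alpha><..<\<beta>} s \<partial>lborel) \<le>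
        (\<integral>\<^sup>+s. A * indicator {\<alpha><..<\<beta>} s + ennreal (C * d) * (ennreal (g (P z s)) * indicator {\<alpha><..<\<beta>} s
          + ennreal (g (P w s)) * indicator {\<alpha><..<\<beta>} s) \<partial>lborel)"
      by (intro nn_integral_mono_AE, eventually_elim) (auto split: split_indicator)
    also have "\<dots> = A * ennreal (\<beta> - \<alpha>) + ennreal (C * d) *
        ((\<integral>\<^sup>+s. ennreal (g (P z s)) * indicator {\<alpha><..<\<beta>} s \<partial>lborel) + (\<integral>\<^sup>+s. ennreal (g (P w s)) * indicator {\<alpha><..<\<beta>} s \<partial>lborel))"
      using len by (simp add: nn_integral_add nn_integral_cmult)
    also have "\<dots> \<le> A * ennreal (\<beta> - \<alpha>) + ennreal (C * d) * (I g z + I g w)"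
    proof (intro add_left_mono mult_left_mono add_mono)
      have "(\<integral>\<^sup>+s. ennreal (g (P y s)) * indicator {\<alpha><..<\<beta>} s \<partial>lborel) \<le> I g y" if y: "y = z \<or> y = w" for y
      proof -
        have "(\<integral>\<^sup>+s. ennreal (g (P y s)) * indicator {\<alpha><..<\<beta>} s \<partial>lborel) =
            (\<integral>\<^sup>+t. ennreal (g (P y (t + y \<bullet> b))) * indicator {\<alpha><..<\<beta>} (t + y \<bullet> b) \<partial>lborel)"
          by (rule nn_integral_translation[where f = "\<lambda>s. ennreal (g (P y s)) * indicator {\<alpha><..<\<beta>} s", symmetric]) measurable
        also have "\<dots> \<le> I g y"
          unfolding I_def
        proof (intro nn_integral_mono)
          fix t
          show "ennreal (g (P y (t + y \<bullet> b))) * indicator {\<alpha><..<\<beta>} (t + y \<bullet> b) \<le>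
              ennreal (g (y + t *\<^sub>R b)) * indicator {-(2*d)..2*d} t"
            using join[of "t + y \<bullet> b" y] y by (auto simp: P_def d_def split: split_indicator)
        qed
        finally show ?thesis .
      qed
      then show "(\<integral>\<^sup>+s. ennreal (g (P z s)) * indicator {\<alpha><..<\<beta>} s \<partial>lborel) \<le> I g z"
        "(\<integral>\<^sup>+s. ennreal (g (P w s)) * indicator {\<alpha><..<\<beta>} s \<partial>lborel) \<le> I g w" by auto
    qed auto
    also have "\<dots> \<le> (ennreal (8 * d) * M z + ennreal (8 * d) * M w) * ennreal (\<beta> - \<alpha>) +
        ennreal (C * d) * (ennreal (8 * d) * M z + ennreal (8 * d) * M w)"
      unfolding A_def by (intro add_mono mult_right_mono mult_left_mono Ih) auto
    also have "M z = ennreal (g' z)" using good(1)[of z] z by (simp add: g'_def)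
    also have "M w = ennreal (g' w)" using good(1)[of w] w by (simp add: g'_def)
    also have "(ennreal (8 * d) * ennreal (g' z) + ennreal (8 * d) * ennreal (g' w)) * ennreal (\<beta> - \<alpha>) +
        ennreal (C * d) * (ennreal (8 * d) * ennreal (g' z) + ennreal (8 * d) * ennreal (g' w)) =
        ennreal ((8 * d * g' z + 8 * d * g' w) * (\<beta> - \<alpha>) + C * d * (8 * d * g' z + 8 * d * g' w))"
      using d(1) C len(2) by (simp add: g'_def ennreal_mult' ennreal_plus mult_nonneg_nonneg)
    also have "(\<integral>\<^sup>+s. ennreal \<bar>u z - u w\<bar> * indicator {\<alpha><..<\<beta>} s \<partial>lborel) = ennreal (\<bar>u z - u w\<bar> * (\<beta> - \<alpha>))"
      using len by (simp add: nn_integral_cmult ennreal_mult)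
    finally have "\<bar>u z - u w\<bar> * (\<beta> - \<alpha>) \<le> (8 * d * g' z + 8 * d * g' w) * (\<beta> - \<alpha>) + C * d * (8 * d * g' z + 8 * d * g' w)"
      using d(1) C len(2) by (subst (asm) ennreal_le_iff) (auto simp: g'_def intro!: add_nonneg_nonneg mult_nonneg_nonneg)
    also have "C * d * (8 * d * g' z + 8 * d * g' w) = (C / \<kappa>) * (\<kappa> * d) * (8 * d * g' z + 8 * d * g' w)"
      using \<kappa> by simp
    also have "\<dots> \<le> (C / \<kappa>) * (\<beta> - \<alpha>) * (8 * d * g' z + 8 * d * g' w)"
      using len(1) C \<kappa> d(1) by (intro mult_right_mono mult_left_mono) (auto simp: g'_def)
    also have "(8 * d * g' z + 8 * d * g' w) * (\<beta> - \<alpha>) + (C / \<kappa>) * (\<beta> - \<alpha>) * (8 * d * g' z + 8 * d * g' w) =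
        (C' * d * (g' z + g' w)) * (\<beta> - \<alpha>)"
    proof -
      have "(8 * d * x + 8 * d * y) * l + q * l * (8 * d * x + 8 * d * y) = ((8 + 8 * q) * d * (x + y)) * l"
        for x y l q by (simp add: algebra_simps)
      from this[of "g' z" "g' w" "\<beta> - \<alpha>" "C / \<kappa>"] show ?thesis by (simp add: C'_def)
    qed
    finally show ?thesis
      using len(2) by (simp add: d_def)
  qed simp
  with g' N' C \<kappa> show ?thesis by (intro that[of g' C' N']) (auto simp: C'_def)
qed

text \<open>The induction variable \<open>m\<close> counts the trailing coordinates in which the
  points may differ. Moving both to a common value of coordinate \<open>n - Suc m\<close> leaves at
  most \<open>m\<close> of them, and for \<open>m = 0\<close> the points coincide. Each step
  replaces \<open>g\<close> by a maximal function of \<open>F + g\<close> along one more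
  direction.\<close>

lemma hajlasz_of_joining:
  fixes u F :: "'a::euclidean_space \<Rightarrow> real" and U :: "'a set" and b :: "nat \<Rightarrow> 'a"
  assumes b: "bij_betw b {..<n} Basis" and p: "1 < p" and F: "Lp_fun p F" and \<kappa>: "0 < \<kappa>"
    and diam: "\<And>z w. z \<in> U \<Longrightarrow> w \<in> U \<Longrightarrow> norm (z - w) \<le> R"
    and incr: "\<And>b. b \<in> Basis \<Longrightarrow> AE z in lborel. AE t in lborel. increment_le U u F b z t"
    and join: "\<And>i z w. i < n \<Longrightarrow> z \<in> U \<Longrightarrow> w \<in> U \<Longrightarrow> z \<noteq> w \<Longrightarrow> (\<And>j. j < i \<Longrightarrow> z \<bullet> b j = w \<bullet> b j) \<Longrightarrow>
      joinable U (b i) \<kappa> z w"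
  shows "\<exists>g C N. Lp_fun p g \<and> 0 \<le> C \<and> N \<in> null_sets lborel \<and>
    (\<forall>z\<in>U - N. \<forall>w\<in>U - N. pointwise_le u C g z w)"
proof -
  have "\<exists>g C N. Lp_fun p g \<and> 0 \<le> C \<and> N \<in> null_sets lborel \<and> (\<forall>z\<in>U - N. \<forall>w\<in>U - N.
      (\<forall>j<n - m. z \<bullet> b j = w \<bullet> b j) \<longrightarrow> pointwise_le u C g z w)" if "m \<le> n" for m
    using that
  proof (induction m)
    case 0
    have zw: "z = w" if "\<forall>j<n. z \<bullet> b j = w \<bullet> b j" for z w
    proof (rule euclidean_eqI)
      fix x :: 'a assume "x \<in> Basis"
      then obtain j where "j < n" "x = b j" using b by (auto simp: bij_betw_def)
      then show "z \<bullet> x = w \<bullet> x" using that by simp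
    qed
    have "Lp_fun p F \<and> (0::real) \<le> 0 \<and> {} \<in> null_sets (lborel :: 'a measure)" using F by simp
    then show ?case by (intro exI[of _ F] exI[of _ "0::real"] exI[of _ "{}"]) (auto dest: zw)
  next
    case (Suc m)
    then obtain g C N where IH: "Lp_fun p g" "0 \<le> C" "N \<in> null_sets lborel"
      "\<And>z w. z \<in> U - N \<Longrightarrow> w \<in> U - N \<Longrightarrow> (\<And>j. j < n - m \<Longrightarrow> z \<bullet> b j = w \<bullet> b j) \<Longrightarrow>
        pointwise_le u C g z w"
      by (metis Suc_leD)
    define i where "i = n - Suc m"
    have i: "i < n" "n - m = Suc i" using Suc.prems by (auto simp: i_def)
    have bi: "b i \<in> Basis" using b i by (auto simp: bij_betw_def)
    have orth: "b i \<bullet> b j = 0" if "j < i" for j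
    proof -
      have "b j \<in> Basis" "b i \<noteq> b j"
        using b i that by (auto simp: bij_betw_def dest: inj_onD)
      then show ?thesis using bi by (simp add: inner_not_same_Basis)
    qed
    obtain g' C' N' where s: "Lp_fun p g'" "0 \<le> C'" "N' \<in> null_sets lborel"
    and step: "\<And>z w \<alpha> \<beta>. z \<in> U - N' \<Longrightarrow> w \<in> U - N' \<Longrightarrow> \<kappa> * norm (z - w) \<le> \<beta> - \<alpha> \<Longrightarrow>
      (\<And>s y. s \<in> {\<alpha><..<\<beta>} \<Longrightarrow> y = z \<or> y = w \<Longrightarrow> movable U (b i) (norm (z - w)) s y) \<Longrightarrow>
      (\<And>z' w'. z' \<in> U - N \<Longrightarrow> w' \<in> U - N \<Longrightarrow> z' - w' = (z - w) - ((z - w) \<bullet> b i) *\<^sub>R b i \<Longrightarrow>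
         pointwise_le u C g z' w') \<Longrightarrow>
      pointwise_le u C' g' z w"
      using join_step[OF bi p F IH(1-3) \<kappa> diam incr[OF bi]] by blast
    have "pointwise_le u C' g' z w"
      if z: "z \<in> U - N'" and w: "w \<in> U - N'" and eq: "\<forall>j<i. z \<bullet> b j = w \<bullet> b j" for z w
    proof (cases "z = w")
      case False
      obtain \<alpha> \<beta> where ab: "\<kappa> * norm (z - w) \<le> \<beta> - \<alpha>"
        "\<forall>s\<in>{\<alpha><..<\<beta>}. \<forall>y\<in>{z, w}. movable U (b i) (norm (z - w)) s y"
        using join[OF i(1) _ _ False] z w eq by auto
      show ?thesis
      proof (rule step[OF z w ab(1)])
        fix z' w' assume z': "z' \<in> U - N" and w': "w' \<in> U - N" and diff: "z' - w' = (z - w) - ((z - w) \<bullet> b i) *\<^sub>R b i"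
        show "pointwise_le u C g z' w'"
        proof (rule IH(4)[OF z' w'])
          fix j assume "j < n - m"
          then have "j < i \<or> j = i" using i by auto
          then have "((z - w) - ((z - w) \<bullet> b i) *\<^sub>R b i) \<bullet> b j = 0"
            using eq orth bi by (auto simp: inner_diff_left)
          then show "z' \<bullet> b j = w' \<bullet> b j" unfolding diff[symmetric] by (simp add: inner_diff_left)
        qed
      qed (use ab(2) in auto)
    qed simp
    then show ?case using s unfolding i_def by blast
  qed
  from this[of n] show ?thesis by simp
qed

section \<open>The two inclusions\<close>

text \<open>Vanishing off \<open>U\<close> lets integrals over \<open>U\<close> be taken over the
  whole space, where translations, Fubini and the maximal function are available.\<close>

definition borel_version :: "'a::euclidean_space set \<Rightarrow> ('a \<Rightarrow> real) \<Rightarrow> ('a \<Rightarrow> real) \<Rightarrow> bool" where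
  "borel_version U f f' \<longleftrightarrow> f \<in> borel_measurable (lebesgue_on U) \<and> f' \<in> borel_measurable borel \<and>
     (\<forall>x. x \<notin> U \<longrightarrow> f' x = 0) \<and> (AE x in lborel. x \<in> U \<longrightarrow> f' x = f x)"

lemma borel_measurable_lebesgue_on:
  fixes f :: "'a::euclidean_space \<Rightarrow> 'b::euclidean_space"
  shows "f \<in> borel_measurable borel \<Longrightarrow> f \<in> borel_measurable (lebesgue_on U)"
  by (intro measurable_restrict_space1 measurable_completion) auto

lemma borel_version_integral:
  fixes f f' w :: "'a::euclidean_space \<Rightarrow> real"
  assumes U: "open U" and f: "borel_version U f f'" and w: "w \<in> borel_measurable borel"
  shows "(LINT x|lebesgue_on U. f x * w x) = (LBINT x. f' x * w x)"
proof -
  have fm: "f \<in> borel_measurable (lebesgue_on U)"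
    and [measurable]: "f' \<in> borel_measurable borel" and off: "\<And>x. x \<notin> U \<Longrightarrow> f' x = 0"
    and eq: "AE x in lborel. x \<in> U \<longrightarrow> f' x = f x"
    using f by (auto simp: borel_version_def)
  have "(LINT x|lebesgue_on U. f x * w x) = (LINT x|lebesgue. (if x \<in> U then f x * w x else 0))"
    using U by (subst integral_restrict_space)
      (auto simp: indicator_def if_distrib intro!: LBINT_cong)
  also have "\<dots> = (LINT x|lebesgue. f' x * w x)"
  proof (rule integral_cong_AE)
    show "(\<lambda>x. if x \<in> U then f x * w x else 0) \<in> borel_measurable lebesgue"
      using U by (intro borel_measurable_if_I borel_measurable_times fm borel_measurable_lebesgue_on[OF w]) auto
    show "(\<lambda>x. f' x * w x) \<in> borel_measurable lebesgue" using w by (intro measurable_completion) auto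
    show "AE x in lebesgue. (if x \<in> U then f x * w x else 0) = f' x * w x"
      unfolding AE_completion_iff using eq by eventually_elim (auto simp: off)
  qed
  also have "\<dots> = (LBINT x. f' x * w x)" using w by (intro integral_completion) auto
  finally show ?thesis .
qed

text \<open>Boundedness of \<open>U\<close> gives integrability: t \<le> 1 + t^q for finite p, with
  the 1 integrated only over \<open>U\<close>, and a bounded function on a set of finite measure for
  p infinite.\<close>

lemma Lp_space_borel_version:
  fixes f :: "'a::euclidean_space \<Rightarrow> real"
  assumes U: "open U" "bounded U" and p: "1 < p" and f: "f \<in> Lp_space p U"
  shows "\<exists>f'. borel_version U f f' \<and> Lp_fun p (\<lambda>x. \<bar>f' x\<bar>) \<and> integrable lborel f'"
proof -
  have Ub [measurable]: "U \<in> sets borel" using U by auto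
  have mf: "f \<in> borel_measurable (lebesgue_on U)" using f by (simp add: Lp_space_def)
  have "(\<lambda>x. if x \<in> U then f x else 0) \<in> borel_measurable lebesgue"
    using U by (intro borel_measurable_if_I mf) auto
  from completion_ex_borel_measurable_real[OF this]
  obtain h where h: "h \<in> borel_measurable borel" and eq: "AE x in lborel. (if x \<in> U then f x else 0) = h x"
    by auto
  define f' where "f' x = (if x \<in> U then h x else 0)" for x
  have m [measurable]: "f' \<in> borel_measurable borel" unfolding f'_def[abs_def] using h by measurable
  have off: "f' x = 0" if "x \<notin> U" for x using that by (simp add: f'_def)
  have eq': "AE x in lborel. x \<in> U \<longrightarrow> f' x = f x" using eq by eventually_elim (auto simp: f'_def)
  have fin: "emeasure lborel U < \<infinity>" using emeasure_bounded_finite[OF U(2)] .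
  have "Lp_fun p (\<lambda>x. \<bar>f' x\<bar>) \<and> integrable lborel f'"
  proof (cases "p = \<infinity>")
    case True
    then obtain C where "AE x in lebesgue_on U. norm (f x) \<le> C" using f by (auto simp: Lp_space_def)
    then have "AE x in lborel. x \<in> U \<longrightarrow> norm (f x) \<le> C"
      using U by (subst (asm) AE_restrict_space_iff) (auto simp: AE_completion_iff)
    with eq' have b: "AE x in lborel. \<bar>f' x\<bar> \<le> \<bar>C\<bar> * indicator U x"
    proof eventually_elim
      case (elim x)
      then show ?case by (cases "x \<in> U") (auto simp: off)
    qed
    have "integrable lborel f'"
    proof (rule LBINT_bound)
      show "integrable lborel (\<lambda>x. \<bar>C\<bar> * indicator U x)"
        using fin by (intro integrable_mult_right integrable_real_indicator) auto
      show "AE x in lborel. norm (f' x) \<le> norm (\<bar>C\<bar> * indicator U x)"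
        using b by eventually_elim auto
    qed measurable
    moreover have "AE x in lborel. \<bar>f' x\<bar> \<le> \<bar>C\<bar>"
      using b by eventually_elim (auto split: split_indicator_asm)
    ultimately show ?thesis using True by (auto simp: Lp_fun_def)
  next
    case False
    define q where "q = enn2real p"
    have q: "1 < q" using enn2real_gt_1[OF p False] by (simp add: q_def)
    have "integrable (lebesgue_on U) (\<lambda>x. norm (f x) powr q)" using f False by (simp add: Lp_space_def q_def)
    then have "(\<integral>\<^sup>+x. ennreal (norm (f x) powr q) \<partial>lebesgue_on U) < \<infinity>"
      by (simp add: integrable_iff_bounded)
    also have "(\<integral>\<^sup>+x. ennreal (norm (f x) powr q) \<partial>lebesgue_on U) =
        (\<integral>\<^sup>+x. ennreal (norm (f x) powr q) * indicator U x \<partial>lborel)"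
      using U by (subst nn_integral_restrict_space) (auto simp: nn_integral_completion)
    also have "\<dots> = (\<integral>\<^sup>+x. ennreal (\<bar>f' x\<bar> powr q) \<partial>lborel)"
      using eq' by (intro nn_integral_cong_AE, eventually_elim) (auto simp: off split: split_indicator)
    finally have finp: "(\<integral>\<^sup>+x. ennreal (\<bar>f' x\<bar> powr q) \<partial>lborel) < \<infinity>" .
    have "integrable lborel f'"
    proof (rule integrableI_bounded)
      have "(\<integral>\<^sup>+x. ennreal (norm (f' x)) \<partial>lborel) \<le> (\<integral>\<^sup>+x. indicator U x + ennreal (\<bar>f' x\<bar> powr q) \<partial>lborel)"
      proof (intro nn_integral_mono)
        fix x
        have "\<bar>f' x\<bar> \<le> 1 + \<bar>f' x\<bar> powr q"
        proof (cases "\<bar>f' x\<bar> \<le> 1")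
          case False
          then have "\<bar>f' x\<bar> powr 1 \<le> \<bar>f' x\<bar> powr q" using q by (intro powr_mono) auto
          then show ?thesis using False by simp
        qed (simp add: add_increasing2)
        then show "ennreal (norm (f' x)) \<le> indicator U x + ennreal (\<bar>f' x\<bar> powr q)"
          by (cases "x \<in> U") (auto simp: off ennreal_leI simp flip: ennreal_1 ennreal_plus)
      qed
      also have "\<dots> = emeasure lborel U + (\<integral>\<^sup>+x. ennreal (\<bar>f' x\<bar> powr q) \<partial>lborel)"
        by (subst nn_integral_add) auto
      also have "\<dots> < \<infinity>" using fin finp by simp
      finally show "(\<integral>\<^sup>+x. ennreal (norm (f' x)) \<partial>lborel) < \<infinity>" .
    qed measurable
    then show ?thesis using finp False by (simp add: Lp_fun_def q_def)
  qed
  moreover have "borel_version U f f'" unfolding borel_version_def using mf m off eq' by blast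
  ultimately show ?thesis by blast
qed

lemma Lp_space_of_bound:
  fixes f :: "'a::euclidean_space \<Rightarrow> 'b::euclidean_space"
  assumes U: "open U" and p: "1 < p" and f: "f \<in> borel_measurable borel" and g: "Lp_fun p g"
    and le: "\<And>x. norm (f x) \<le> C * g x" and C: "0 \<le> C"
  shows "f \<in> Lp_space p U"
proof -
  have fl: "f \<in> borel_measurable (lebesgue_on U)" by (rule borel_measurable_lebesgue_on[OF f])
  have [measurable]: "g \<in> borel_measurable borel" and g0: "\<And>x. 0 \<le> g x" using g by (auto simp: Lp_fun_def)
  show ?thesis
  proof (cases "p = \<infinity>")
    case True
    then obtain K where K: "AE x in lborel. g x \<le> K" using g by (auto simp: Lp_fun_def)
    then have "AE x in lborel. norm (f x) \<le> C * K"
      by eventually_elim (rule order_trans[OF le mult_left_mono[OF _ C]])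
    then have "AE x in lebesgue_on U. norm (f x) \<le> C * K"
      using U by (subst AE_restrict_space_iff) (auto simp: AE_completion_iff elim: eventually_mono)
    then show ?thesis using True fl by (auto simp: Lp_space_def)
  next
    case False
    define q where "q = enn2real p"
    have q: "1 < q" using enn2real_gt_1[OF p False] by (simp add: q_def)
    have "integrable (lebesgue_on U) (\<lambda>x. norm (f x) powr q)"
    proof (rule integrableI_bounded)
      show "(\<lambda>x. norm (f x) powr q) \<in> borel_measurable (lebesgue_on U)" using fl by measurable
      have "(\<integral>\<^sup>+x. ennreal (norm (norm (f x) powr q)) \<partial>lebesgue_on U) =
          (\<integral>\<^sup>+x. ennreal (norm (f x) powr q) * indicator U x \<partial>lborel)"
        using U by (subst nn_integral_restrict_space) (auto simp: nn_integral_completion)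
      also have "\<dots> \<le> (\<integral>\<^sup>+x. ennreal (C powr q) * ennreal (g x powr q) \<partial>lborel)"
      proof (intro nn_integral_mono)
        fix x
        have "norm (f x) powr q \<le> (C * g x) powr q" using le[of x] q by (intro powr_mono2) auto
        also have "\<dots> = C powr q * g x powr q" using C g0 by (simp add: powr_mult)
        finally show "ennreal (norm (f x) powr q) * indicator U x \<le> ennreal (C powr q) * ennreal (g x powr q)"
          by (auto simp: ennreal_mult[symmetric] ennreal_leI split: split_indicator)
      qed
      also have "\<dots> = ennreal (C powr q) * (\<integral>\<^sup>+x. ennreal (g x powr q) \<partial>lborel)"
        by (rule nn_integral_cmult) measurable
      also have "\<dots> < \<infinity>" using g False by (simp add: Lp_fun_def q_def ennreal_mult_less_top)
      finally show "(\<integral>\<^sup>+x. ennreal (norm (norm (f x) powr q)) \<partial>lebesgue_on U) < \<infinity>" .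
    qed
    then show ?thesis using False fl by (simp add: Lp_space_def q_def)
  qed
qed

lemma Lp_space_component:
  fixes G :: "'a::euclidean_space \<Rightarrow> 'b::euclidean_space"
  assumes G: "G \<in> Lp_space p U" and b: "b \<in> Basis" and p: "1 < p"
  shows "(\<lambda>x. G x \<bullet> b) \<in> Lp_space p U"
proof -
  have [measurable]: "G \<in> borel_measurable (lebesgue_on U)" using G by (simp add: Lp_space_def)
  have m: "(\<lambda>x. G x \<bullet> b) \<in> borel_measurable (lebesgue_on U)" by measurable
  have le: "\<bar>G x \<bullet> b\<bar> \<le> norm (G x)" for x using Basis_le_norm[OF b] .
  show ?thesis
  proof (cases "p = \<infinity>")
    case True
    then obtain C where "AE x in lebesgue_on U. norm (G x) \<le> C" using G by (auto simp: Lp_space_def)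
    then have "AE x in lebesgue_on U. norm (G x \<bullet> b) \<le> C"
      \<comment> \<open>The component is bounded pointwise by the norm.\<close>
      by eventually_elim (use le order_trans in \<open>auto intro: order_trans\<close>)
    then show ?thesis using True m by (auto simp: Lp_space_def)
  next
    case False
    have q: "1 < enn2real p" by (rule enn2real_gt_1[OF p False])
    have "integrable (lebesgue_on U) (\<lambda>x. norm (G x \<bullet> b) powr enn2real p)"
    proof (rule LBINT_bound)
      show "integrable (lebesgue_on U) (\<lambda>x. norm (G x) powr enn2real p)"
        using G False by (simp add: Lp_space_def)
      show "AE x in lebesgue_on U. norm (norm (G x \<bullet> b) powr enn2real p) \<le> norm (norm (G x) powr enn2real p)"
        using le q by (intro AE_I2) (auto intro!: powr_mono2)
    qed measurable
    then show ?thesis using False m by (simp add: Lp_space_def)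
  qed
qed

lemma test_function_off_zero:
  assumes "\<phi> \<in> test_functions U" "x \<notin> U"
  shows "\<phi> x = 0"
  using assms closure_subset[of "{x. \<phi> x \<noteq> 0}"] by (auto simp: test_functions_def)

lemma hajlasz_M1_subset_sobolev_W1:
  fixes U :: "'a::euclidean_space set"
  assumes U: "open U" "bounded U" and p: "1 < p"
  shows "hajlasz_M1 p U \<subseteq> sobolev_W1 p U"
proof
  fix u assume u: "u \<in> hajlasz_M1 p U"
  then have uL: "u \<in> Lp_space p U" by (simp add: hajlasz_M1_def)
  obtain g E where gL: "g \<in> Lp_space p U" and g0: "\<And>z. z \<in> U \<Longrightarrow> 0 \<le> g z"
    and E: "E \<in> null_sets lebesgue"
    and haj: "\<And>y z. y \<in> U - E \<Longrightarrow> z \<in> U - E \<Longrightarrow> \<bar>u y - u z\<bar> \<le> norm (y - z) * (g y + g z)"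
    using u by (auto simp: hajlasz_M1_def hajlasz_gradients_def)
  obtain u' where u': "borel_version U u u'" "integrable lborel u'"
    using Lp_space_borel_version[OF U p uL] by blast
  have uu': "AE x in lborel. x \<in> U \<longrightarrow> u' x = u x" using u'(1) by (simp add: borel_version_def)
  obtain g' where g': "AE x in lborel. x \<in> U \<longrightarrow> g' x = g x" "Lp_fun p (\<lambda>x. \<bar>g' x\<bar>)" "integrable lborel g'"
    using Lp_space_borel_version[OF U p gL] by (auto simp: borel_version_def)
  have "AE x in lborel. x \<notin> E" using AE_not_in[OF E] by (simp add: AE_completion_iff)
  with uu' g'(1) have "AE x in lborel. x \<notin> E \<and> (x \<in> U \<longrightarrow> u' x = u x \<and> g' x = g x)"
    by eventually_elim auto
  then obtain N where N: "N \<in> null_sets lborel" "\<And>x. x \<notin> N \<Longrightarrow> x \<notin> E \<and> (x \<in> U \<longrightarrow> u' x = u x \<and> g' x = g x)"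
    by (rule AE_lborel_null_set) blast
  have haj': "\<bar>u' y - u' z\<bar> \<le> norm (y - z) * (\<bar>g' y\<bar> + \<bar>g' z\<bar>)" if "y \<in> U - N" "z \<in> U - N" for y z
    using haj[of y z] N(2)[of y] N(2)[of z] g0[of y] g0[of z] that by simp
  let ?Q = "\<lambda>b G. G \<in> borel_measurable borel \<and> (\<forall>x. \<bar>G x\<bar> \<le> 2 * \<bar>g' x\<bar>) \<and>
      (\<forall>\<phi>\<in>test_functions U. weak_partial u' b G \<phi>)"
  have "\<exists>G. ?Q b G" if "b \<in> Basis" for b
    unfolding Bex_def[symmetric]
    by (rule hajlasz_weak_derivative[OF U(1) u'(2) _ _ N(1) haj' that]) (use g'(3) in auto)
  then have "\<forall>b\<in>Basis. \<exists>G. ?Q b G" by (intro ballI)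
  from bchoice[OF this] obtain G where "\<forall>b\<in>Basis. ?Q b (G b)" by (elim exE)
  then have G: "\<And>b. b \<in> Basis \<Longrightarrow> G b \<in> borel_measurable borel"
    "\<And>b x. b \<in> Basis \<Longrightarrow> \<bar>G b x\<bar> \<le> 2 * \<bar>g' x\<bar>"
    "\<And>b \<phi>. b \<in> Basis \<Longrightarrow> \<phi> \<in> test_functions U \<Longrightarrow> weak_partial u' b (G b) \<phi>"
    by blast+
  define H where "H x = (\<Sum>b\<in>Basis. G b x *\<^sub>R b)" for x
  have Hb: "H x \<bullet> b = G b x" if "b \<in> Basis" for x b using that by (simp add: H_def)
  have HL: "H \<in> Lp_space p U"
  proof (rule Lp_space_of_bound[OF U(1) p _ g'(2)])
    show "H \<in> borel_measurable borel"
      unfolding H_def[abs_def] using G(1) by (intro borel_measurable_sum borel_measurable_scaleR) auto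
    show "norm (H x) \<le> (DIM('a) * 2) * \<bar>g' x\<bar>" for x
    proof -
      have "norm (H x) \<le> (\<Sum>b\<in>Basis. \<bar>H x \<bullet> b\<bar>)" by (rule norm_le_l1)
      also have "\<dots> \<le> (\<Sum>b\<in>(Basis::'a set). 2 * \<bar>g' x\<bar>)"
        using G(2) by (intro sum_mono) (simp add: Hb)
      finally show ?thesis by (simp add: mult.assoc)
    qed
  qed simp
  have "weak_gradient U u H"
    unfolding weak_gradient_def
  proof (intro ballI)
    fix \<phi> :: "'a \<Rightarrow> real" and b :: 'a assume \<phi>: "\<phi> \<in> test_functions U" and b: "b \<in> Basis"
    note m = test_function_directional(1,2)[OF \<phi>, THEN borel_measurable_continuous_onI]
    \<comment> \<open>A test function vanishes off \<open>U\<close>, so it is its own Borel version.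
      The integral of a partial derivative against \<phi> can thus be transferred with the roles
      exchanged, \<phi> being the function and \<open>G b\<close> the weight.\<close>
    have v: "borel_version U \<phi> \<phi>"
      using m(1) test_function_off_zero[OF \<phi>] by (auto simp: borel_version_def borel_measurable_lebesgue_on)
    have "(LINT x|lebesgue_on U. u x * directional \<phi> b x) = - (LBINT x. G b x * \<phi> x)"
      using borel_version_integral[OF U(1) u'(1) m(2)] G(3)[OF b \<phi>] by simp
    also have "(LBINT x. G b x * \<phi> x) = (LINT x|lebesgue_on U. (H x \<bullet> b) * \<phi> x)"
      using borel_version_integral[OF U(1) v G(1)[OF b]] by (simp add: Hb[OF b] mult.commute)
    finally show "(LINT x|lebesgue_on U. u x * directional \<phi> b x) =
        - (LINT x|lebesgue_on U. (H x \<bullet> b) * \<phi> x)" .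
  qed
  then show "u \<in> sobolev_W1 p U" using uL HL by (auto simp: sobolev_W1_def)
qed

lemma sobolev_W1_subset_hajlasz_M1:
  fixes U :: "'a::euclidean_space set" and b :: "nat \<Rightarrow> 'a"
  assumes U: "open U" "bounded U" and p: "1 < p" and b: "bij_betw b {..<n} Basis" and \<kappa>: "0 < \<kappa>"
    and join: "\<And>i z w. i < n \<Longrightarrow> z \<in> U \<Longrightarrow> w \<in> U \<Longrightarrow> z \<noteq> w \<Longrightarrow> (\<And>j. j < i \<Longrightarrow> z \<bullet> b j = w \<bullet> b j) \<Longrightarrow>
      joinable U (b i) \<kappa> z w"
  shows "sobolev_W1 p U \<subseteq> hajlasz_M1 p U"
proof
  fix u assume "u \<in> sobolev_W1 p U"
  then obtain G where uL: "u \<in> Lp_space p U" and GL: "G \<in> Lp_space p U" and weak: "weak_gradient U u G"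
    by (auto simp: sobolev_W1_def)
  obtain u' where u': "borel_version U u u'" "integrable lborel u'"
    using Lp_space_borel_version[OF U p uL] by blast
  have uu': "AE x in lborel. x \<in> U \<longrightarrow> u' x = u x" using u'(1) by (simp add: borel_version_def)
  let ?Q = "\<lambda>d f. borel_version U (\<lambda>x. G x \<bullet> d) f \<and> Lp_fun p (\<lambda>x. \<bar>f x\<bar>) \<and> integrable lborel f"
  have "\<forall>d\<in>Basis. \<exists>f. ?Q d f"
    using Lp_space_borel_version[OF U p Lp_space_component[OF GL _ p]] by (intro ballI)
  from bchoice[OF this] obtain H where "\<forall>d\<in>Basis. ?Q d (H d)" by (elim exE)
  then have H: "\<And>d. d \<in> Basis \<Longrightarrow> borel_version U (\<lambda>x. G x \<bullet> d) (H d)"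
    "\<And>d. d \<in> Basis \<Longrightarrow> Lp_fun p (\<lambda>x. \<bar>H d x\<bar>)" "\<And>d. d \<in> Basis \<Longrightarrow> integrable lborel (H d)"
    by blast+
  \<comment> \<open>A single majorant of all partial derivatives, so that the same \<open>F\<close>
    enters at every step of the induction over directions.\<close>
  define F where "F x = (\<Sum>d\<in>Basis. \<bar>H d x\<bar>)" for x
  have "Lp_fun p (\<lambda>x. \<Sum>d\<in>D. \<bar>H d x\<bar>)" if "finite D" "D \<subseteq> Basis" for D
    using that
  proof (induction D)
    case empty
    then show ?case by (auto simp: Lp_fun_def intro!: exI[of _ 0])
  next
    case (insert d D)
    then show ?case using Lp_fun_add[OF H(2)[of d] _ p] by simp
  qed
  then have F: "Lp_fun p F" unfolding F_def[abs_def] by simp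
  have HF: "\<bar>H d x\<bar> \<le> F x" if "d \<in> Basis" for d x
    unfolding F_def using that by (intro member_le_sum) auto
  have weak': "weak_partial u' d (H d) \<phi>"
    if \<phi>: "\<phi> \<in> test_functions U" and d: "d \<in> Basis" for \<phi> d
  proof -
    note m = test_function_directional(1,2)[OF \<phi>, THEN borel_measurable_continuous_onI]
    show ?thesis
      using borel_version_integral[OF U(1) u'(1) m(2), of d] borel_version_integral[OF U(1) H(1)[OF d] m(1)]
        weak \<phi> d by (simp add: weak_gradient_def)
  qed
  obtain R where R: "\<And>z. z \<in> U \<Longrightarrow> norm z \<le> R" using U(2) by (auto simp: bounded_iff)
  have "\<exists>g C N. Lp_fun p g \<and> 0 \<le> C \<and> N \<in> null_sets lborel \<and>
    (\<forall>z\<in>U - N. \<forall>w\<in>U - N. pointwise_le u' C g z w)"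
  proof (rule hajlasz_of_joining[OF b p F \<kappa>])
    show "norm (z - w) \<le> 2 * R" if "z \<in> U" "w \<in> U" for z w
      using R[OF that(1)] R[OF that(2)] norm_triangle_ineq4[of z w] by linarith
    show "AE z in lborel. AE t in lborel. increment_le U u' F d z t"
      if "d \<in> Basis" for d
      using F by (intro AE_increment_bound[OF U(1) that u'(2) H(3)[OF that] weak'[OF _ that] _ HF[OF that]])
        (auto simp: Lp_fun_def)
  qed (use join in auto)
  then obtain g C N where g: "Lp_fun p g" and C: "0 \<le> C" and N: "N \<in> null_sets lborel"
    and haj: "\<And>z w. z \<in> U - N \<Longrightarrow> w \<in> U - N \<Longrightarrow> pointwise_le u' C g z w"
    by blast
  have gm: "g \<in> borel_measurable borel" and g0: "\<And>x. 0 \<le> g x" using g by (auto simp: Lp_fun_def)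
  have "AE x in lborel. x \<notin> N \<and> (x \<in> U \<longrightarrow> u' x = u x)"
    using uu' AE_not_in[OF N] by eventually_elim auto
  then obtain N' where N': "N' \<in> null_sets lborel" "\<And>x. x \<notin> N' \<Longrightarrow> x \<notin> N \<and> (x \<in> U \<longrightarrow> u' x = u x)"
    by (rule AE_lborel_null_set) blast
  \<comment> \<open>The constant of the pointwise estimate is absorbed into the gradient.\<close>
  have "(\<lambda>x. C * g x) \<in> Lp_space p U"
    using gm C g0 by (intro Lp_space_of_bound[OF U(1) p _ g, of _ C]) auto
  moreover have "U \<inter> N' \<in> null_sets lebesgue"
    using null_sets_completion_subset[OF _ null_sets_completionI[OF N'(1)]] by blast
  moreover have "\<bar>u y - u z\<bar> \<le> norm (y - z) * (C * g y + C * g z)" if "y \<in> U - (U \<inter> N')" "z \<in> U - (U \<inter> N')" for y z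
    using haj[of y z] N'(2)[of y] N'(2)[of z] that by (simp add: algebra_simps)
  ultimately have "(\<lambda>x. C * g x) \<in> hajlasz_gradients p U u"
    using C g0 unfolding hajlasz_gradients_def by (intro CollectI conjI exI[of _ "U \<inter> N'"]) auto
  then show "u \<in> hajlasz_M1 p U" using uL by (auto simp: hajlasz_M1_def)
qed

lemma mem_vectors_of:
  fixes e :: "nat \<Rightarrow> 'n::finite"
  assumes "CARD('n) = n"
  shows "z \<in> vectors_of e (Omega I \<psi> c n) \<longleftrightarrow> in_Omega I \<psi> c n (\<lambda>j. z $ e j)"
  using assms by (simp add: vectors_of_def in_Omega_def)

context cuspidal
begin

section \<open>Transfer of the geometry from coordinate functions to vectors\<close>

lemma open_vectors_of:
  fixes e :: "nat \<Rightarrow> 'n::finite"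
  assumes n: "1 \<le> n" "CARD('n) = n"
  shows "open (vectors_of e (Omega I \<psi> c n))"
  unfolding open_dist
proof
  fix z assume "z \<in> vectors_of e (Omega I \<psi> c n)"
  then have "dom n (\<lambda>j. z $ e j)" by (simp add: mem_vectors_of[OF n(2)])
  then obtain \<delta> where \<delta>: "0 < \<delta>" "\<And>h. \<forall>j<n. \<bar>h j - z $ e j\<bar> < \<delta> \<Longrightarrow> dom n h"
    using dom_open[of n "\<lambda>j. z $ e j"] n(1) by auto
  have "y \<in> vectors_of e (Omega I \<psi> c n)" if "dist y z < \<delta>" for y
  proof -
    have "\<bar>y $ e j - z $ e j\<bar> < \<delta>" for j
      using component_le_norm_cart[of "y - z" "e j"] that by (simp add: dist_norm)
    then show ?thesis using \<delta>(2) by (simp add: mem_vectors_of[OF n(2)])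
  qed
  then show "\<exists>\<delta>>0. \<forall>y. dist y z < \<delta> \<longrightarrow> y \<in> vectors_of e (Omega I \<psi> c n)"
    using \<delta>(1) by blast
qed

lemma sum_coordinates:
  fixes e :: "nat \<Rightarrow> 'n::finite" and f :: "'n \<Rightarrow> real"
  assumes "bij_betw e {0..<n} UNIV"
  shows "(\<Sum>i\<in>UNIV. f i) = (\<Sum>j<n. f (e j))"
  using sum.reindex_bij_betw[OF assms, of f] by (simp add: lessThan_atLeast0)

lemma bounded_vectors_of:
  fixes e :: "nat \<Rightarrow> 'n::finite"
  assumes n: "1 \<le> n" "CARD('n) = n" and e: "bij_betw e {0..<n} UNIV"
  shows "bounded (vectors_of e (Omega I \<psi> c n))"
proof -
  obtain B where B: "\<And>f j. dom n f \<Longrightarrow> j < n \<Longrightarrow> \<bar>f j\<bar> \<le> B"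
    using dom_bounded[of n] n by auto
  have "norm z \<le> n * B" if "z \<in> vectors_of e (Omega I \<psi> c n)" for z
  proof -
    have "norm z \<le> (\<Sum>j<n. \<bar>z $ e j\<bar>)"
      using norm_le_l1_cart[of z] by (simp add: sum_coordinates[OF e])
    also have "\<dots> \<le> (\<Sum>j<n. B)"
      using that B by (intro sum_mono) (auto simp: mem_vectors_of[OF n(2)])
    finally show ?thesis by simp
  qed
  then show ?thesis by (auto simp: bounded_iff)
qed

text \<open>The Euclidean distance dominates every coordinate difference and is at most their sum,
  so it is an admissible \<open>d\<close> in \<open>joining_interval\<close>.\<close>

lemma vectors_of_joining:
  fixes e :: "nat \<Rightarrow> 'n::finite"
  assumes n: "1 \<le> n" "CARD('n) = n" and e: "bij_betw e {0..<n} UNIV"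
  defines "U \<equiv> vectors_of e (Omega I \<psi> c n)" and "b \<equiv> \<lambda>j. axis (e j) (1::real)"
  shows "\<exists>\<kappa>>0. \<forall>i z w. i < n \<longrightarrow> z \<in> U \<longrightarrow> w \<in> U \<longrightarrow> z \<noteq> w \<longrightarrow> (\<forall>j<i. z \<bullet> b j = w \<bullet> b j) \<longrightarrow>
    (joinable U (b i) \<kappa> z w)"
proof -
  have zb: "z \<bullet> b j = z $ e j" for z j by (simp add: b_def inner_axis)
  obtain \<kappa> where \<kappa>: "0 < \<kappa>" and join: "\<And>i z w d. i < n \<Longrightarrow> dom n z \<Longrightarrow> dom n w \<Longrightarrow> \<forall>j<i. z j = w j \<Longrightarrow>
    \<forall>j<n. \<bar>z j - w j\<bar> \<le> d \<Longrightarrow> d \<le> (\<Sum>j<n. \<bar>z j - w j\<bar>) \<Longrightarrow> 0 < d \<Longrightarrow>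
    joined (\<kappa> * d) i z w d"
    using joining_interval by blast
  have in_U: "y + t *\<^sub>R b i \<in> U" if i: "i < n" and y: "joins i (\<lambda>j. y $ e j) d s" and t: "t \<in> closed_segment 0 (s - y $ e i)"
    for i y t d s
  proof -
    have "y $ e i + t \<in> closed_segment (y $ e i) s"
      using t by (auto simp: closed_segment_eq_real_ivl split: if_splits)
    then have "dom n ((\<lambda>j. y $ e j)(i := y $ e i + t))" using y by (simp add: joins_def)
    moreover have "dom n ((\<lambda>j. y $ e j)(i := y $ e i + t)) = dom n (\<lambda>j. (y + t *\<^sub>R b i) $ e j)"
    proof (rule in_Omega_cong)
      fix j assume "j < n"
      \<comment> \<open>Injectivity of the enumeration makes adding a multiple of the axis vector
        the same as updating the single coordinate \<open>i\<close>.\<close>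
      then have "e j = e i \<longleftrightarrow> j = i" using e i by (auto simp: bij_betw_def inj_on_eq_iff)
      then show "((\<lambda>j. y $ e j)(i := y $ e i + t)) j = (y + t *\<^sub>R b i) $ e j"
        by (auto simp: b_def axis_def)
    qed
    ultimately show ?thesis by (simp add: U_def mem_vectors_of[OF n(2)])
  qed
  show ?thesis
  proof (rule exI[of _ \<kappa>], intro conjI allI impI \<kappa>)
    fix i z w assume i: "i < n" and z: "z \<in> U" and w: "w \<in> U" and ne: "z \<noteq> w" and eq: "\<forall>j<i. z \<bullet> b j = w \<bullet> b j"
    have le: "\<bar>z $ e j - w $ e j\<bar> \<le> norm (z - w)" for j
      using component_le_norm_cart[of "z - w" "e j"] by simp
    have sum: "norm (z - w) \<le> (\<Sum>j<n. \<bar>z $ e j - w $ e j\<bar>)"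
      using norm_le_l1_cart[of "z - w"] by (simp add: sum_coordinates[OF e])
    obtain \<alpha> \<beta> where ab: "\<kappa> * norm (z - w) \<le> \<beta> - \<alpha>"
      "\<And>s. s \<in> {\<alpha><..<\<beta>} \<Longrightarrow> joins i (\<lambda>j. z $ e j) (norm (z - w)) s \<and> joins i (\<lambda>j. w $ e j) (norm (z - w)) s"
      using join[OF i, of "\<lambda>j. z $ e j" "\<lambda>j. w $ e j" "norm (z - w)"] z w eq ne le sum
      by (auto simp: U_def mem_vectors_of[OF n(2)] zb)
    show "joinable U (b i) \<kappa> z w"
    proof (rule exI[of _ \<alpha>], rule exI[of _ \<beta>], intro conjI[OF ab(1)] ballI)
      fix s y assume s: "s \<in> {\<alpha><..<\<beta>}" and "y \<in> {z, w}"
      then have j: "joins i (\<lambda>j. y $ e j) (norm (z - w)) s" using ab(2)[OF s] by auto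
      then have "\<bar>s - y \<bullet> b i\<bar> \<le> 2 * norm (z - w)" by (simp add: joins_def zb)
      moreover have "\<forall>t\<in>closed_segment 0 (s - y \<bullet> b i). y + t *\<^sub>R b i \<in> U"
        unfolding zb using in_U[OF i j] by blast
      ultimately show "movable U (b i) (norm (z - w)) s y" by blast
    qed
  qed
qed

end

theorem corollary1p4:
  fixes n :: nat
    and I :: "real set"
    and \<psi> :: "nat \<Rightarrow> real \<Rightarrow> real"
    and c :: "nat \<Rightarrow> real list"
    and e :: "nat \<Rightarrow> 'n::finite"
    and p :: ennreal
  assumes "n \<ge> 2"
    and "CARD('n) = n"
    and "bij_betw e {0..<n} (UNIV :: 'n set)"
    and "is_interval I" and "open I" and "bounded I" and "0 \<in> I"
    and "\<And>i t. i \<in> {1..n} \<Longrightarrow> t \<in> {0<..1} \<Longrightarrow> \<psi> i t > 0"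
    and "\<And>i. i \<in> {1..n} \<Longrightarrow> mono_on {0<..1} (\<psi> i)"
    and "\<And>i t. i \<in> {1..n} \<Longrightarrow> t \<in> {0<..1} \<Longrightarrow> continuous (at_left t) (\<psi> i)"
    and "\<And>i. i \<in> {2..n} \<Longrightarrow> star_center (Omega I \<psi> c (i - 1)) (c (i - 1))"
    and "1 < p"
  shows "sobolev_W1 p (vectors_of e (Omega I \<psi> c n)) = hajlasz_M1 p (vectors_of e (Omega I \<psi> c n))"
proof -
  interpret cuspidal I \<psi> c n
    using assms(4-6,8-11) by unfold_locales auto
  let ?U = "vectors_of e (Omega I \<psi> c n)" and ?b = "\<lambda>j. axis (e j) (1::real)"
  have n: "1 \<le> n" using assms(1) by simp
  have U: "open ?U" "bounded ?U"
    using open_vectors_of[OF n assms(2)] bounded_vectors_of[OF n assms(2,3)] by auto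
  have b: "bij_betw ?b {..<n} Basis"
  proof -
    have "bij_betw (\<lambda>i. axis i (1::real)) (UNIV :: 'n set) Basis"
      by (auto simp: bij_betw_def inj_on_def axis_eq_axis Basis_vec_def)
    from bij_betw_trans[OF assms(3) this] show ?thesis by (simp add: comp_def lessThan_atLeast0)
  qed
  obtain \<kappa> where \<kappa>: "0 < \<kappa>" and join: "\<And>i z w. i < n \<Longrightarrow> z \<in> ?U \<Longrightarrow> w \<in> ?U \<Longrightarrow> z \<noteq> w \<Longrightarrow>
      \<forall>j<i. z \<bullet> ?b j = w \<bullet> ?b j \<Longrightarrow>
      joinable ?U (?b i) \<kappa> z w"
    using vectors_of_joining[OF n assms(2,3)] by blast
  have "sobolev_W1 p ?U \<subseteq> hajlasz_M1 p ?U"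
    by (rule sobolev_W1_subset_hajlasz_M1[OF U assms(12) b \<kappa>]) (rule join; blast)
  with hajlasz_M1_subset_sobolev_W1[OF U assms(12)] show ?thesis by (rule subset_antisym[rotated])
qed

end
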